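(* Let $\alpha\in(0,1)$, $\theta<1$, $p=1-\theta$, $0\le a<T<\infty$, and $\Omega=\{(x,t): 0<x<1,\ a<t\le T\}$. Let the following conditions be fulfilled: 1. $0<\beta<1$; 2. $\varphi,\ A\varphi\in \dot W^{1}_{2,\beta}(0,1)$; 3. $f,\ Af\in C([a,T],\dot W^{1}_{2,\beta}(0,1))$. Let $\{v_k\}_{k\ge1}$, $\{\lambda_k\}_{k\ge1}$ be the eigenfunctions (orthonormal in $L^2(0,1)$) and eigenvalues of $A$, let $\varphi_k=\int_0^1\varphi(x)v_k(x)\,dx$, $f_k(t)=\int_0^1 f(x,t)v_k(x)\,dx$, $\lambda_k^*=-\lambda_k/p^{\alpha}$, and $$u_k(t)=\varphi_kE_{\alpha,1}\big(\lambda_k^*(t^p-a^p)^{\alpha}\big)+\frac{1}{p^{\alpha}\Gamma(\alpha)}\int_a^t(t^p-\tau^p)^{\alpha-1}f_k(\tau)\,d(\tau^p)+\frac{\lambda_k^*}{p^{\alpha}}\int_a^t(t^p-\tau^p)^{2\alpha-1}E_{\alpha,2\alpha}\big(\lambda_k^*(t^p-\tau^p)^{\alpha}\big)f_k(\tau)\,d(\tau^p).$$ Then the function $u(x,t)=\sum_{k=1}^{\infty}u_k(t)v_k(x)$ is a classical solution of the problem $$\mathcal{D}^{\alpha}_t u(x,t)-\frac{\partial}{\partial x}\Big(x^{\beta}\frac{\partial u(x,t)}{\partial x}\Big)=f(x,t)\ \text{ in }\Omega,\qquad u(x,a+)=\varphi(x)\ (0\le x\le1),\qquad u(0,t)=u(1,t)=0\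 (a\le t\le T),$$ where $\mathcal{D}^{\alpha}_t$ is the regularized Caputo-like counterpart of the hyper-Bessel fractional derivative with starting point $a$.
   Context: All functions are real-valued. $E_{\alpha,\gamma}(z)=\sum_{k\ge0} z^k/\Gamma(\alpha k+\gamma)$ is the two-parameter Mittag-Leffler function. Integrals $\int\cdots d(\tau^p)$ mean $\int\cdots p\tau^{p-1}d\tau$. Fractional derivative. For $\theta<1$, $p=1-\theta$, $0<\alpha<1$, $t>a\ge0$, and a function $g$ of $t$, define the Erdélyi–Kober integral $I^{\gamma,\delta}_{p;a+}g(t)=\frac{t^{-p(\gamma+\delta)}}{\Gamma(\delta)}\int_a^t(t^p-\tau^p)^{\delta-1}\tau^{p\gamma}g(\tau)\,d(\tau^p)$ ($\delta>0$), and for negative order $$I^{0,-\alpha}_{p;a+}g(t):=D^{-\alpha,\alpha}_{p;a+}g(t)=\Big(1-\alpha+\frac{t}{p}\frac{d}{dt}\Big)I^{0,1-\alpha}_{p;a+}g(t).$$ The hyper-Bessel derivative is $p^{\alpha}t^{-p\alpha}I^{0,-\alpha}_{p;a+}g(t)$, and its regularized Caputo-like counterpart is $$\mathcal{D}^{\alpha}_t g(t)=p^{\alpha}t^{-p\alpha}I^{0,-\alpha}_{p;a+}g(t)-\frac{p^{\alpha}g(a)\,(t^{p}-a^{p})^{-\alpha}}{\Gamma(1-\alpha)}.$$ It acts on $u(x,t)$ in the variable $t$ with $x$ fixed. Operator $A$ and spaces, for $0<\beta<1$. $Av=-(x^{\beta}v')'$, with initial domain $D(A)$ consisting of the $v\in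 C[0,1]$ with $x^{\beta}v'\in C[0,1]$, $(x^{\beta}v')'\in AC[0,1]$, $Av\in L^2(0,1)$, $v(0)=v(1)=0$. This operator is symmetric and positive definite in $L^2(0,1)$, and its Friedrichs extension is again denoted by $A$; it has discrete spectrum, with eigenvalues $\lambda_k>0$ (counted with multiplicity) and eigenfunctions $v_k$ forming a complete orthonormal system in $L^2(0,1)$. $\dot W^1_{2,\beta}(0,1)$ is the closure of $D(A)$ in the norm $\|v\|^2=\int_0^1[v^2+x^{\beta}(v')^2]\,dx$. $A$ acts on functions of $(x,t)$ in the variable $x$. $C([a,T],V)$ denotes continuous functions from $[a,T]$ to the Banach space $V$. Classical solution: a function $u\in C(\overline\Omega)$ such that $\mathcal{D}^{\alpha}_t u$ and $Au=-\frac{\partial}{\partial x}(x^{\beta}\frac{\partial u}{\partial x})$ belong to $C(\Omega)$, and $u$ satisfies the equation in $\Omega$, the initial condition and the boundary conditions stated in the claim. *)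

theory Defs
  imports "HOL-Analysis.Analysis"
begin

definition mittag_leffler :: "real \<Rightarrow> real \<Rightarrow> real \<Rightarrow> real" where
  "mittag_leffler \<alpha> \<gamma> z = (\<Sum>k. z ^ k / Gamma (\<alpha> * real k + \<gamma>))"


subsection \<open>Hyper-Bessel fractional derivatives\<close>

text \<open>An integral with respect to \<open>\<tau>\<^sup>p\<close> is written out with the weight \<open>p * \<tau> powr (p - 1)\<close>. The
  conventions \<open>0 powr s = 0\<close> at \<open>\<tau> = t\<close> and at \<open>\<tau> = 0\<close> concern null sets only.\<close>

definition EK_integral ::
    "real \<Rightarrow> real \<Rightarrow> real \<Rightarrow> real \<Rightarrow> (real \<Rightarrow> real) \<Rightarrow> real \<Rightarrow> real" where
  "EK_integral \<gamma> \<delta> p a g t =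
     t powr (- p * (\<gamma> + \<delta>)) / Gamma \<delta> *
     (LINT \<tau>:{a..t}|lebesgue.
        (t powr p - \<tau> powr p) powr (\<delta> - 1) * \<tau> powr (p * \<gamma>) * g \<tau> * (p * \<tau> powr (p - 1)))"

text \<open>Functions of time are given on \<open>[a, T]\<close> only, so the time derivative is taken within
  \<open>{a..T}\<close>: it is the ordinary derivative for \<open>a < t < T\<close> and the left one at \<open>t = T\<close>.\<close>

definition EK_derivative ::
    "real \<Rightarrow> real \<Rightarrow> real \<Rightarrow> real \<Rightarrow> (real \<Rightarrow> real) \<Rightarrow> real \<Rightarrow> real" where
  "EK_derivative \<alpha> p a T g t =
     (1 - \<alpha>) * EK_integral 0 (1 - \<alpha>) p a g t +
     t / p * vector_derivative (EK_integral 0 (1 - \<alpha>) p a g) (at t within {a..T})"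

definition EK_differentiable ::
    "real \<Rightarrow> real \<Rightarrow> real \<Rightarrow> real \<Rightarrow> (real \<Rightarrow> real) \<Rightarrow> real \<Rightarrow> bool" where
  "EK_differentiable \<alpha> p a T g t \<longleftrightarrow>
     EK_integral 0 (1 - \<alpha>) p a g differentiable (at t within {a..T})"

definition hyper_Bessel_derivative ::
    "real \<Rightarrow> real \<Rightarrow> real \<Rightarrow> real \<Rightarrow> (real \<Rightarrow> real) \<Rightarrow> real \<Rightarrow> real" where
  "hyper_Bessel_derivative \<alpha> p a T g t =
     p powr \<alpha> * t powr (- p * \<alpha>) * EK_derivative \<alpha> p a T g t"

definition caputo_hyper_Bessel ::
    "real \<Rightarrow> real \<Rightarrow> real \<Rightarrow> real \<Rightarrow> (real \<Rightarrow> real) \<Rightarrow> real \<Rightarrow> real" where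
  "caputo_hyper_Bessel \<alpha> p a T g t =
     hyper_Bessel_derivative \<alpha> p a T g t -
     p powr \<alpha> * g a * (t powr p - a powr p) powr (- \<alpha>) / Gamma (1 - \<alpha>)"


subsection \<open>The degenerate operator and its energy space\<close>

text \<open>Functions on \<open>[0, 1]\<close> are represented by functions on \<open>real\<close> whose values outside \<open>[0, 1]\<close>
  are irrelevant.\<close>

definition L2_01 :: "(real \<Rightarrow> real) \<Rightarrow> bool" where
  "L2_01 v \<longleftrightarrow> set_borel_measurable lebesgue {0..1} v \<and>
     set_integrable lebesgue {0..1} (\<lambda>x. (v x)\<^sup>2)"

definition ip_01 :: "(real \<Rightarrow> real) \<Rightarrow> (real \<Rightarrow> real) \<Rightarrow> real" where
  "ip_01 v w = (LINT x:{0..1}|lebesgue. v x * w x)"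

definition AC_on :: "real \<Rightarrow> real \<Rightarrow> (real \<Rightarrow> real) \<Rightarrow> bool" where
  "AC_on a b r \<longleftrightarrow>
     (\<forall>\<epsilon>>0. \<exists>\<delta>>0. \<forall>(n::nat) l u.
        (\<forall>i<n. a \<le> l i \<and> l i \<le> u i \<and> u i \<le> b) \<longrightarrow>
        disjoint_family_on (\<lambda>i. {l i<..<u i}) {..<n} \<longrightarrow>
        (\<Sum>i<n. u i - l i) < \<delta> \<longrightarrow>
        (\<Sum>i<n. \<bar>r (u i) - r (l i)\<bar>) < \<epsilon>)"

definition flux :: "real \<Rightarrow> (real \<Rightarrow> real) \<Rightarrow> real \<Rightarrow> real" where
  "flux \<beta> v x = x powr \<beta> * deriv v x"

definition A_expr :: "real \<Rightarrow> (real \<Rightarrow> real) \<Rightarrow> real \<Rightarrow> real" where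
  "A_expr \<beta> v x = - deriv (flux \<beta> v) x"

definition A_differentiable :: "real \<Rightarrow> (real \<Rightarrow> real) \<Rightarrow> real \<Rightarrow> bool" where
  "A_differentiable \<beta> v x \<longleftrightarrow>
     v differentiable (at x) \<and> flux \<beta> v differentiable (at x)"

text \<open>The initial domain of the operator. The derivatives exist in the open interval, and
  membership in \<open>C[0, 1]\<close> or \<open>AC[0, 1]\<close> refers to the extension to the end points.\<close>

definition dom_A :: "real \<Rightarrow> (real \<Rightarrow> real) \<Rightarrow> bool" where
  "dom_A \<beta> v \<longleftrightarrow>
     continuous_on {0..1} v \<and>
     (\<forall>x\<in>{0<..<1}. A_differentiable \<beta> v x) \<and>
     (\<exists>q. continuous_on {0..1} q \<and> (\<forall>x\<in>{0<..<1}. q x = flux \<beta> v x)) \<and>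
     (\<exists>r. AC_on 0 1 r \<and> (\<forall>x\<in>{0<..<1}. r x = deriv (flux \<beta> v) x)) \<and>
     L2_01 (A_expr \<beta> v) \<and>
     v 0 = 0 \<and> v 1 = 0"

text \<open>\<open>v\<close> is absolutely continuous on \<open>[0, 1]\<close> with almost everywhere derivative \<open>w\<close>. If
  \<open>0 < \<beta> < 1\<close>, a square integrable function whose distributional derivative \<open>w\<close> on \<open>(0, 1)\<close>
  has \<open>x powr \<beta> * w\<^sup>2\<close> integrable satisfies \<open>w \<in> L\<^sup>1(0, 1)\<close>, because \<open>x powr - \<beta>\<close> is integrable.
  Its class modulo null sets therefore contains exactly one function of this kind, and that
  function is taken as the representative. Pointwise statements such as \<open>u(x, a+) = \<phi>(x)\<close> are
  about these representatives.\<close>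

definition has_weak_deriv :: "(real \<Rightarrow> real) \<Rightarrow> (real \<Rightarrow> real) \<Rightarrow> bool" where
  "has_weak_deriv v w \<longleftrightarrow>
     set_integrable lebesgue {0..1} w \<and>
     (\<forall>x\<in>{0..1}. v x = v 0 + (LINT y:{0..x}|lebesgue. w y))"

text \<open>Determined up to a null set whenever a weak derivative exists.\<close>

definition weak_deriv :: "(real \<Rightarrow> real) \<Rightarrow> real \<Rightarrow> real" where
  "weak_deriv v = (SOME w. has_weak_deriv v w)"

definition W12 :: "real \<Rightarrow> (real \<Rightarrow> real) \<Rightarrow> bool" where
  "W12 \<beta> v \<longleftrightarrow>
     (\<exists>w. has_weak_deriv v w \<and> set_integrable lebesgue {0..1} (\<lambda>x. x powr \<beta> * (w x)\<^sup>2))"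

definition norm_W12 :: "real \<Rightarrow> (real \<Rightarrow> real) \<Rightarrow> real" where
  "norm_W12 \<beta> v = sqrt (LINT x:{0..1}|lebesgue. (v x)\<^sup>2 + x powr \<beta> * (weak_deriv v x)\<^sup>2)"

definition W12_dot :: "real \<Rightarrow> (real \<Rightarrow> real) \<Rightarrow> bool" where
  "W12_dot \<beta> v \<longleftrightarrow> W12 \<beta> v \<and>
     (\<exists>\<eta>. (\<forall>n::nat. dom_A \<beta> (\<eta> n)) \<and> (\<lambda>n. norm_W12 \<beta> (\<lambda>x. \<eta> n x - v x)) \<longlonglongrightarrow> 0)"

text \<open>\<open>C([a, T], V)\<close> for \<open>V\<close> the space above.\<close>

definition C_W12_dot :: "real \<Rightarrow> real \<Rightarrow> real \<Rightarrow> (real \<Rightarrow> real \<Rightarrow> real) \<Rightarrow> bool" where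
  "C_W12_dot \<beta> a T f \<longleftrightarrow>
     (\<forall>t\<in>{a..T}. W12_dot \<beta> (\<lambda>x. f x t) \<and>
        ((\<lambda>s. norm_W12 \<beta> (\<lambda>x. f x s - f x t)) \<longlongrightarrow> 0) (at t within {a..T}))"

text \<open>The graph of the Friedrichs extension, that is, of the restriction of the adjoint to the
  form domain. For \<open>v\<close> in the initial domain \<open>(A v, v) = \<integral> x\<^sup>\<beta> (v')\<^sup>2\<close>, so the form domain, the
  closure of the initial domain in the norm \<open>(A v, v) + (v, v)\<close>, is \<open>W12_dot \<beta>\<close>. The value \<open>w\<close> is
  determined up to a null set.\<close>

definition friedrichs_A :: "real \<Rightarrow> (real \<Rightarrow> real) \<Rightarrow> (real \<Rightarrow> real) \<Rightarrow> bool" where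
  "friedrichs_A \<beta> v w \<longleftrightarrow> W12_dot \<beta> v \<and> L2_01 w \<and>
     (\<forall>\<eta>. dom_A \<beta> \<eta> \<longrightarrow> ip_01 v (A_expr \<beta> \<eta>) = ip_01 w \<eta>)"

text \<open>Eigenfunctions are numbered from 0; multiplicities are accounted for by completeness.\<close>

definition eigensystem :: "real \<Rightarrow> (nat \<Rightarrow> real \<Rightarrow> real) \<Rightarrow> (nat \<Rightarrow> real) \<Rightarrow> bool" where
  "eigensystem \<beta> v lam \<longleftrightarrow>
     (\<forall>k. friedrichs_A \<beta> (v k) (\<lambda>x. lam k * v k x)) \<and>
     (\<forall>j k. ip_01 (v j) (v k) = (if j = k then 1 else 0)) \<and>
     (\<forall>h. L2_01 h \<longrightarrow> (\<forall>k. ip_01 h (v k) = 0) \<longrightarrow>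
        (AE x in lebesgue. x \<in> {0..1} \<longrightarrow> h x = 0))"


subsection \<open>The initial-boundary value problem\<close>

text \<open>The time factor for the eigenvalue \<open>l\<close>, the initial coefficient \<open>c\<close> and the source
  coefficient \<open>h\<close>.\<close>

definition time_factor ::
    "real \<Rightarrow> real \<Rightarrow> real \<Rightarrow> real \<Rightarrow> real \<Rightarrow> (real \<Rightarrow> real) \<Rightarrow> real \<Rightarrow> real" where
  "time_factor \<alpha> p a l c h t =
     (let ls = - l / p powr \<alpha> in
        c * mittag_leffler \<alpha> 1 (ls * (t powr p - a powr p) powr \<alpha>) +
        1 / (p powr \<alpha> * Gamma \<alpha>) *
          (LINT \<tau>:{a..t}|lebesgue.
             (t powr p - \<tau> powr p) powr (\<alpha> - 1) * h \<tau> * (p * \<tau> powr (p - 1))) +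
        ls / p powr \<alpha> *
          (LINT \<tau>:{a..t}|lebesgue.
             (t powr p - \<tau> powr p) powr (2 * \<alpha> - 1) *
             mittag_leffler \<alpha> (2 * \<alpha>) (ls * (t powr p - \<tau> powr p) powr \<alpha>) *
             h \<tau> * (p * \<tau> powr (p - 1))))"

definition Omega :: "real \<Rightarrow> real \<Rightarrow> (real \<times> real) set" where
  "Omega a T = {(x, t). 0 < x \<and> x < 1 \<and> a < t \<and> t \<le> T}"

definition classical_solution ::
    "real \<Rightarrow> real \<Rightarrow> real \<Rightarrow> real \<Rightarrow> real \<Rightarrow> (real \<Rightarrow> real \<Rightarrow> real) \<Rightarrow> (real \<Rightarrow> real) \<Rightarrow>
     (real \<Rightarrow> real \<Rightarrow> real) \<Rightarrow> bool" where
  "classical_solution \<alpha> \<beta> p a T f \<phi> u \<longleftrightarrow>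
     continuous_on (closure (Omega a T)) (\<lambda>(x, t). u x t) \<and>
     (\<forall>(x, t)\<in>Omega a T. EK_differentiable \<alpha> p a T (u x) t) \<and>
     continuous_on (Omega a T) (\<lambda>(x, t). caputo_hyper_Bessel \<alpha> p a T (u x) t) \<and>
     (\<forall>(x, t)\<in>Omega a T. A_differentiable \<beta> (\<lambda>y. u y t) x) \<and>
     continuous_on (Omega a T) (\<lambda>(x, t). A_expr \<beta> (\<lambda>y. u y t) x) \<and>
     (\<forall>(x, t)\<in>Omega a T.
        caputo_hyper_Bessel \<alpha> p a T (u x) t + A_expr \<beta> (\<lambda>y. u y t) x = f x t) \<and>
     (\<forall>x\<in>{0..1}. (u x \<longlongrightarrow> \<phi> x) (at_right a)) \<and>
     (\<forall>t\<in>{a..T}. u 0 t = 0 \<and> u 1 t = 0)"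

end

theory Submission
  imports Defs
begin

text \<open>Separation of variables works here because both factors can be controlled by elementary means.

  \<^bold>\<open>Space.\<close> The problem \<open>- (x\<^sup>\<beta> v')' = h\<close>, \<open>v(0) = v(1) = 0\<close> is solved explicitly by a Green
  operator \<open>green \<beta>\<close>, which maps Lipschitz functions into the initial domain. Testing the definition
  of the Friedrichs extension with the images of hat functions shows that \<open>A v = w\<close> with a continuous
  \<open>w\<close> means \<open>v = green \<beta> w\<close> pointwise (\<open>friedrichs_A_imp_green\<close>). Consequently the eigenvalues are
  positive, and the fluxes \<open>q\<^sub>k = x\<^sup>\<beta> v\<^sub>k'\<close> are orthogonal for the weight \<open>x\<^sup>-\<^sup>\<beta>\<close> with square norms
  \<open>lam k\<close>. Bessel's inequality for this system gives two estimates: the sum of \<open>v\<^sub>k(x)\<^sup>2 / lam k\<close> is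
  bounded uniformly in \<open>x\<close> (\<open>bessel_pointwise\<close>), and the sum of \<open>lam k * (\<psi>, v\<^sub>k)\<^sup>2\<close> is at most the
  squared energy norm of \<open>\<psi>\<close> (\<open>bessel_energy\<close>). By the Cauchy-Schwarz inequality, a series of
  \<open>c\<^sub>k(t) v\<^sub>k(x)\<close> converges uniformly in \<open>(x, t)\<close> whenever the energy tails, the sums of
  \<open>lam k * c\<^sub>k(t)\<^sup>2\<close> over large \<open>k\<close>, are small uniformly in \<open>t\<close> (\<open>eigen_series_uniform\<close>). The
  hypotheses on the data say that \<open>\<phi>\<close>, \<open>A \<phi>\<close>, \<open>f\<close> and \<open>A f\<close> have such coefficients; uniformity in
  time is a compactness argument.

  \<^bold>\<open>Time.\<close> In the variable \<open>s = t\<^sup>p\<close> a time factor is a Volterra convolution whose kernel is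
  \<open>s\<^sup>\<alpha>\<^sup>-\<^sup>1 E\<^sub>\<alpha>\<^sub>,\<^sub>\<alpha>(- \<mu> s\<^sup>\<alpha>)\<close>. Since \<open>0 \<le> E\<^sub>\<alpha>\<^sub>,\<^sub>\<gamma>(- x) \<le> 1 / \<Gamma>(\<gamma>)\<close> for \<open>\<gamma> \<ge> \<alpha>\<close>
  (\<open>mittag_leffler_bounds\<close>), it is dominated by the Abel kernel independently of the eigenvalue, so
  time factors inherit uniformly small energy tails from their data. This applies to the data
  \<open>(\<phi>, f)\<close> and, multiplying by \<open>lam k\<close>, to \<open>(A \<phi>, A f)\<close>. Hence the series of \<open>u\<close> and of \<open>A u\<close>
  converge uniformly, and \<open>u = green \<beta> (A u)\<close> because both sides have the same coefficients.

  \<^bold>\<open>The equation.\<close> The resolvent identity turns the explicit time factor into the integral equation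
  \<open>u\<^sub>k = \<phi>\<^sub>k + p\<^sup>-\<^sup>\<alpha> J\<^sup>\<alpha>(f\<^sub>k - lam k * u\<^sub>k)\<close> with the fractional integral \<open>J\<^sup>\<alpha>\<close> in \<open>s\<close>. Summing over \<open>k\<close>
  gives \<open>u = \<phi> + p\<^sup>-\<^sup>\<alpha> J\<^sup>\<alpha>(f - A u)\<close> (\<open>u_volterra\<close>). The integral of order \<open>1 - \<alpha>\<close> in the hyper-Bessel
  derivative completes \<open>J\<^sup>\<alpha>\<close> to an ordinary integral of a continuous function, so the derivative
  exists, and its regularization equals \<open>f - A u\<close>.\<close>

section \<open>Functions with a weak derivative\<close>

text \<open>The sets over which \<open>w\<close> integrates to zero form a Dynkin system containing the half-lines,
  hence all Borel sets. The norm of the energy space refers to an arbitrarily chosen weak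
  derivative, and this lemma makes the choice immaterial.\<close>

lemma zero_integrals_imp_AE_zero:
  fixes w :: "real \<Rightarrow> real"
  assumes w: "w absolutely_integrable_on {0..1}"
    and zero: "\<And>x. x \<in> {0..1} \<Longrightarrow> integral {0..x} w = 0"
  shows "AE x in lebesgue. x \<in> {0..1} \<longrightarrow> w x = 0"
proof -
  define f where "f x = indicator {0..1} x * w x" for x :: real
  have f_int: "integrable lebesgue f"
    using w unfolding f_def set_integrable_def by simp
  obtain g where g: "g \<in> borel_measurable lborel" and fg: "AE x in lborel. f x = g x"
    using completion_ex_borel_measurable_real[of f lborel] f_int by auto
  have fg': "AE x in lebesgue. f x = g x"
    using fg by (rule AE_completion)
  have g_leb: "g \<in> borel_measurable lebesgue"
    using g by (rule measurable_completion)
  have g_int: "integrable lborel g"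
  proof -
    have "integrable lebesgue g"
      using integrable_cong_AE[of f lebesgue g] f_int g_leb fg' by auto
    then show ?thesis using integrable_completion[OF g] by blast
  qed
  have initial: "set_lebesgue_integral lborel {..x} g = 0" for x
  proof -
    have "set_lebesgue_integral lborel {..x} g = set_lebesgue_integral lebesgue {..x} g"
      unfolding set_lebesgue_integral_def
      using g by (intro integral_completion[symmetric]) simp
    also have "\<dots> = set_lebesgue_integral lebesgue {..x} f"
      using fg' g_leb f_int by (intro set_lebesgue_integral_cong_AE) auto
    also have "\<dots> = set_lebesgue_integral lebesgue {0..min x 1} w"
      unfolding set_lebesgue_integral_def f_def
      by (intro Bochner_Integration.integral_cong) (auto simp: indicator_def)
    also have "\<dots> = 0"
    proof (cases "0 \<le> x")
      case True
      have "w absolutely_integrable_on {0..min x 1}"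
        using w by (rule set_integrable_subset) auto
      then show ?thesis
        using zero[of "min x 1"] True by (simp add: set_lebesgue_integral_eq_integral)
    next
      case False
      then have "{0..min x 1} = {}" by auto
      then show ?thesis by (simp add: set_lebesgue_integral_def)
    qed
    finally show ?thesis .
  qed
  have total: "(\<integral>x. g x \<partial>lborel) = 0"
  proof -
    have "(\<integral>x. g x \<partial>lborel) = (\<integral>x. g x \<partial>lebesgue)"
      using g by (rule integral_completion[symmetric])
    also have "\<dots> = (\<integral>x. f x \<partial>lebesgue)"
      using fg' g_leb f_int by (intro integral_cong_AE) auto
    also have "\<dots> = integral {0..1} w"
      using set_lebesgue_integral_eq_integral(2)[OF w]
      by (simp add: f_def[abs_def] set_lebesgue_integral_def)
    finally show ?thesis using zero[of 1] by simp
  qed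
  have "set_lebesgue_integral lborel A g = 0" if "A \<in> sets lborel" for A
  proof -
    have "Int_stable (range (atMost :: real \<Rightarrow> _))"
      by (auto simp: Int_stable_def)
    moreover have "range atMost \<subseteq> Pow (UNIV :: real set)" by simp
    moreover have "A \<in> sigma_sets UNIV (range atMost)"
      using that by (simp add: borel_eq_atMost)
    ultimately show ?thesis
    proof (induction rule: sigma_sets_induct_disjoint)
      case (compl A)
      then have A: "A \<in> sets lborel" by (simp add: borel_eq_atMost)
      have "set_integrable lborel A g" "set_integrable lborel (UNIV - A) g"
        using g_int A unfolding set_integrable_def by (intro integrable_mult_indicator; simp)+
      then have "set_lebesgue_integral lborel (A \<union> (UNIV - A)) g =
          set_lebesgue_integral lborel A g + set_lebesgue_integral lborel (UNIV - A) g"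
        by (intro set_integral_Un) auto
      then show ?case using total compl
        by (simp add: set_lebesgue_integral_def)
    next
      case (union A)
      have A: "A i \<in> sets lborel" for i
        using union(2) by (auto simp: borel_eq_atMost)
      have "set_lebesgue_integral lborel (\<Union>i. A i) g = (\<Sum>i. set_lebesgue_integral lborel (A i) g)"
      proof (rule lebesgue_integral_countable_add)
        show "set_integrable lborel (\<Union>i. A i) g"
          using g_int A unfolding set_integrable_def by (intro integrable_mult_indicator) auto
      qed (use A union(1) in \<open>auto simp: disjoint_family_on_def\<close>)
      then show ?case using union by simp
    qed (auto simp: initial, simp add: set_lebesgue_integral_def)
  qed
  from sigma_finite_measure.density_zero[OF sigma_finite_lborel g_int this] have "AE x in lborel. g x = 0" by simp
  then have "AE x in lebesgue. g x = 0" by (rule AE_completion)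
  with fg' show ?thesis
    by eventually_elim (auto simp: f_def)
qed

text \<open>With \<open>H\<close> continuously differentiable and \<open>W\<close> only absolutely continuous, the defect \<open>P\<close> of the
  formula on \<open>[0, x]\<close> changes over \<open>[x, y]\<close> by at most a multiple of \<open>(y - x)\<close> times the integral of
  \<open>\<bar>w\<bar>\<close> over \<open>[x, y]\<close>. The second factor tends to zero, so \<open>P\<close> has derivative zero everywhere.\<close>

lemma ac_integration_by_parts:
  fixes w h W H :: "real \<Rightarrow> real"
  assumes w: "w absolutely_integrable_on {0..1}"
    and h: "continuous_on {0..1} h"
    and W: "\<And>x. x \<in> {0..1} \<Longrightarrow> W x = W 0 + integral {0..x} w"
    and H: "\<And>x. x \<in> {0..1} \<Longrightarrow> H x = H 0 + integral {0..x} h"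
  shows "(\<lambda>x. w x * H x) absolutely_integrable_on {0..1}"
    and "integral {0..1} (\<lambda>x. w x * H x) =
           W 1 * H 1 - W 0 * H 0 - integral {0..1} (\<lambda>x. W x * h x)"
proof -
  have w_int: "w integrable_on {0..1}" and aw_int: "(\<lambda>x. \<bar>w x\<bar>) integrable_on {0..1}"
    using w by (auto simp: absolutely_integrable_on_def)
  have h_int: "h integrable_on {0..1}"
    using h by (rule integrable_continuous_real)
  have sub: "g integrable_on {x..y}" if "g integrable_on {0..1}" "0 \<le> x" "y \<le> 1"
    for g :: "real \<Rightarrow> real" and x y
    using that by (meson atLeastatMost_subset_iff integrable_on_subinterval)
  have W_cont: "continuous_on {0..1} W"
    by (rule continuous_on_eq[OF _ W[symmetric]])
      (intro continuous_intros indefinite_integral_continuous_1[OF w_int])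
  have H_cont: "continuous_on {0..1} H"
    by (rule continuous_on_eq[OF _ H[symmetric]])
      (intro continuous_intros indefinite_integral_continuous_1[OF h_int])
  have meas: "g \<in> borel_measurable (lebesgue_on {0..1})" if "continuous_on {0..1} g"
    for g :: "real \<Rightarrow> real"
    using that by (rule continuous_imp_measurable_on_sets_lebesgue) auto
  have bdd: "bounded (g ` {0..1})" if "continuous_on {0..1} g" for g :: "real \<Rightarrow> real"
    using that by (intro compact_imp_bounded compact_continuous_image) auto
  have "(\<lambda>x. H x * w x) absolutely_integrable_on {0..1}"
    using absolutely_integrable_bounded_measurable_product_real[OF meas[OF H_cont] _ bdd[OF H_cont] w]
    by simp
  then show wH: "(\<lambda>x. w x * H x) absolutely_integrable_on {0..1}"
    by (simp add: mult.commute)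
  then have wH_int: "(\<lambda>x. w x * H x) integrable_on {0..1}"
    by (auto simp: absolutely_integrable_on_def)
  have Wh_int: "(\<lambda>x. W x * h x) integrable_on {0..1}"
    using W_cont h by (intro integrable_continuous_real continuous_intros)
  obtain M where M: "\<And>x. x \<in> {0..1} \<Longrightarrow> \<bar>h x\<bar> \<le> M"
    using bdd[OF h] unfolding bounded_iff real_norm_def by (meson imageI)
  have M0: "0 \<le> M" using M[of 0] by auto
  define V where "V x = integral {0..x} (\<lambda>x. \<bar>w x\<bar>)" for x
  have V_cont: "continuous_on {0..1} V"
    unfolding V_def by (rule indefinite_integral_continuous_1[OF aw_int])
  have split: "integral {0..y} g - integral {0..x} g = integral {x..y} g"
    if "g integrable_on {0..1}" "0 \<le> x" "x \<le> y" "y \<le> 1" for g :: "real \<Rightarrow> real" and x y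
    using Henstock_Kurzweil_Integration.integral_combine[OF that(2,3) sub[OF that(1)]] that by simp
  define P where "P x = W x * H x - (integral {0..x} (\<lambda>x. w x * H x) + integral {0..x} (\<lambda>x. W x * h x))"
    for x
  have step: "\<bar>P y - P x\<bar> \<le> 2 * M * (y - x) * (V y - V x)" if xy: "0 \<le> x" "x \<le> y" "y \<le> 1" for x y
  proof -
    note s = sub[OF _ xy(1,3)]
    have Wd: "W y - W x = integral {x..y} w"
      using W[of x] W[of y] split[OF w_int xy] xy by simp
    have Hd: "H y - H x = integral {x..y} h"
      using H[of x] H[of y] split[OF h_int xy] xy by simp
    have "P y - P x = (W y - W x) * H y + (H y - H x) * W x
        - integral {x..y} (\<lambda>x. w x * H x) - integral {x..y} (\<lambda>x. W x * h x)"
      unfolding P_def split[OF wH_int xy, symmetric] split[OF Wh_int xy, symmetric]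
      by (simp add: algebra_simps)
    also have "\<dots> = (integral {x..y} (\<lambda>s. w s * H y) - integral {x..y} (\<lambda>s. w s * H s))
        + (integral {x..y} (\<lambda>s. h s * W x) - integral {x..y} (\<lambda>s. W s * h s))"
      unfolding Wd Hd by simp
    also have "\<dots> = integral {x..y} (\<lambda>s. w s * H y - w s * H s) + integral {x..y} (\<lambda>s. h s * W x - W s * h s)"
      using s[OF w_int] s[OF h_int] s[OF wH_int] s[OF Wh_int]
      by (simp add: Henstock_Kurzweil_Integration.integral_diff integrable_on_mult_left)
    finally have eq: "P y - P x = \<dots>" .
    have Hb: "\<bar>H y - H s\<bar> \<le> M * (y - x)" if "s \<in> {x..y}" for s
    proof -
      have "H y - H s = integral {s..y} h"
        using H[of s] H[of y] split[OF h_int, of s y] that xy by simp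
      also have "\<bar>\<dots>\<bar> \<le> M * (y - s)"
        using integral_bound[of s y h M] continuous_on_subset[OF h, of "{s..y}"] that xy M
        by auto
      also have "\<dots> \<le> M * (y - x)" using that M0 by (intro mult_left_mono) auto
      finally show ?thesis .
    qed
    have Wb: "\<bar>W x - W s\<bar> \<le> V y - V x" if "s \<in> {x..y}" for s
    proof -
      have "W s - W x = integral {x..s} w"
        using W[of s] W[of x] split[OF w_int, of x s] that xy by simp
      also have "\<bar>\<dots>\<bar> \<le> integral {x..s} (\<lambda>s. \<bar>w s\<bar>)"
        using integral_norm_bound_integral[of w "{x..s}" "\<lambda>s. \<bar>w s\<bar>"] sub[OF w_int, of x s]
          sub[OF aw_int, of x s] that xy by auto
      also have "\<dots> \<le> integral {x..y} (\<lambda>s. \<bar>w s\<bar>)"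
        using that xy sub[OF aw_int, of x s] sub[OF aw_int, of x y]
        by (intro integral_subset_le) auto
      also have "\<dots> = V y - V x" unfolding V_def using split[OF aw_int xy] by simp
      finally show ?thesis by (simp add: abs_minus_commute)
    qed
    have i1: "\<bar>integral {x..y} (\<lambda>s. w s * H y - w s * H s)\<bar> \<le> integral {x..y} (\<lambda>s. \<bar>w s\<bar> * (M * (y - x)))"
    proof -
      have "norm (integral {x..y} (\<lambda>s. w s * H y - w s * H s)) \<le> integral {x..y} (\<lambda>s. \<bar>w s\<bar> * (M * (y - x)))"
      proof (rule integral_norm_bound_integral)
        show "(\<lambda>s. w s * H y - w s * H s) integrable_on {x..y}"
          using s[OF w_int] s[OF wH_int] by (intro integrable_diff integrable_on_mult_left)
        show "(\<lambda>s. \<bar>w s\<bar> * (M * (y - x))) integrable_on {x..y}"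
          using s[OF aw_int] by (intro integrable_on_mult_left)
        show "norm (w s * H y - w s * H s) \<le> \<bar>w s\<bar> * (M * (y - x))" if "s \<in> {x..y}" for s
          using mult_left_mono[OF Hb[OF that], of "\<bar>w s\<bar>"]
          by (simp add: right_diff_distrib[symmetric] abs_mult)
      qed
      then show ?thesis by simp
    qed
    have i2: "\<bar>integral {x..y} (\<lambda>s. h s * W x - W s * h s)\<bar> \<le> integral {x..y} (\<lambda>s. M * (V y - V x))"
    proof -
      have "norm (integral {x..y} (\<lambda>s. h s * W x - W s * h s)) \<le> integral {x..y} (\<lambda>s. M * (V y - V x))"
      proof (rule integral_norm_bound_integral)
        show "(\<lambda>s. h s * W x - W s * h s) integrable_on {x..y}"
          using s[OF h_int] s[OF Wh_int] by (intro integrable_diff integrable_on_mult_left)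
        show "norm (h s * W x - W s * h s) \<le> M * (V y - V x)" if "s \<in> {x..y}" for s
        proof -
          have "norm (h s * W x - W s * h s) = \<bar>h s\<bar> * \<bar>W x - W s\<bar>"
            by (simp add: abs_mult[symmetric] algebra_simps)
          also have "\<dots> \<le> M * (V y - V x)"
            using Wb[OF that] M[of s] that xy M0 by (intro mult_mono) auto
          finally show ?thesis .
        qed
      qed auto
      then show ?thesis by simp
    qed
    have "integral {x..y} (\<lambda>s. \<bar>w s\<bar> * (M * (y - x))) = (V y - V x) * (M * (y - x))"
      unfolding V_def using split[OF aw_int xy] by simp
    moreover have "integral {x..y} (\<lambda>s. M * (V y - V x)) = M * (V y - V x) * (y - x)"
      using xy by simp
    ultimately show ?thesis using i1 i2 unfolding eq by (simp add: algebra_simps)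
  qed
  have "(P has_field_derivative 0) (at x within {0..1})" if x: "x \<in> {0..1}" for x
  proof -
    have "((\<lambda>y. 2 * M * \<bar>V y - V x\<bar>) \<longlongrightarrow> 2 * M * \<bar>V x - V x\<bar>) (at x within {0..1})"
      using V_cont x by (intro tendsto_intros) (auto simp: continuous_on_def)
    then have lim: "((\<lambda>y. 2 * M * \<bar>V y - V x\<bar>) \<longlongrightarrow> 0) (at x within {0..1})" by simp
    have "\<forall>\<^sub>F y in at x within {0..1}. norm ((P y - P x) / (y - x)) \<le> 2 * M * \<bar>V y - V x\<bar>"
    proof -
      have "norm ((P y - P x) / (y - x)) \<le> 2 * M * \<bar>V y - V x\<bar>" if y: "y \<in> {0..1}" "y \<noteq> x" for y
      proof (cases "x < y")
        case True
        have "\<bar>P y - P x\<bar> \<le> 2 * M * (y - x) * (V y - V x)" using step[of x y] x y True by auto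
        also have "\<dots> \<le> 2 * M * (y - x) * \<bar>V y - V x\<bar>" using M0 True by (intro mult_left_mono) auto
        finally show ?thesis using True by (simp add: field_simps)
      next
        case False
        have "\<bar>P x - P y\<bar> \<le> 2 * M * (x - y) * (V x - V y)" using step[of y x] x y False by auto
        also have "\<dots> \<le> 2 * M * (x - y) * \<bar>V x - V y\<bar>" using M0 False by (intro mult_left_mono) auto
        finally show ?thesis using False y by (simp add: field_simps abs_minus_commute)
      qed
      then show ?thesis by (auto simp: eventually_at_filter)
    qed
    then have "((\<lambda>y. (P y - P x) / (y - x)) \<longlongrightarrow> 0) (at x within {0..1})"
      using lim by (rule Lim_null_comparison)
    then show ?thesis by (simp add: has_field_derivative_iff)
  qed
  then have "P 1 = P 0"
    using has_field_derivative_zero_constant[of "{0..1}" P]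
    by (metis atLeastAtMost_iff convex_real_interval(5) order_refl zero_le_one)
  then show "integral {0..1} (\<lambda>x. w x * H x) =
           W 1 * H 1 - W 0 * H 0 - integral {0..1} (\<lambda>x. W x * h x)"
    by (simp add: P_def)
qed

text \<open>Gauge integrals over intervals replace Lebesgue integrals, because the fundamental theorem of
  calculus holds for them without regularity of the derivative.\<close>

lemma has_weak_deriv_iff:
  "has_weak_deriv v w \<longleftrightarrow> w absolutely_integrable_on {0..1} \<and>
     (\<forall>x\<in>{0..1}. v x = v 0 + integral {0..x} w)"
proof -
  have "(LINT y:{0..x}|lebesgue. w y) = integral {0..x} w"
    if "w absolutely_integrable_on {0..1}" "x \<in> {0..1}" for x
    using that set_integrable_subset[of lebesgue "{0..1}" w "{0..x}"]
    by (intro set_lebesgue_integral_eq_integral(2)) auto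
  then show ?thesis unfolding has_weak_deriv_def by auto
qed

lemma has_weak_derivD:
  assumes "has_weak_deriv v w"
  shows "w absolutely_integrable_on {0..1}"
    and "x \<in> {0..1} \<Longrightarrow> v x = v 0 + integral {0..x} w"
  using assms unfolding has_weak_deriv_iff by blast+

lemma has_weak_deriv_continuous_on:
  assumes "has_weak_deriv v w"
  shows "continuous_on {0..1} v"
proof -
  have wi: "w integrable_on {0..1}"
    using has_weak_derivD(1)[OF assms] by (auto simp: absolutely_integrable_on_def)
  show ?thesis
    by (rule continuous_on_eq[OF _ has_weak_derivD(2)[OF assms, symmetric]])
      (intro continuous_intros indefinite_integral_continuous_1[OF wi])
qed

lemma has_weak_deriv_diff:
  assumes "has_weak_deriv v w" "has_weak_deriv v' w'"
  shows "has_weak_deriv (\<lambda>x. v x - v' x) (\<lambda>x. w x - w' x)"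
  unfolding has_weak_deriv_iff
proof (intro conjI ballI)
  note w = has_weak_derivD(1)[OF assms(1)] and w' = has_weak_derivD(1)[OF assms(2)]
  show "(\<lambda>x. w x - w' x) absolutely_integrable_on {0..1}"
    using w w' by (rule set_integral_diff(1))
  fix x :: real assume x: "x \<in> {0..1}"
  have "u integrable_on {0..x}" if "u absolutely_integrable_on {0..1}" for u :: "real \<Rightarrow> real"
    using that x unfolding absolutely_integrable_on_def
    by (meson atLeastAtMost_iff atLeastatMost_subset_iff integrable_on_subinterval order_refl)
  then have "integral {0..x} (\<lambda>x. w x - w' x) = integral {0..x} w - integral {0..x} w'"
    using w w' by (intro Henstock_Kurzweil_Integration.integral_diff) auto
  then show "v x - v' x = v 0 - v' 0 + integral {0..x} (\<lambda>x. w x - w' x)"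
    using has_weak_derivD(2)[OF assms(1) x] has_weak_derivD(2)[OF assms(2) x] by simp
qed

lemma has_weak_deriv_unique:
  assumes "has_weak_deriv v w" "has_weak_deriv v w'"
  shows "AE x in lebesgue. x \<in> {0..1} \<longrightarrow> w x = w' x"
proof -
  have d: "has_weak_deriv (\<lambda>x. 0) (\<lambda>x. w x - w' x)"
    using has_weak_deriv_diff[OF assms] by simp
  have "AE x in lebesgue. x \<in> {0..1} \<longrightarrow> w x - w' x = 0"
    using has_weak_derivD[OF d] by (intro zero_integrals_imp_AE_zero) auto
  then show ?thesis by eventually_elim auto
qed

lemma absolutely_integrable_continuous_mult:
  fixes w g :: "real \<Rightarrow> real"
  assumes w: "w absolutely_integrable_on {0..1}" and g: "continuous_on {0..1} g"
  shows "(\<lambda>x. w x * g x) absolutely_integrable_on {0..1}"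
proof -
  have "(\<lambda>x. g x * w x) absolutely_integrable_on {0..1}"
  proof (rule absolutely_integrable_bounded_measurable_product_real[OF _ _ _ w])
    show "g \<in> borel_measurable (lebesgue_on {0..1})"
      using g by (rule continuous_imp_measurable_on_sets_lebesgue) auto
    show "bounded (g ` {0..1})"
      using g by (intro compact_imp_bounded compact_continuous_image) auto
  qed auto
  then show ?thesis by (simp add: mult.commute)
qed

lemma integral_powr_neg:
  fixes \<beta> x :: real
  assumes "\<beta> < 1" "0 \<le> x"
  shows "((\<lambda>z. z powr (-\<beta>)) has_integral x powr (1 - \<beta>) / (1 - \<beta>)) {0..x}"
  using has_integral_powr_from_0[of "-\<beta>" x] assms by (simp add: add.commute)

lemma absolutely_integrable_powr_neg:
  assumes "\<beta> < 1"
  shows "(\<lambda>z. z powr (-\<beta>)) absolutely_integrable_on {0..1::real}"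
  using integral_powr_neg[OF assms, of 1]
  by (intro nonnegative_absolutely_integrable_1) (auto simp: has_integral_iff)

abbreviation energy_density :: "real \<Rightarrow> (real \<Rightarrow> real) \<Rightarrow> real \<Rightarrow> real" where
  "energy_density \<beta> w \<equiv> \<lambda>x. x powr \<beta> * (w x)\<^sup>2"

lemma W12_diff:
  assumes "W12 \<beta> v" "W12 \<beta> v'"
  shows "W12 \<beta> (\<lambda>x. v x - v' x)"
proof -
  obtain w where w: "has_weak_deriv v w" "(energy_density \<beta> w) absolutely_integrable_on {0..1}"
    using assms(1) unfolding W12_def by auto
  obtain w' where w': "has_weak_deriv v' w'" "(energy_density \<beta> w') absolutely_integrable_on {0..1}"
    using assms(2) unfolding W12_def by auto
  note d = has_weak_deriv_diff[OF w(1) w'(1)]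
  have "(\<lambda>x. x powr \<beta> * (w x - w' x)\<^sup>2) absolutely_integrable_on {0..1}"
  proof (rule measurable_bounded_by_integrable_imp_absolutely_integrable)
    have "(\<lambda>x. w x - w' x) \<in> borel_measurable (lebesgue_on {0..1})"
      using has_weak_derivD(1)[OF d] by (simp add: absolutely_integrable_imp_borel_measurable)
    moreover have "(\<lambda>x. x powr \<beta>) \<in> borel_measurable (lebesgue_on {0..1})"
      by (intro measurable_restrict_space1 measurable_completion) measurable
    ultimately show "(\<lambda>x. x powr \<beta> * (w x - w' x)\<^sup>2) \<in> borel_measurable (lebesgue_on {0..1})"
      by measurable
    show "(\<lambda>x. 2 * (x powr \<beta> * (w x)\<^sup>2) + 2 * (x powr \<beta> * (w' x)\<^sup>2)) integrable_on {0..1}"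
      using w(2) w'(2) unfolding absolutely_integrable_on_def
      by (intro integrable_add integrable_on_mult_right) auto
    fix x :: real
    have "(w x - w' x)\<^sup>2 \<le> 2 * (w x)\<^sup>2 + 2 * (w' x)\<^sup>2"
      using zero_le_power2[of "w x + w' x"] by (simp add: power2_eq_square algebra_simps)
    then have "x powr \<beta> * (w x - w' x)\<^sup>2 \<le> x powr \<beta> * (2 * (w x)\<^sup>2 + 2 * (w' x)\<^sup>2)"
      by (rule mult_left_mono) simp
    then show "norm (x powr \<beta> * (w x - w' x)\<^sup>2) \<le> 2 * (x powr \<beta> * (w x)\<^sup>2) + 2 * (x powr \<beta> * (w' x)\<^sup>2)"
      by (simp add: algebra_simps)
  qed auto
  with d show ?thesis unfolding W12_def by blast
qed

text \<open>The derivative of a function in the initial domain is \<open>x\<^sup>-\<^sup>\<beta>\<close> times a continuous flux, and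
  \<open>x\<^sup>-\<^sup>\<beta>\<close> is integrable because \<open>\<beta> < 1\<close>.\<close>

lemma dom_A_imp_W12:
  assumes \<beta>: "0 < \<beta>" "\<beta> < 1" and v: "dom_A \<beta> v"
  shows "W12 \<beta> v"
proof -
  obtain q where q: "continuous_on {0..1} q" "\<And>x. x \<in> {0<..<1} \<Longrightarrow> q x = flux \<beta> v x"
    using v unfolding dom_A_def by auto
  define w where "w x = x powr (-\<beta>) * q x" for x
  have cont: "continuous_on {0..1} v" using v by (simp add: dom_A_def)
  have w_int: "w absolutely_integrable_on {0..1}"
    unfolding w_def by (intro absolutely_integrable_continuous_mult absolutely_integrable_powr_neg \<beta> q)
  have deriv: "(v has_vector_derivative w x) (at x)" if "x \<in> {0<..<1}" for x
  proof -
    have "v differentiable (at x)"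
      using v that by (auto simp: dom_A_def A_differentiable_def)
    then have "(v has_field_derivative deriv v x) (at x)"
      by (metis DERIV_imp_deriv real_differentiableE)
    moreover have "deriv v x = w x"
      using that q(2)[OF that] by (simp add: w_def flux_def powr_minus)
    ultimately show ?thesis by (simp add: has_real_derivative_iff_has_vector_derivative)
  qed
  have "v x = v 0 + integral {0..x} w" if x: "x \<in> {0..1}" for x
  proof -
    have "(w has_integral v x - v 0) {0..x}"
      using x deriv by (intro fundamental_theorem_of_calculus_interior continuous_on_subset[OF cont]) auto
    then show ?thesis by (simp add: has_integral_iff)
  qed
  then have "has_weak_deriv v w" using w_int unfolding has_weak_deriv_iff by blast
  moreover have "(energy_density \<beta> w) = (\<lambda>x. x powr (-\<beta>) * (q x)\<^sup>2)"
    by (auto simp: w_def fun_eq_iff power2_eq_square powr_minus field_simps)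
  moreover have "(\<lambda>x. x powr (-\<beta>) * (q x)\<^sup>2) absolutely_integrable_on {0..1}"
    by (intro absolutely_integrable_continuous_mult absolutely_integrable_powr_neg \<beta> continuous_intros q)
  ultimately show ?thesis unfolding W12_def by auto
qed

lemma norm_W12_eq:
  assumes w: "has_weak_deriv v w" and w2: "(energy_density \<beta> w) absolutely_integrable_on {0..1}"
  shows "norm_W12 \<beta> v = sqrt (integral {0..1} (\<lambda>x. (v x)\<^sup>2) + integral {0..1} (energy_density \<beta> w))"
proof -
  have wd: "has_weak_deriv v (weak_deriv v)"
    unfolding weak_deriv_def by (rule someI[of _ w]) (rule w)
  have v2: "(\<lambda>x. (v x)\<^sup>2) absolutely_integrable_on {0..1}"
    by (intro absolutely_integrable_continuous_real continuous_intros
        has_weak_deriv_continuous_on[OF w])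
  have int: "(\<lambda>x. (v x)\<^sup>2 + x powr \<beta> * (w x)\<^sup>2) absolutely_integrable_on {0..1}"
    using v2 w2 by (rule set_integral_add(1))
  have "negligible {x \<in> {0..1}. weak_deriv v x \<noteq> w x}"
    using has_weak_deriv_unique[OF wd w] unfolding eventually_ae_filter_negligible
    by (elim exE conjE, elim negligible_subset) auto
  then have neg: "(g has_integral I) {0..1} \<longleftrightarrow> (g' has_integral I) {0..1}"
    if "\<And>x. x \<in> {0..1} \<Longrightarrow> weak_deriv v x = w x \<Longrightarrow> g x = g' x" for g g' :: "real \<Rightarrow> real" and I
    using that by (intro has_integral_spike_eq) auto
  have "((\<lambda>x. (v x)\<^sup>2 + x powr \<beta> * (weak_deriv v x)\<^sup>2) has_integral
      integral {0..1} (\<lambda>x. (v x)\<^sup>2) + integral {0..1} (energy_density \<beta> w)) {0..1}"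
    using v2 w2 by (subst neg[where g' = "\<lambda>x. (v x)\<^sup>2 + x powr \<beta> * (w x)\<^sup>2"])
      (auto intro!: has_integral_add simp: absolutely_integrable_on_def has_integral_integral[symmetric])
  then have hi: "(\<lambda>x. (v x)\<^sup>2 + x powr \<beta> * (weak_deriv v x)\<^sup>2) integrable_on {0..1}"
    "integral {0..1} (\<lambda>x. (v x)\<^sup>2 + x powr \<beta> * (weak_deriv v x)\<^sup>2) =
      integral {0..1} (\<lambda>x. (v x)\<^sup>2) + integral {0..1} (energy_density \<beta> w)"
    by (auto simp: has_integral_iff)
  then have "(\<lambda>x. (v x)\<^sup>2 + x powr \<beta> * (weak_deriv v x)\<^sup>2) absolutely_integrable_on {0..1}"
    by (intro nonnegative_absolutely_integrable_1) auto
  then show ?thesis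
    unfolding norm_W12_def using hi(2) by (simp add: set_lebesgue_integral_eq_integral)
qed

text \<open>The embedding of the energy space into the continuous functions, for any positive bound \<open>s\<close> of
  the norm. The integral of \<open>\<bar>w\<bar>\<close> is split by \<open>2 \<bar>w\<bar> \<le> s x\<^sup>-\<^sup>\<beta> + x\<^sup>\<beta> w\<^sup>2 / s\<close>; this controls the
  oscillation of \<open>h\<close>, and averaging controls its value at \<open>0\<close>. The bound \<open>s\<close> is
  divided by, hence positive; letting it decrease to the norm gives the embedding.\<close>

lemma abs_le_of_norm_W12_le:
  assumes \<beta>: "0 < \<beta>" "\<beta> < 1" and w: "has_weak_deriv h w"
    and w2: "(energy_density \<beta> w) absolutely_integrable_on {0..1}"
    and s: "norm_W12 \<beta> h \<le> s" "0 < s" and x: "x \<in> {0..1}"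
  shows "\<bar>h x\<bar> \<le> (2 + 1 / (1 - \<beta>)) * s"
proof -
  define D where "D = integral {0..1} (\<lambda>z. \<bar>w z\<bar>)"
  have h_cont: "continuous_on {0..1} h" by (rule has_weak_deriv_continuous_on[OF w])
  have h2: "(\<lambda>x. (h x)\<^sup>2) integrable_on {0..1}" "(\<lambda>x. \<bar>h x\<bar>) integrable_on {0..1}"
    by (auto intro!: integrable_continuous_real continuous_intros h_cont)
  have w2': "(energy_density \<beta> w) integrable_on {0..1}"
    using w2 by (auto simp: absolutely_integrable_on_def)
  have wi: "w integrable_on {0..1}" "(\<lambda>x. \<bar>w x\<bar>) integrable_on {0..1}"
    using has_weak_derivD(1)[OF w] by (auto simp: absolutely_integrable_on_def)
  let ?I = "integral {0..1} (\<lambda>x. (h x)\<^sup>2)" and ?J = "integral {0..1} (energy_density \<beta> w)"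
  have "?I + ?J \<le> s\<^sup>2"
    using s norm_W12_eq[OF w w2] by (simp add: sqrt_le_D real_sqrt_le_iff') 
  moreover have "0 \<le> ?I" "0 \<le> ?J"
    by (auto intro!: integral_nonneg h2 w2')
  ultimately have I: "?I \<le> s\<^sup>2" and J: "?J \<le> s\<^sup>2" by auto
  have pi: "((\<lambda>z. z powr (-\<beta>)) has_integral 1 / (1 - \<beta>)) {0..1}"
    using integral_powr_neg[OF \<beta>(2), of 1] by simp
  define b where "b z = s / 2 * z powr (-\<beta>) + 1 / (2 * s) * (z powr \<beta> * (w z)\<^sup>2)" for z
  have b: "(b has_integral s / 2 * (1 / (1 - \<beta>)) + 1 / (2 * s) * ?J) {0..1}"
    unfolding b_def using w2'
    by (intro has_integral_add has_integral_mult_right pi) (simp add: has_integral_integral[symmetric])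
  have "D = integral {0..1} (\<lambda>z. if z = 0 then 0 else \<bar>w z\<bar>)"
    unfolding D_def by (rule integral_spike[of "{0}"]) auto
  also have "\<dots> \<le> integral {0..1} b"
  proof (rule integral_le)
    show "(\<lambda>z. if z = 0 then 0 else \<bar>w z\<bar>) integrable_on {0..1}"
      by (rule integrable_spike[OF wi(2), of "{0}"]) auto
    show "b integrable_on {0..1}" using b by (auto simp: has_integral_iff)
    fix z :: real assume z: "z \<in> {0..1}"
    show "(if z = 0 then 0 else \<bar>w z\<bar>) \<le> b z"
    proof (cases "z = 0")
      case False
      define c where "c = z powr \<beta>"
      have c: "0 < c" using False z by (simp add: c_def)
      have "b z - \<bar>w z\<bar> = (s - c * \<bar>w z\<bar>)\<^sup>2 / (2 * s * c)"
        unfolding b_def powr_minus c_def[symmetric] using c s(2)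
        by (simp add: field_simps power2_eq_square)
      also have "\<dots> \<ge> 0" using c s(2) by simp
      finally show ?thesis using False by simp
    qed (use s in \<open>simp add: b_def\<close>)
  qed
  also have "\<dots> = s / 2 * (1 / (1 - \<beta>)) + ?J / (2 * s)"
    using b by (simp add: has_integral_iff)
  also have "\<dots> \<le> s / 2 * (1 / (1 - \<beta>)) + s / 2"
    using J s(2) by (simp add: field_simps power2_eq_square)
  finally have D: "D \<le> s / 2 * (1 / (1 - \<beta>)) + s / 2" .
  have osc: "\<bar>h y - h 0\<bar> \<le> D" if y: "y \<in> {0..1}" for y
  proof -
    have sub: "{0..y} \<subseteq> {0..1}" using y by auto
    have "h y - h 0 = integral {0..y} w"
      using has_weak_derivD(2)[OF w y] by linarith
    also have "\<bar>\<dots>\<bar> \<le> integral {0..y} (\<lambda>z. \<bar>w z\<bar>)"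
      using integral_norm_bound_integral[of w "{0..y}" "\<lambda>s. \<bar>w s\<bar>"]
        integrable_on_subinterval[OF wi(1) sub] integrable_on_subinterval[OF wi(2) sub] by auto
    also have "\<dots> \<le> D"
      unfolding D_def by (intro integral_subset_le sub integrable_on_subinterval[OF wi(2) sub] wi) auto
    finally show ?thesis .
  qed
  have b2: "((\<lambda>z. s / 2 + 1 / (2 * s) * (h z)\<^sup>2) has_integral s / 2 + 1 / (2 * s) * ?I) {0..1}"
    using h2(1) has_integral_const_real[of "s / 2" 0 1]
    by (intro has_integral_add has_integral_mult_right) (simp_all add: has_integral_integral[symmetric])
  have "integral {0..1} (\<lambda>z::real. \<bar>h 0\<bar> - D) \<le> integral {0..1} (\<lambda>z. s / 2 + 1 / (2 * s) * (h z)\<^sup>2)"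
  proof (rule integral_le)
    show "(\<lambda>z. s / 2 + 1 / (2 * s) * (h z)\<^sup>2) integrable_on {0..1}"
      using b2 by (auto simp: has_integral_iff)
    fix z :: real assume z: "z \<in> {0..1}"
    have "s / 2 + 1 / (2 * s) * (h z)\<^sup>2 - \<bar>h z\<bar> = (s - \<bar>h z\<bar>)\<^sup>2 / (2 * s)"
      using s(2) by (simp add: field_simps power2_eq_square)
    also have "\<dots> \<ge> 0" using s(2) by simp
    finally show "\<bar>h 0\<bar> - D \<le> s / 2 + 1 / (2 * s) * (h z)\<^sup>2" using osc[OF z] by linarith
  qed auto
  also have "\<dots> = s / 2 + ?I / (2 * s)"
    using b2 by (simp add: has_integral_iff)
  also have "\<dots> \<le> s"
    using I s(2) by (simp add: field_simps power2_eq_square)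
  finally have "\<bar>h 0\<bar> \<le> s + D" by (subst (asm) integral_const_real) simp
  then have "\<bar>h x\<bar> \<le> s + 2 * D" using osc[OF x] by linarith
  also have "\<dots> \<le> (2 + 1 / (1 - \<beta>)) * s" using D \<beta> by (simp add: field_simps)
  finally show ?thesis .
qed

lemma W12_sup_bound:
  assumes \<beta>: "0 < \<beta>" "\<beta> < 1" and h: "W12 \<beta> h" and x: "x \<in> {0..1}"
  shows "\<bar>h x\<bar> \<le> (2 + 1 / (1 - \<beta>)) * norm_W12 \<beta> h"
proof -
  let ?C = "2 + 1 / (1 - \<beta>)"
  obtain w where w: "has_weak_deriv h w" "(energy_density \<beta> w) absolutely_integrable_on {0..1}"
    using h unfolding W12_def by auto
  have "\<bar>h x\<bar> / ?C \<le> s" if "norm_W12 \<beta> h < s" for s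
  proof -
    have "0 \<le> integral {0..1} (\<lambda>x. (h x)\<^sup>2) + integral {0..1} (energy_density \<beta> w)"
      using w(2) has_weak_deriv_continuous_on[OF w(1)]
      by (intro add_nonneg_nonneg integral_nonneg)
        (auto simp: absolutely_integrable_on_def intro!: integrable_continuous_real continuous_intros)
    then have "0 \<le> norm_W12 \<beta> h" using norm_W12_eq[OF w] by simp
    then have "0 < s" using that by simp
    then have "\<bar>h x\<bar> \<le> ?C * s"
      using abs_le_of_norm_W12_le[OF \<beta> w _ _ x] that by simp
    moreover have "0 < ?C" using \<beta> by (simp add: add_pos_pos)
    ultimately show ?thesis by (simp add: pos_divide_le_eq mult.commute)
  qed
  then have "\<bar>h x\<bar> / ?C \<le> norm_W12 \<beta> h"
    by (meson dense_ge)
  moreover have "0 < ?C" using \<beta> by (simp add: add_pos_pos)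
  ultimately show ?thesis by (simp add: pos_divide_le_eq mult.commute)
qed

lemma W12_energy:
  assumes "W12 \<beta> h"
  obtains w where "has_weak_deriv h w" "(energy_density \<beta> w) absolutely_integrable_on {0..1}"
    "integral {0..1} (energy_density \<beta> w) \<le> (norm_W12 \<beta> h)\<^sup>2"
proof -
  obtain w where w: "has_weak_deriv h w" "(energy_density \<beta> w) absolutely_integrable_on {0..1}"
    using assms unfolding W12_def by auto
  have "0 \<le> integral {0..1} (\<lambda>x. (h x)\<^sup>2)"
    using has_weak_deriv_continuous_on[OF w(1)]
    by (intro integral_nonneg integrable_continuous_real continuous_intros) auto
  moreover have "0 \<le> integral {0..1} (energy_density \<beta> w)"
    using w(2) by (intro integral_nonneg) (auto simp: absolutely_integrable_on_def)
  ultimately have "integral {0..1} (energy_density \<beta> w) \<le> (norm_W12 \<beta> h)\<^sup>2"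
    using norm_W12_eq[OF w] by simp
  with w that show ?thesis by blast
qed

lemma W12_dot_imp_W12: "W12_dot \<beta> v \<Longrightarrow> W12 \<beta> v"
  by (simp add: W12_dot_def)

lemma W12_continuous_on: "W12 \<beta> v \<Longrightarrow> continuous_on {0..1} v"
  by (auto simp: W12_def intro: has_weak_deriv_continuous_on)

text \<open>Convergence in the energy norm is uniform on \<open>[0, 1]\<close>, so the boundary values of the
  approximating functions from the initial domain survive in the limit.\<close>

lemma W12_dot_boundary:
  assumes \<beta>: "0 < \<beta>" "\<beta> < 1" and v: "W12_dot \<beta> v"
  shows "v 0 = 0" "v 1 = 0"
proof -
  obtain \<eta> where \<eta>: "\<And>n::nat. dom_A \<beta> (\<eta> n)" and lim: "(\<lambda>n. norm_W12 \<beta> (\<lambda>x. \<eta> n x - v x)) \<longlonglongrightarrow> 0"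
    using v unfolding W12_dot_def by blast
  have "v x = 0" if x: "x \<in> {0..1}" "\<And>n. \<eta> n x = 0" for x
  proof -
    have "\<bar>v x\<bar> \<le> (2 + 1 / (1 - \<beta>)) * norm_W12 \<beta> (\<lambda>x. \<eta> n x - v x)" for n
      using W12_sup_bound[OF \<beta> W12_diff[OF dom_A_imp_W12[OF \<beta> \<eta>] W12_dot_imp_W12[OF v]] x(1), of n] x(2)
      by simp
    moreover have "(\<lambda>n. (2 + 1 / (1 - \<beta>)) * norm_W12 \<beta> (\<lambda>x. \<eta> n x - v x)) \<longlonglongrightarrow> (2 + 1 / (1 - \<beta>)) * 0"
      by (intro tendsto_intros lim)
    ultimately have "\<bar>v x\<bar> \<le> 0" by (intro Lim_bounded2) auto
    then show ?thesis by simp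
  qed
  then show "v 0 = 0" "v 1 = 0" using \<eta> by (auto simp: dom_A_def)
qed


section \<open>The Green operator\<close>

lemma integral_eq_interior:
  fixes f g :: "real \<Rightarrow> real"
  assumes g: "continuous_on {0..1} g" and eq: "\<And>x. x \<in> {0<..<1} \<Longrightarrow> f x = g x"
  shows "f absolutely_integrable_on {0..1}" "integral {0..1} f = integral {0..1} g"
proof -
  have neg: "negligible {0, 1::real}" by simp
  have fg: "f x = g x" if "x \<in> {0..1} - {0, 1}" for x
    using eq[of x] that by (cases "x = 0 \<or> x = 1") auto
  show "f absolutely_integrable_on {0..1}"
    by (rule absolutely_integrable_spike[OF absolutely_integrable_continuous_real[OF g] neg fg])
  show "integral {0..1} f = integral {0..1} g"
    by (rule integral_spike[OF neg]) (simp add: fg)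
qed

lemma ip_01_continuous:
  assumes "continuous_on {0..1} v" "continuous_on {0..1} w"
  shows "ip_01 v w = integral {0..1} (\<lambda>x. v x * w x)"
  unfolding ip_01_def using assms
  by (intro set_lebesgue_integral_eq_integral(2) absolutely_integrable_continuous_real continuous_intros)

lemma continuous_imp_L2_01:
  assumes g: "continuous_on {0..1} g" and eq: "\<And>x. x \<in> {0<..<1} \<Longrightarrow> f x = g x"
  shows "L2_01 f"
proof -
  have "f absolutely_integrable_on {0..1}" using assms by (rule integral_eq_interior)
  moreover have "(\<lambda>x. (f x)\<^sup>2) absolutely_integrable_on {0..1}"
    using g eq by (intro integral_eq_interior(1)[of "\<lambda>x. (g x)\<^sup>2"]) (auto intro!: continuous_intros)
  ultimately show ?thesis
    unfolding L2_01_def set_integrable_def set_borel_measurable_def by auto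
qed

lemma Lipschitz_imp_AC_on:
  assumes L: "\<And>x y. \<lbrakk>x \<in> {a..b}; y \<in> {a..b}\<rbrakk> \<Longrightarrow> \<bar>r y - r x\<bar> \<le> L * \<bar>y - x\<bar>" and "0 \<le> L"
  shows "AC_on a b r"
  unfolding AC_on_def
proof (intro allI impI)
  fix \<epsilon> :: real assume \<epsilon>: "0 < \<epsilon>"
  show "\<exists>\<delta>>0. \<forall>(n::nat) l u.
        (\<forall>i<n. a \<le> l i \<and> l i \<le> u i \<and> u i \<le> b) \<longrightarrow>
        disjoint_family_on (\<lambda>i. {l i<..<u i}) {..<n} \<longrightarrow>
        (\<Sum>i<n. u i - l i) < \<delta> \<longrightarrow>
        (\<Sum>i<n. \<bar>r (u i) - r (l i)\<bar>) < \<epsilon>"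
  proof (intro exI[of _ "\<epsilon> / (L + 1)"] conjI allI impI)
    show "0 < \<epsilon> / (L + 1)" using \<epsilon> \<open>0 \<le> L\<close> by simp
    fix n :: nat and l u :: "nat \<Rightarrow> real"
    assume lu: "\<forall>i<n. a \<le> l i \<and> l i \<le> u i \<and> u i \<le> b" and small: "(\<Sum>i<n. u i - l i) < \<epsilon> / (L + 1)"
    have "(\<Sum>i<n. \<bar>r (u i) - r (l i)\<bar>) \<le> (\<Sum>i<n. L * (u i - l i))"
    proof (rule sum_mono)
      fix i assume "i \<in> {..<n}"
      then have "a \<le> l i" "l i \<le> u i" "u i \<le> b" using lu by auto
      then show "\<bar>r (u i) - r (l i)\<bar> \<le> L * (u i - l i)" using L[of "l i" "u i"] by simp
    qed
    also have "\<dots> = L * (\<Sum>i<n. u i - l i)" by (simp add: sum_distrib_left)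
    also have "\<dots> \<le> (L + 1) * (\<Sum>i<n. u i - l i)"
      using lu by (intro mult_right_mono sum_nonneg) auto
    also have "\<dots> < \<epsilon>" using small \<open>0 \<le> L\<close> by (simp add: field_simps)
    finally show "(\<Sum>i<n. \<bar>r (u i) - r (l i)\<bar>) < \<epsilon>" .
  qed
qed

text \<open>If \<open>g c > 0\<close>, a hat function at \<open>c\<close> with a small base makes the integrand nonnegative and
  positive at \<open>c\<close>. Hat functions serve as test functions because they are Lipschitz, as the initial
  domain requires of the right-hand sides.\<close>

lemma continuous_eq_zero_by_hats:
  fixes g :: "real \<Rightarrow> real"
  assumes g: "continuous_on {0..1} g"
    and zero: "\<And>c r. integral {0..1} (\<lambda>x. g x * max 0 (r - \<bar>x - c\<bar>)) = 0"
    and c: "c \<in> {0..1}"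
  shows "g c = 0"
proof -
  have pos: False if g: "continuous_on {0..1} g" and "0 < g c"
    and zero: "\<And>c r. integral {0..1} (\<lambda>x. g x * max 0 (r - \<bar>x - c\<bar>)) = 0" for g :: "real \<Rightarrow> real"
  proof -
    obtain r where r: "0 < r" "\<And>x. x \<in> {0..1} \<Longrightarrow> dist x c < r \<Longrightarrow> dist (g x) (g c) < g c"
      using g \<open>0 < g c\<close> c unfolding continuous_on_iff by blast
    define k where "k x = g x * max 0 (r - \<bar>x - c\<bar>)" for x
    have k_cont: "continuous_on {0..1} k"
      unfolding k_def by (intro continuous_intros g)
    have k0: "0 \<le> k x" if "x \<in> {0..1}" for x
    proof (cases "\<bar>x - c\<bar> < r")
      case True
      then have "0 < g x" using r(2)[OF that] by (auto simp: dist_real_def)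
      then show ?thesis by (simp add: k_def)
    qed (simp add: k_def)
    have "(k has_integral 0) {0..1}"
      using zero[of r c] integrable_continuous_real[OF k_cont]
      by (simp add: has_integral_iff k_def[abs_def])
    then have "k c = 0"
      using has_integral_0_cbox_imp_0[of 0 1 k c] k_cont k0 c by (auto simp: box_real)
    then show False using r(1) \<open>0 < g c\<close> by (simp add: k_def)
  qed
  have "continuous_on {0..1} (\<lambda>x. - g x)" by (intro continuous_intros g)
  moreover have "integral {0..1} (\<lambda>x. - g x * max 0 (r - \<bar>x - c\<bar>)) = 0" for c r
    using zero[of r c] by simp
  ultimately show ?thesis using pos[of g] pos[of "\<lambda>x. - g x"] g zero by force
qed

definition primitive :: "(real \<Rightarrow> real) \<Rightarrow> real \<Rightarrow> real" where
  "primitive h x = integral {0..x} h"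

text \<open>The flux \<open>x\<^sup>\<beta> v'\<close> of the solution of \<open>- (x\<^sup>\<beta> v')' = h\<close> is a constant minus the primitive of
  \<open>h\<close>. The constant is the one for which \<open>v(1) = 0\<close>, since \<open>x\<^sup>-\<^sup>\<beta>\<close> has integral \<open>1 / (1 - \<beta>)\<close>.\<close>

definition green_flux :: "real \<Rightarrow> (real \<Rightarrow> real) \<Rightarrow> real \<Rightarrow> real" where
  "green_flux \<beta> h x = (1 - \<beta>) * integral {0..1} (\<lambda>z. z powr (-\<beta>) * primitive h z) - primitive h x"

definition green :: "real \<Rightarrow> (real \<Rightarrow> real) \<Rightarrow> real \<Rightarrow> real" where
  "green \<beta> h x = integral {0..x} (\<lambda>z. z powr (-\<beta>) * green_flux \<beta> h z)"

lemma primitive_continuous_on: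
  "continuous_on {0..1} h \<Longrightarrow> continuous_on {0..1} (primitive h)"
  unfolding primitive_def by (intro indefinite_integral_continuous_1 integrable_continuous_real)

lemma green_flux_continuous_on:
  "continuous_on {0..1} h \<Longrightarrow> continuous_on {0..1} (green_flux \<beta> h)"
  unfolding green_flux_def by (intro continuous_intros primitive_continuous_on)

lemma has_real_derivative_at_interior:
  assumes "(F has_real_derivative D) (at x within {0..1})" "x \<in> {0<..<1}"
  shows "(F has_real_derivative D) (at x)"
  using assms at_within_interior[of x "{0..1}"] by (simp add: interior_atLeastAtMost_real)

lemma green_flux_has_derivative:
  assumes h: "continuous_on {0..1} h" and x: "x \<in> {0<..<1}"
  shows "(green_flux \<beta> h has_real_derivative - h x) (at x)"
proof -
  have "(primitive h has_real_derivative h x) (at x within {0..1})"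
    unfolding primitive_def using x by (intro integral_has_real_derivative h) auto
  then have "(primitive h has_real_derivative h x) (at x)"
    using x by (rule has_real_derivative_at_interior)
  then show ?thesis
    unfolding green_flux_def by (auto intro!: derivative_eq_intros)
qed

lemma green_flux_eq_integral:
  assumes h: "continuous_on {0..1} h"
  shows "green_flux \<beta> h x = green_flux \<beta> h 0 + integral {0..x} (\<lambda>z. - h z)"
  by (simp add: green_flux_def primitive_def)

context
  fixes \<beta> :: real
  assumes \<beta>: "0 < \<beta>" "\<beta> < 1"
begin

lemma weighted_absolutely_integrable:
  "continuous_on {0..1} q \<Longrightarrow> (\<lambda>z. z powr (-\<beta>) * q z) absolutely_integrable_on {0..1}"
  by (intro absolutely_integrable_continuous_mult absolutely_integrable_powr_neg \<beta>)

lemma weighted_integrable: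
  "continuous_on {0..1} q \<Longrightarrow> (\<lambda>z. z powr (-\<beta>) * q z) integrable_on {0..1}"
  using weighted_absolutely_integrable by (auto simp: absolutely_integrable_on_def)

lemma green_has_weak_deriv:
  assumes h: "continuous_on {0..1} h"
  shows "has_weak_deriv (green \<beta> h) (\<lambda>z. z powr (-\<beta>) * green_flux \<beta> h z)"
  unfolding has_weak_deriv_iff
  using weighted_absolutely_integrable[OF green_flux_continuous_on[OF h]] by (simp add: green_def)

lemma green_continuous_on: "continuous_on {0..1} h \<Longrightarrow> continuous_on {0..1} (green \<beta> h)"
  by (rule has_weak_deriv_continuous_on[OF green_has_weak_deriv])

lemma green_0: "green \<beta> h 0 = 0"
  by (simp add: green_def)

lemma green_1:
  assumes h: "continuous_on {0..1} h"
  shows "green \<beta> h 1 = 0"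
proof -
  let ?I = "integral {0..1} (\<lambda>z. z powr (-\<beta>) * primitive h z)"
  have "((\<lambda>z. (1 - \<beta>) * ?I * z powr (-\<beta>) - z powr (-\<beta>) * primitive h z) has_integral
      ((1 - \<beta>) * ?I * (1 / (1 - \<beta>)) - ?I)) {0..1}"
    using integral_powr_neg[OF \<beta>(2), of 1] weighted_integrable[OF primitive_continuous_on[OF h]]
    by (intro has_integral_diff has_integral_mult_right) (simp_all add: has_integral_integral[symmetric])
  moreover have "(1 - \<beta>) * ?I * (1 / (1 - \<beta>)) - ?I = 0" using \<beta> by simp
  moreover have "(\<lambda>z. (1 - \<beta>) * ?I * z powr (-\<beta>) - z powr (-\<beta>) * primitive h z) =
      (\<lambda>z. z powr (-\<beta>) * green_flux \<beta> h z)"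
    by (simp add: green_flux_def algebra_simps fun_eq_iff)
  ultimately show ?thesis by (simp add: green_def has_integral_iff)
qed

text \<open>The integrand of \<open>green \<beta> h\<close> is singular at \<open>0\<close>; the fundamental theorem of calculus is
  applied on \<open>[x / 2, 1]\<close>, where it is continuous.\<close>

lemma green_has_derivative:
  assumes h: "continuous_on {0..1} h" and x: "x \<in> {0<..<1}"
  shows "(green \<beta> h has_real_derivative x powr (-\<beta>) * green_flux \<beta> h x) (at x)"
proof -
  define k where "k z = z powr (-\<beta>) * green_flux \<beta> h z" for z
  have k_int: "k integrable_on {0..1}"
    unfolding k_def by (rule weighted_integrable[OF green_flux_continuous_on[OF h]])
  define d where "d = x / 2"
  have d: "0 < d" "d < x" using x by (auto simp: d_def)
  have k_cont: "continuous_on {d..1} k"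
    unfolding k_def using d green_flux_continuous_on[OF h]
    by (intro continuous_intros continuous_on_subset[OF green_flux_continuous_on[OF h]]) auto
  have "((\<lambda>y. integral {d..y} k) has_real_derivative k x) (at x within {d..1})"
    using x d by (intro integral_has_real_derivative k_cont) auto
  then have "((\<lambda>y. integral {d..y} k) has_real_derivative k x) (at x)"
    using at_within_interior[of x "{d..1}"] x d by (simp add: interior_atLeastAtMost_real)
  then have "((\<lambda>y. integral {0..d} k + integral {d..y} k) has_real_derivative k x) (at x)"
    by (auto intro!: derivative_eq_intros)
  moreover have "\<forall>\<^sub>F y in nhds x. integral {0..d} k + integral {d..y} k = green \<beta> h y"
  proof -
    have "\<forall>\<^sub>F y in nhds x. y \<in> {d<..<1}"
      using x d by (intro eventually_nhds_in_open) auto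
    then show ?thesis
    proof eventually_elim
      case (elim y)
      have "k integrable_on {0..y}"
        using k_int elim by (rule_tac integrable_on_subinterval) auto
      then show ?case
        using Henstock_Kurzweil_Integration.integral_combine[of 0 d y k] elim d
        by (simp add: green_def k_def[abs_def])
    qed
  qed
  ultimately show ?thesis
    unfolding k_def by (simp add: DERIV_cong_ev[OF refl _ refl])
qed

lemma flux_green:
  assumes h: "continuous_on {0..1} h" and x: "x \<in> {0<..<1}"
  shows "flux \<beta> (green \<beta> h) x = green_flux \<beta> h x"
  using DERIV_imp_deriv[OF green_has_derivative[OF assms]] x
  by (simp add: flux_def powr_minus)

lemma flux_green_has_derivative:
  assumes h: "continuous_on {0..1} h" and x: "x \<in> {0<..<1}"
  shows "(flux \<beta> (green \<beta> h) has_real_derivative - h x) (at x)"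
proof -
  have "\<forall>\<^sub>F y in nhds x. y \<in> {0<..<1}"
    using x by (intro eventually_nhds_in_open) auto
  then have "\<forall>\<^sub>F y in nhds x. green_flux \<beta> h y = flux \<beta> (green \<beta> h) y"
    by eventually_elim (simp add: flux_green[OF h])
  with green_flux_has_derivative[OF assms, of \<beta>] show ?thesis
    by (simp add: DERIV_cong_ev[OF refl _ refl])
qed

lemma A_expr_green:
  assumes h: "continuous_on {0..1} h" and x: "x \<in> {0<..<1}"
  shows "A_expr \<beta> (green \<beta> h) x = h x" "A_differentiable \<beta> (green \<beta> h) x"
  using DERIV_imp_deriv[OF flux_green_has_derivative[OF assms]]
    flux_green_has_derivative[OF assms] green_has_derivative[OF assms]
  by (auto simp: A_expr_def A_differentiable_def real_differentiable_def)

lemma green_dom_A: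
  assumes L: "\<And>x y. \<lbrakk>x \<in> {0..1}; y \<in> {0..1}\<rbrakk> \<Longrightarrow> \<bar>h y - h x\<bar> \<le> L * \<bar>y - x\<bar>" "0 \<le> L"
    and h: "continuous_on {0..1} h"
  shows "dom_A \<beta> (green \<beta> h)"
  unfolding dom_A_def
proof (intro conjI ballI)
  show "\<exists>q. continuous_on {0..1} q \<and> (\<forall>x\<in>{0<..<1}. q x = flux \<beta> (green \<beta> h) x)"
    using green_flux_continuous_on[OF h] flux_green[OF h] by auto
  show "\<exists>r. AC_on 0 1 r \<and> (\<forall>x\<in>{0<..<1}. r x = deriv (flux \<beta> (green \<beta> h)) x)"
  proof (intro exI[of _ "\<lambda>x. - h x"] conjI ballI)
    show "AC_on 0 1 (\<lambda>x. - h x)"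
      using L by (intro Lipschitz_imp_AC_on[where L = L]) (auto simp: abs_minus_commute)
  qed (use DERIV_imp_deriv[OF flux_green_has_derivative[OF h]] in auto)
  show "L2_01 (A_expr \<beta> (green \<beta> h))"
    using h A_expr_green(1)[OF h] by (rule continuous_imp_L2_01)
qed (use green_continuous_on[OF h] A_expr_green[OF h] green_0 green_1[OF h] in auto)

text \<open>The variational formulation of \<open>A (green \<beta> h) = h\<close>, tested with functions of the energy space.\<close>

lemma weak_form_green_flux:
  assumes w: "has_weak_deriv \<psi> w" and bd: "\<psi> 0 = 0" "\<psi> 1 = 0" and h: "continuous_on {0..1} h"
  shows "(\<lambda>z. w z * green_flux \<beta> h z) absolutely_integrable_on {0..1}"
    and "integral {0..1} (\<lambda>z. w z * green_flux \<beta> h z) = integral {0..1} (\<lambda>z. \<psi> z * h z)"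
proof -
  have h': "continuous_on {0..1} (\<lambda>z. - h z)" by (intro continuous_intros h)
  note parts = ac_integration_by_parts[where W = \<psi> and H = "green_flux \<beta> h", OF has_weak_derivD(1)[OF w] h'
      has_weak_derivD(2)[OF w] green_flux_eq_integral[OF h]]
  show "(\<lambda>z. w z * green_flux \<beta> h z) absolutely_integrable_on {0..1}"
    by (rule parts(1))
  show "integral {0..1} (\<lambda>z. w z * green_flux \<beta> h z) = integral {0..1} (\<lambda>z. \<psi> z * h z)"
    using parts(2) bd by simp
qed

lemma green_energy:
  assumes u: "continuous_on {0..1} u" and h: "continuous_on {0..1} h"
  shows "integral {0..1} (\<lambda>z. green \<beta> h z * u z) =
    integral {0..1} (\<lambda>z. z powr (-\<beta>) * (green_flux \<beta> h z * green_flux \<beta> u z))"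
  using weak_form_green_flux(2)[OF green_has_weak_deriv[OF h] green_0 green_1[OF h] u]
  by (simp add: mult.assoc)

text \<open>Both sides are the energy product of the two solutions.\<close>

lemma green_symmetric:
  assumes u: "continuous_on {0..1} u" and h: "continuous_on {0..1} h"
  shows "integral {0..1} (\<lambda>z. green \<beta> h z * u z) = integral {0..1} (\<lambda>z. h z * green \<beta> u z)"
  using green_energy[OF u h] green_energy[OF h u] by (simp add: mult.commute)

text \<open>For a hat function \<open>h\<close>, the function \<open>green \<beta> h\<close> belongs to the initial domain, so the
  definition gives \<open>(v, h) = (w, green \<beta> h)\<close>, and this is \<open>(green \<beta> w, h)\<close> by symmetry. Hat functions
  separate continuous functions.\<close>

lemma friedrichs_A_imp_green:
  assumes F: "friedrichs_A \<beta> v w" and w: "continuous_on {0..1} w" and x: "x \<in> {0..1}"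
  shows "v x = green \<beta> w x"
proof -
  have v: "continuous_on {0..1} v"
    using F by (auto simp: friedrichs_A_def intro: W12_continuous_on W12_dot_imp_W12)
  note gw = green_continuous_on[OF w]
  have "integral {0..1} (\<lambda>x. (v x - green \<beta> w x) * max 0 (r - \<bar>x - c\<bar>)) = 0" for c r
  proof -
    define h where "h x = max 0 (r - \<bar>x - c\<bar>)" for x
    have h: "continuous_on {0..1} h" unfolding h_def by (intro continuous_intros)
    have "\<bar>h y - h x\<bar> \<le> 1 * \<bar>y - x\<bar>" for x y
      unfolding h_def by (auto simp: max_def abs_if)
    then have "dom_A \<beta> (green \<beta> h)" using h by (intro green_dom_A[where L = 1]) auto
    then have eq: "ip_01 v (A_expr \<beta> (green \<beta> h)) = ip_01 w (green \<beta> h)"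
      using F by (auto simp: friedrichs_A_def)
    have vh: "continuous_on {0..1} (\<lambda>x. v x * h x)" "continuous_on {0..1} (\<lambda>x. green \<beta> w x * h x)"
      by (intro continuous_intros v h gw)+
    have "ip_01 v (A_expr \<beta> (green \<beta> h)) = integral {0..1} (\<lambda>x. v x * A_expr \<beta> (green \<beta> h) x)"
      unfolding ip_01_def
      by (intro set_lebesgue_integral_eq_integral(2) integral_eq_interior(1)[OF vh(1)])
        (simp add: A_expr_green[OF h])
    also have "\<dots> = integral {0..1} (\<lambda>x. v x * h x)"
      by (intro integral_eq_interior(2)[OF vh(1)]) (simp add: A_expr_green[OF h])
    finally have "integral {0..1} (\<lambda>x. v x * h x) = ip_01 w (green \<beta> h)" using eq by simp
    also have "\<dots> = integral {0..1} (\<lambda>x. green \<beta> w x * h x)"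
      using green_symmetric[OF h w] ip_01_continuous[OF w green_continuous_on[OF h]] by simp
    finally have "integral {0..1} (\<lambda>x. v x * h x) - integral {0..1} (\<lambda>x. green \<beta> w x * h x) = 0"
      by simp
    then show ?thesis
      unfolding h_def[symmetric] left_diff_distrib
      using vh by (subst Henstock_Kurzweil_Integration.integral_diff) (auto intro!: integrable_continuous_real)
  qed
  then have "v x - green \<beta> w x = 0"
    using continuous_eq_zero_by_hats[of "\<lambda>x. v x - green \<beta> w x", OF _ _ x] v gw
    by (auto intro!: continuous_intros)
  then show ?thesis by simp
qed

end

section \<open>Eigenfunctions and Bessel inequalities\<close>

locale degenerate_eigensystem =
  fixes \<beta> :: real and v :: "nat \<Rightarrow> real \<Rightarrow> real" and lam :: "nat \<Rightarrow> real"
  assumes beta: "0 < \<beta>" "\<beta> < 1" and eigensystem: "eigensystem \<beta> v lam"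
begin

text \<open>The continuous extension of \<open>x\<^sup>\<beta> v\<^sub>k'\<close> to the closed interval.\<close>

definition eigen_flux :: "nat \<Rightarrow> real \<Rightarrow> real" where
  "eigen_flux k = green_flux \<beta> (\<lambda>x. lam k * v k x)"

lemma v_friedrichs: "friedrichs_A \<beta> (v k) (\<lambda>x. lam k * v k x)"
  using eigensystem by (simp add: eigensystem_def)

lemma v_W12_dot: "W12_dot \<beta> (v k)"
  using v_friedrichs by (simp add: friedrichs_A_def)

lemma v_continuous [continuous_intros]: "continuous_on {0..1} (v k)"
  by (intro W12_continuous_on[of \<beta>] W12_dot_imp_W12 v_W12_dot)

lemma v_boundary: "v k 0 = 0" "v k 1 = 0"
  using W12_dot_boundary[OF beta v_W12_dot] by auto

lemma lam_v_continuous: "continuous_on {0..1} (\<lambda>x. lam k * v k x)"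
  by (intro continuous_intros)

lemma v_eq_green: "x \<in> {0..1} \<Longrightarrow> v k x = green \<beta> (\<lambda>x. lam k * v k x) x"
  using friedrichs_A_imp_green[OF beta v_friedrichs lam_v_continuous] .

lemma eigen_flux_continuous: "continuous_on {0..1} (eigen_flux k)"
  unfolding eigen_flux_def by (rule green_flux_continuous_on[OF lam_v_continuous])

lemma v_eq_integral_eigen_flux:
  "x \<in> {0..1} \<Longrightarrow> v k x = integral {0..x} (\<lambda>z. z powr (-\<beta>) * eigen_flux k z)"
  by (simp add: v_eq_green green_def eigen_flux_def)

lemma v_orthonormal: "integral {0..1} (\<lambda>x. v j x * v k x) = (if j = k then 1 else 0)"
  using eigensystem ip_01_continuous[OF v_continuous v_continuous, of j k]
  by (simp add: eigensystem_def)

lemma weak_form_eigen_flux: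
  assumes "has_weak_deriv \<psi> w" "\<psi> 0 = 0" "\<psi> 1 = 0"
  shows "(\<lambda>z. w z * eigen_flux k z) absolutely_integrable_on {0..1}"
    and "integral {0..1} (\<lambda>z. w z * eigen_flux k z) = lam k * ip_01 \<psi> (v k)"
  using weak_form_green_flux[OF beta assms lam_v_continuous, of k]
    ip_01_continuous[OF has_weak_deriv_continuous_on[OF assms(1)] v_continuous, of k]
  by (simp_all add: eigen_flux_def mult.left_commute[of _ "lam k"])

lemma eigen_flux_orthogonal:
  "integral {0..1} (\<lambda>z. z powr (-\<beta>) * (eigen_flux j z * eigen_flux k z)) = (if j = k then lam k else 0)"
proof -
  have "integral {0..1} (\<lambda>z. z powr (-\<beta>) * (eigen_flux j z * eigen_flux k z)) =
      integral {0..1} (\<lambda>z. green \<beta> (\<lambda>x. lam j * v j x) z * (lam k * v k z))"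
    unfolding eigen_flux_def by (rule green_energy[OF beta lam_v_continuous lam_v_continuous, symmetric])
  also have "\<dots> = integral {0..1} (\<lambda>z. lam k * (v j z * v k z))"
    by (intro Henstock_Kurzweil_Integration.integral_cong) (simp add: v_eq_green[symmetric])
  finally show ?thesis by (simp add: v_orthonormal)
qed

text \<open>\<open>lam k\<close> is the weighted square norm of the flux; it cannot vanish, for then
  \<open>v\<^sub>k = green \<beta> 0 = 0\<close> would not be normalized.\<close>

lemma lam_pos: "0 < lam k"
proof -
  have "0 \<le> integral {0..1} (\<lambda>z. z powr (-\<beta>) * (eigen_flux k z * eigen_flux k z))"
    by (intro integral_nonneg weighted_integrable[OF beta] continuous_intros eigen_flux_continuous) simp
  then have "0 \<le> lam k" by (simp add: eigen_flux_orthogonal)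
  moreover have "lam k \<noteq> 0"
  proof
    assume "lam k = 0"
    then have "v k x = 0" if "x \<in> {0..1}" for x
      using v_eq_green[OF that, of k] by (simp add: green_def green_flux_def primitive_def[abs_def])
    then have "integral {0..1} (\<lambda>x. v k x * v k x) = integral {0..1} (\<lambda>x::real. 0)"
      by (intro Henstock_Kurzweil_Integration.integral_cong) auto
    then show False by (simp add: v_orthonormal)
  qed
  ultimately show ?thesis by simp
qed

text \<open>Bessel's inequality for the orthonormal system \<open>x\<^sup>-\<^sup>\<beta>\<^sup>/\<^sup>2 q\<^sub>k / sqrt (lam k)\<close> applied to
  \<open>x\<^sup>\<beta>\<^sup>/\<^sup>2 F\<close>: the integrand \<open>d\<close> is \<open>x\<^sup>\<beta>\<close> times the squared difference of \<open>F\<close> and its projection. At the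
  origin the powers take the default value \<open>0\<close>, so this point is removed.\<close>

lemma bessel:
  assumes F: "\<And>k. (\<lambda>z. F z * eigen_flux k z) integrable_on {0..1}"
    and F2: "(\<lambda>z. z powr \<beta> * (F z)\<^sup>2) integrable_on {0..1}" and S: "finite S"
  shows "(\<Sum>k\<in>S. (integral {0..1} (\<lambda>z. F z * eigen_flux k z))\<^sup>2 / lam k) \<le>
    integral {0..1} (\<lambda>z. z powr \<beta> * (F z)\<^sup>2)"
proof -
  define I where "I k = integral {0..1} (\<lambda>z. F z * eigen_flux k z)" for k
  define c where "c k = I k / lam k" for k
  define d where "d z = z powr \<beta> * (F z)\<^sup>2 - 2 * (\<Sum>k\<in>S. c k * (F z * eigen_flux k z))
     + (\<Sum>j\<in>S. \<Sum>k\<in>S. c j * c k * (z powr (-\<beta>) * (eigen_flux j z * eigen_flux k z)))" for z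
  have prods: "((\<lambda>z. z powr (-\<beta>) * (eigen_flux j z * eigen_flux k z)) has_integral (if j = k then lam k else 0)) {0..1}"
    for j k
    using weighted_integrable[OF beta, of "\<lambda>z. eigen_flux j z * eigen_flux k z"] eigen_flux_orthogonal[of j k]
    by (auto simp: has_integral_iff intro!: continuous_intros eigen_flux_continuous)
  have "(d has_integral (integral {0..1} (\<lambda>z. z powr \<beta> * (F z)\<^sup>2) - 2 * (\<Sum>k\<in>S. c k * I k)
     + (\<Sum>j\<in>S. \<Sum>k\<in>S. c j * c k * (if j = k then lam k else 0)))) {0..1}"
    unfolding d_def I_def using F F2 S
    by (intro has_integral_add has_integral_diff has_integral_mult_right has_integral_sum prods)
      (auto simp: has_integral_integral[symmetric])
  moreover have "(\<Sum>j\<in>S. \<Sum>k\<in>S. c j * c k * (if j = k then lam k else 0)) = (\<Sum>j\<in>S. c j * c j * lam j)"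
    using S by (intro sum.cong) (auto simp: if_distrib sum.delta cong: if_cong)
  moreover have "c j * c j * lam j = c j * I j" for j using lam_pos[of j] by (simp add: c_def)
  ultimately have d: "(d has_integral (integral {0..1} (\<lambda>z. z powr \<beta> * (F z)\<^sup>2) - (\<Sum>k\<in>S. c k * I k))) {0..1}"
    by simp
  have "((\<lambda>z. if z = 0 then 0 else d z) has_integral (integral {0..1} (\<lambda>z. z powr \<beta> * (F z)\<^sup>2) - (\<Sum>k\<in>S. c k * I k))) {0..1}"
    by (rule has_integral_spike[OF _ _ d, of "{0}"]) auto
  moreover have "0 \<le> (if z = 0 then 0 else d z)" if "z \<in> {0..1}" for z
  proof (cases "z = 0")
    case False
    define w where "w = z powr \<beta>"
    have w: "0 < w" using that False by (simp add: w_def)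
    have "d z = w * (F z - (\<Sum>k\<in>S. c k * eigen_flux k z) / w)\<^sup>2"
    proof -
      have "(\<Sum>j\<in>S. \<Sum>k\<in>S. c j * c k * (z powr (-\<beta>) * (eigen_flux j z * eigen_flux k z))) =
          (\<Sum>k\<in>S. c k * eigen_flux k z)\<^sup>2 / w"
        unfolding power2_eq_square sum_product sum_divide_distrib powr_minus w_def[symmetric]
        by (intro sum.cong) (simp_all add: field_simps)
      moreover have "(\<Sum>k\<in>S. c k * (F z * eigen_flux k z)) = F z * (\<Sum>k\<in>S. c k * eigen_flux k z)"
        by (simp add: sum_distrib_left mult.left_commute)
      ultimately show ?thesis
        unfolding d_def w_def[symmetric] using w by (simp add: field_simps power2_eq_square)
    qed
    then show ?thesis using w False by simp
  qed simp
  ultimately have "0 \<le> integral {0..1} (\<lambda>z. z powr \<beta> * (F z)\<^sup>2) - (\<Sum>k\<in>S. c k * I k)"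
    by (rule has_integral_nonneg)
  moreover have "c k * I k = (I k)\<^sup>2 / lam k" for k by (simp add: c_def power2_eq_square)
  ultimately show ?thesis by (simp add: I_def)
qed

text \<open>\<open>v\<^sub>k(x)\<close> is the integral of \<open>F q\<^sub>k\<close>, where \<open>F\<close> is \<open>z\<^sup>-\<^sup>\<beta>\<close> cut off at \<open>x\<close>; the energy of this
  \<open>F\<close> is the integral of \<open>z\<^sup>-\<^sup>\<beta>\<close> over \<open>[0, x]\<close>.\<close>

lemma bessel_pointwise:
  assumes x: "x \<in> {0..1}" and S: "finite S"
  shows "(\<Sum>k\<in>S. (v k x)\<^sup>2 / lam k) \<le> 1 / (1 - \<beta>)"
proof -
  define F where "F z = (if z \<in> {0..x} then z powr (-\<beta>) else 0)" for z
  have sub: "{0..x} \<subseteq> {0..1}" using x by auto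
  have I: "((\<lambda>z. F z * eigen_flux k z) has_integral v k x) {0..1}" for k
  proof -
    have "(\<lambda>z. z powr (-\<beta>) * eigen_flux k z) integrable_on {0..x}"
      by (rule integrable_on_subinterval[OF weighted_integrable[OF beta eigen_flux_continuous] sub])
    then have "((\<lambda>z. z powr (-\<beta>) * eigen_flux k z) has_integral v k x) {0..x}"
      using v_eq_integral_eigen_flux[OF x, of k] by (simp add: has_integral_iff)
    then have "((\<lambda>z. if z \<in> {0..x} then z powr (-\<beta>) * eigen_flux k z else 0) has_integral v k x) {0..1}"
      using has_integral_restrict_closed_subinterval[of _ _ 0 x 0 1] x
      by (simp add: has_integral_restrict[OF sub])
    moreover have "(\<lambda>z. if z \<in> {0..x} then z powr (-\<beta>) * eigen_flux k z else 0) = (\<lambda>z. F z * eigen_flux k z)"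
      by (auto simp: F_def fun_eq_iff)
    ultimately show ?thesis by simp
  qed
  have F2: "((\<lambda>z. z powr \<beta> * (F z)\<^sup>2) has_integral x powr (1 - \<beta>) / (1 - \<beta>)) {0..1}"
  proof -
    have "((\<lambda>z. z powr (-\<beta>)) has_integral x powr (1 - \<beta>) / (1 - \<beta>)) {0..x}"
      using integral_powr_neg[of \<beta> x] beta x by auto
    then have "((\<lambda>z. if z \<in> {0..x} then z powr (-\<beta>) else 0) has_integral x powr (1 - \<beta>) / (1 - \<beta>)) {0..1}"
      by (simp only: has_integral_restrict[OF sub])
    moreover have "(\<lambda>z. if z \<in> {0..x} then z powr (-\<beta>) else 0) = (\<lambda>z. z powr \<beta> * (F z)\<^sup>2)"
      by (auto simp: F_def fun_eq_iff power2_eq_square powr_minus field_simps)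
    ultimately show ?thesis by simp
  qed
  have "(\<Sum>k\<in>S. (v k x)\<^sup>2 / lam k) = (\<Sum>k\<in>S. (integral {0..1} (\<lambda>z. F z * eigen_flux k z))\<^sup>2 / lam k)"
    using I by (simp add: has_integral_iff)
  also have "\<dots> \<le> integral {0..1} (\<lambda>z. z powr \<beta> * (F z)\<^sup>2)"
    using I F2 by (intro bessel S) (auto simp: has_integral_iff)
  also have "\<dots> = x powr (1 - \<beta>) / (1 - \<beta>)" using F2 by (simp add: has_integral_iff)
  also have "\<dots> \<le> 1 / (1 - \<beta>)"
    using x beta powr_mono2[of "1 - \<beta>" x 1] by (intro divide_right_mono) auto
  finally show ?thesis .
qed

text \<open>Here \<open>F = \<psi>'\<close>; the weak formulation identifies the integral of \<open>\<psi>' q\<^sub>k\<close> as \<open>lam k\<close> times the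
  coefficient of \<open>\<psi>\<close>.\<close>

lemma bessel_energy:
  assumes W: "W12 \<beta> \<psi>" and bd: "\<psi> 0 = 0" "\<psi> 1 = 0" and S: "finite S"
  shows "(\<Sum>k\<in>S. lam k * (ip_01 \<psi> (v k))\<^sup>2) \<le> (norm_W12 \<beta> \<psi>)\<^sup>2"
proof -
  obtain w where w: "has_weak_deriv \<psi> w" "(energy_density \<beta> w) absolutely_integrable_on {0..1}"
    "integral {0..1} (energy_density \<beta> w) \<le> (norm_W12 \<beta> \<psi>)\<^sup>2"
    using W12_energy[OF W] .
  note wf = weak_form_eigen_flux[OF w(1) bd]
  have "(\<Sum>k\<in>S. lam k * (ip_01 \<psi> (v k))\<^sup>2) = (\<Sum>k\<in>S. (integral {0..1} (\<lambda>z. w z * eigen_flux k z))\<^sup>2 / lam k)"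
  proof (intro sum.cong refl)
    fix k show "lam k * (ip_01 \<psi> (v k))\<^sup>2 = (integral {0..1} (\<lambda>z. w z * eigen_flux k z))\<^sup>2 / lam k"
      using lam_pos[of k] unfolding wf(2) by (simp add: power2_eq_square)
  qed
  also have "\<dots> \<le> integral {0..1} (energy_density \<beta> w)"
    using wf(1) w(2) by (intro bessel S) (auto simp: absolutely_integrable_on_def)
  also have "\<dots> \<le> (norm_W12 \<beta> \<psi>)\<^sup>2" by (rule w(3))
  finally show ?thesis .
qed

text \<open>Symmetry of the Green operator moves \<open>A\<close> from \<open>\<phi>\<close> to the eigenfunction.\<close>

lemma friedrichs_coefficient:
  assumes F: "friedrichs_A \<beta> \<phi> \<psi>" and \<psi>: "continuous_on {0..1} \<psi>"
  shows "lam k * ip_01 \<phi> (v k) = ip_01 \<psi> (v k)"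
proof -
  have \<phi>: "W12_dot \<beta> \<phi>" using F by (simp add: friedrichs_A_def)
  have \<phi>c: "continuous_on {0..1} \<phi>" by (intro W12_continuous_on[of \<beta>] W12_dot_imp_W12 \<phi>)
  have "ip_01 \<psi> (v k) = integral {0..1} (\<lambda>z. \<psi> z * green \<beta> (\<lambda>x. lam k * v k x) z)"
    unfolding ip_01_continuous[OF \<psi> v_continuous]
    by (intro Henstock_Kurzweil_Integration.integral_cong) (simp add: v_eq_green[symmetric])
  also have "\<dots> = integral {0..1} (\<lambda>z. green \<beta> \<psi> z * (lam k * v k z))"
    by (rule green_symmetric[OF beta lam_v_continuous \<psi>, symmetric])
  also have "\<dots> = integral {0..1} (\<lambda>z. lam k * (\<phi> z * v k z))"
    using friedrichs_A_imp_green[OF beta F \<psi>]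
    by (intro Henstock_Kurzweil_Integration.integral_cong) simp
  finally show ?thesis by (simp add: ip_01_continuous[OF \<phi>c v_continuous])
qed

lemma eq_of_coefficients:
  assumes g: "continuous_on {0..1} g" and h: "continuous_on {0..1} h"
    and eq: "\<And>k. ip_01 g (v k) = ip_01 h (v k)" and x: "x \<in> {0..1}"
  shows "g x = h x"
proof -
  have d: "continuous_on {0..1} (\<lambda>x. g x - h x)" by (intro continuous_intros g h)
  have "ip_01 (\<lambda>x. g x - h x) (v k) = 0" for k
  proof -
    have "(\<lambda>x. g x * v k x) integrable_on {0..1}" "(\<lambda>x. h x * v k x) integrable_on {0..1}"
      by (intro integrable_continuous_real continuous_intros g h)+
    then have "integral {0..1} (\<lambda>x. g x * v k x - h x * v k x) = ip_01 g (v k) - ip_01 h (v k)"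
      by (simp add: Henstock_Kurzweil_Integration.integral_diff ip_01_continuous g h v_continuous)
    then show ?thesis by (simp add: ip_01_continuous[OF d v_continuous] left_diff_distrib eq)
  qed
  moreover have "L2_01 (\<lambda>x. g x - h x)" by (rule continuous_imp_L2_01[OF d]) simp
  ultimately have "AE x in lebesgue. x \<in> {0..1} \<longrightarrow> g x - h x = 0"
    using eigensystem unfolding eigensystem_def by blast
  then have neg: "negligible {x \<in> {0..1}. (g x - h x)\<^sup>2 \<noteq> 0}"
    unfolding eventually_ae_filter_negligible by (elim exE conjE, elim negligible_subset) auto
  have "((\<lambda>x. (g x - h x)\<^sup>2) has_integral 0) {0..1}"
    by (rule has_integral_spike[OF neg _ has_integral_0]) auto
  moreover have "continuous_on {0..1} (\<lambda>x. (g x - h x)\<^sup>2)" by (intro continuous_intros g h)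
  ultimately have "(g x - h x)\<^sup>2 = 0"
    using has_integral_0_cbox_imp_0[of 0 1 "\<lambda>x. (g x - h x)\<^sup>2" x] x by (auto simp: box_real)
  then show ?thesis by simp
qed

section \<open>Uniformly convergent eigenfunction series\<close>

text \<open>Tails are taken over arbitrary finite sets of large indices, which is the form that survives
  sums, the Cauchy criterion and finite covers alike.\<close>

definition uniform_energy_tails :: "'t set \<Rightarrow> (nat \<Rightarrow> 't \<Rightarrow> real) \<Rightarrow> bool" where
  "uniform_energy_tails X c \<longleftrightarrow> (\<forall>\<epsilon>>0. \<exists>N. \<forall>t\<in>X. \<forall>S. finite S \<longrightarrow> S \<subseteq> {N..} \<longrightarrow>
     (\<Sum>k\<in>S. lam k * (c k t)\<^sup>2) \<le> \<epsilon>)"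

lemma uniform_energy_tailsD:
  "uniform_energy_tails X c \<Longrightarrow> 0 < \<epsilon> \<Longrightarrow>
    \<exists>N. \<forall>t\<in>X. \<forall>S. finite S \<longrightarrow> S \<subseteq> {N..} \<longrightarrow> (\<Sum>k\<in>S. lam k * (c k t)\<^sup>2) \<le> \<epsilon>"
  by (simp add: uniform_energy_tails_def)

lemma lam_square_add_le: "lam k * (x + y)\<^sup>2 \<le> 2 * (lam k * x\<^sup>2) + 2 * (lam k * y\<^sup>2)"
proof -
  have "(x + y)\<^sup>2 \<le> 2 * x\<^sup>2 + 2 * y\<^sup>2"
    using zero_le_power2[of "x - y"] by (simp add: power2_eq_square algebra_simps)
  then have "lam k * (x + y)\<^sup>2 \<le> lam k * (2 * x\<^sup>2 + 2 * y\<^sup>2)"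
    using lam_pos[of k] by (intro mult_left_mono) auto
  then show ?thesis by (simp add: algebra_simps)
qed

lemma uniform_energy_tails_diff:
  assumes c: "uniform_energy_tails X c" and d: "uniform_energy_tails X d"
  shows "uniform_energy_tails X (\<lambda>k t. c k t - d k t)"
  unfolding uniform_energy_tails_def
proof (intro allI impI)
  fix \<epsilon> :: real assume "0 < \<epsilon>"
  then have e: "0 < \<epsilon> / 4" by simp
  from uniform_energy_tailsD[OF c e] obtain M where
    M: "\<forall>t\<in>X. \<forall>S. finite S \<longrightarrow> S \<subseteq> {M..} \<longrightarrow> (\<Sum>k\<in>S. lam k * (c k t)\<^sup>2) \<le> \<epsilon> / 4" ..
  from uniform_energy_tailsD[OF d e] obtain N where
    N: "\<forall>t\<in>X. \<forall>S. finite S \<longrightarrow> S \<subseteq> {N..} \<longrightarrow> (\<Sum>k\<in>S. lam k * (d k t)\<^sup>2) \<le> \<epsilon> / 4" ..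
  show "\<exists>N. \<forall>t\<in>X. \<forall>S. finite S \<longrightarrow> S \<subseteq> {N..} \<longrightarrow> (\<Sum>k\<in>S. lam k * (c k t - d k t)\<^sup>2) \<le> \<epsilon>"
  proof (intro exI[of _ "max M N"] ballI allI impI)
    fix t and S :: "nat set" assume "t \<in> X" "finite S" "S \<subseteq> {max M N..}"
    then have S: "S \<subseteq> {M..}" "S \<subseteq> {N..}" by auto
    have "(\<Sum>k\<in>S. lam k * (c k t - d k t)\<^sup>2) \<le> (\<Sum>k\<in>S. 2 * (lam k * (c k t)\<^sup>2) + 2 * (lam k * (d k t)\<^sup>2))"
    proof (rule sum_mono)
      fix k show "lam k * (c k t - d k t)\<^sup>2 \<le> 2 * (lam k * (c k t)\<^sup>2) + 2 * (lam k * (d k t)\<^sup>2)"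
        using lam_square_add_le[of k "c k t" "- d k t"] by simp
    qed
    also have "\<dots> \<le> \<epsilon>"
      using M[rule_format, OF \<open>t \<in> X\<close> \<open>finite S\<close> S(1)] N[rule_format, OF \<open>t \<in> X\<close> \<open>finite S\<close> S(2)]
      by (simp add: sum.distrib sum_distrib_left[symmetric])
    finally show "(\<Sum>k\<in>S. lam k * (c k t - d k t)\<^sup>2) \<le> \<epsilon>" .
  qed
qed

text \<open>Cauchy-Schwarz with the factors \<open>sqrt (lam k) * c k\<close> and \<open>v k x / sqrt (lam k)\<close>.\<close>

lemma eigen_sum_bound:
  assumes x: "x \<in> {0..1}" and S: "finite S" and e: "(\<Sum>k\<in>S. lam k * (c k)\<^sup>2) \<le> \<epsilon>"
  shows "(\<Sum>k\<in>S. c k * v k x)\<^sup>2 \<le> \<epsilon> / (1 - \<beta>)"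
proof -
  have "(\<Sum>k\<in>S. c k * v k x) = (\<Sum>k\<in>S. (sqrt (lam k) * c k) * (v k x / sqrt (lam k)))"
    using lam_pos by (intro sum.cong) (auto simp: less_imp_neq[THEN not_sym])
  then have "(\<Sum>k\<in>S. c k * v k x)\<^sup>2 \<le> (\<Sum>k\<in>S. (sqrt (lam k) * c k)\<^sup>2) * (\<Sum>k\<in>S. (v k x / sqrt (lam k))\<^sup>2)"
    using Cauchy_Schwarz_ineq_sum[of "\<lambda>k. sqrt (lam k) * c k" "\<lambda>k. v k x / sqrt (lam k)" S] by simp
  also have "\<dots> = (\<Sum>k\<in>S. lam k * (c k)\<^sup>2) * (\<Sum>k\<in>S. (v k x)\<^sup>2 / lam k)"
    using lam_pos by (simp add: power_mult_distrib power_divide less_imp_le)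
  also have "\<dots> \<le> \<epsilon> * (1 / (1 - \<beta>))"
  proof (intro mult_mono e bessel_pointwise x S)
    show "0 \<le> \<epsilon>"
      using e lam_pos by (meson less_imp_le mult_nonneg_nonneg order_trans sum_nonneg zero_le_power2)
    show "0 \<le> (\<Sum>k\<in>S. (v k x)\<^sup>2 / lam k)"
      using lam_pos by (intro sum_nonneg divide_nonneg_pos) auto
  qed
  finally show ?thesis by simp
qed

lemma eigen_series_uniform:
  fixes X :: "'t set"
  assumes c: "uniform_energy_tails X c"
  shows "uniform_limit ({0..1} \<times> X) (\<lambda>n (x, t). \<Sum>k<n. c k t * v k x) (\<lambda>(x, t). \<Sum>k. c k t * v k x) sequentially"
    and "\<And>x t. x \<in> {0..1} \<Longrightarrow> t \<in> X \<Longrightarrow> summable (\<lambda>k. c k t * v k x)"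
proof -
  let ?s = "\<lambda>n (x :: real, t :: 't). \<Sum>k<n. c k t * v k x"
  have "uniformly_Cauchy_on ({0..1} \<times> X) ?s"
  proof (rule uniformly_Cauchy_onI)
    fix e :: real assume e: "0 < e"
    \<comment> \<open>The factor \<open>1 - \<beta>\<close> cancels the one in \<open>eigen_sum_bound\<close>, which leaves \<open>(e / 2)\<^sup>2\<close>.\<close>
    then have "0 < (1 - \<beta>) * e\<^sup>2 / 4" using beta by simp
    from uniform_energy_tailsD[OF c this] obtain N where N: "\<forall>t\<in>X. \<forall>S. finite S \<longrightarrow> S \<subseteq> {N..} \<longrightarrow>
        (\<Sum>k\<in>S. lam k * (c k t)\<^sup>2) \<le> (1 - \<beta>) * e\<^sup>2 / 4" ..
    have less: "dist (?s m y) (?s n y) < e" if mn: "N \<le> m" "m \<le> n" and y: "y \<in> {0..1} \<times> X"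
      for m n and y :: "real \<times> 't"
    proof -
      obtain x t where xt: "y = (x, t)" "x \<in> {0..1}" "t \<in> X" using y by auto
      have "(\<Sum>k\<in>{m..<n}. c k t * v k x)\<^sup>2 \<le> ((1 - \<beta>) * e\<^sup>2 / 4) / (1 - \<beta>)"
        using N xt(3) mn by (intro eigen_sum_bound[OF xt(2)] N[rule_format, OF xt(3)]) auto
      also have "\<dots> = (e / 2)\<^sup>2" using beta by (simp add: field_simps power2_eq_square)
      finally have "\<bar>\<Sum>k\<in>{m..<n}. c k t * v k x\<bar> \<le> e / 2"
        using e by (simp add: abs_le_square_iff[symmetric])
      moreover have "(\<Sum>k\<in>{m..<n}. c k t * v k x) = ?s n y - ?s m y"
        using mn xt sum_diff_nat_ivl[of 0 m n "\<lambda>k. c k t * v k x"] by (simp add: atLeast0LessThan)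
      ultimately show ?thesis
        using e unfolding dist_commute[of "?s m y"] dist_real_def by linarith
    qed
    show "\<exists>M. \<forall>x\<in>{0..1} \<times> X. \<forall>m\<ge>M. \<forall>n\<ge>M. dist (?s m x) (?s n x) < e"
    proof (intro exI[of _ N] ballI allI impI)
      fix y :: "real \<times> 't" and m n assume "y \<in> {0..1} \<times> X" "N \<le> m" "N \<le> n"
      note y = this
      show "dist (?s m y) (?s n y) < e"
      proof (cases "m \<le> n")
        case True
        then show ?thesis using y by (intro less)
      next
        case False
        then have "dist (?s n y) (?s m y) < e" using y by (intro less) auto
        then show ?thesis by (simp only: dist_commute)
      qed
    qed
  qed
  then obtain l where l: "uniform_limit ({0..1} \<times> X) ?s l sequentially"
    using Cauchy_uniformly_convergent unfolding uniformly_convergent_on_def by blast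
  have sums: "(\<lambda>k. c k t * v k x) sums l (x, t)" if "x \<in> {0..1}" "t \<in> X" for x t
    using tendsto_uniform_limitI[OF l, of "(x, t)"] that by (simp add: sums_def)
  show "\<And>x t. x \<in> {0..1} \<Longrightarrow> t \<in> X \<Longrightarrow> summable (\<lambda>k. c k t * v k x)"
    using sums sums_summable by blast
  show "uniform_limit ({0..1} \<times> X) ?s (\<lambda>(x, t). \<Sum>k. c k t * v k x) sequentially"
    by (rule uniform_limit_cong'[THEN iffD1, OF _ _ l]) (auto simp: sums[THEN sums_unique])
qed

lemma eigen_series_continuous_on:
  assumes c: "uniform_energy_tails X c" and cc: "\<And>k. continuous_on X (c k)"
  shows "continuous_on ({0..1} \<times> X) (\<lambda>(x, t). \<Sum>k. c k t * v k x)"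
proof (rule uniform_limit_theorem[OF _ eigen_series_uniform(1)[OF c]])
  have "continuous_on ({0..1} \<times> X) (\<lambda>p. \<Sum>k<n. c k (snd p) * v k (fst p))" for n
    by (intro continuous_intros continuous_on_compose2[OF cc continuous_on_snd]
        continuous_on_compose2[OF v_continuous continuous_on_fst]) auto
  then show "\<forall>\<^sub>F n in sequentially. continuous_on ({0..1} \<times> X) (\<lambda>(x, t). \<Sum>k<n. c k t * v k x)"
    by (simp add: case_prod_beta)
qed simp

text \<open>Uniform convergence allows integrating the series against \<open>v j\<close> term by term.\<close>

lemma eigen_series_slice:
  assumes c: "uniform_energy_tails X c" and t: "t \<in> X"
  shows "continuous_on {0..1} (\<lambda>x. \<Sum>k. c k t * v k x)"
    and "ip_01 (\<lambda>x. \<Sum>k. c k t * v k x) (v j) = c j t"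
proof -
  have u: "uniform_limit {0..1} (\<lambda>n x. \<Sum>k<n. c k t * v k x) (\<lambda>x. \<Sum>k. c k t * v k x) sequentially"
    using uniform_limit_compose'[OF eigen_series_uniform(1)[OF c], of "\<lambda>x. (x, t)" "{0..1}"] t by auto
  have pc: "continuous_on {0..1} (\<lambda>x. \<Sum>k<n. c k t * v k x)" for n
    by (intro continuous_intros)
  show cont: "continuous_on {0..1} (\<lambda>x. \<Sum>k. c k t * v k x)"
    by (rule uniform_limit_theorem[OF _ u]) (auto intro!: always_eventually pc)
  have "bounded (v j ` {0..1})"
    by (intro compact_imp_bounded compact_continuous_image v_continuous) auto
  then have u2: "uniform_limit {0..1} (\<lambda>n x. (\<Sum>k<n. c k t * v k x) * v j x)
      (\<lambda>x. (\<Sum>k. c k t * v k x) * v j x) sequentially"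
    using compact_imp_bounded[OF compact_continuous_image[OF cont]]
    by (intro bounded_bilinear.bounded_uniform_limit[OF bounded_bilinear_mult] u) (auto intro!: uniform_limit_intros)
  obtain I J where I: "\<And>n. ((\<lambda>x. (\<Sum>k<n. c k t * v k x) * v j x) has_integral I n) {0..1}"
    and J: "((\<lambda>x. (\<Sum>k. c k t * v k x) * v j x) has_integral J) {0..1}" and IJ: "I \<longlonglongrightarrow> J"
    by (rule uniform_limit_integral[OF u2 continuous_on_mult[OF pc v_continuous] sequentially_bot], rule that)
  have "I n = c j t" if "j < n" for n
  proof -
    have "((\<lambda>x. \<Sum>k<n. c k t * (v k x * v j x)) has_integral (\<Sum>k<n. c k t * (if k = j then 1 else 0))) {0..1}"
    proof (intro has_integral_sum has_integral_mult_right)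
      fix k
      have "(\<lambda>x. v k x * v j x) integrable_on {0..1}"
        by (intro integrable_continuous_real continuous_intros)
      then show "((\<lambda>x. v k x * v j x) has_integral (if k = j then 1 else 0)) {0..1}"
        using v_orthonormal[of k j] by (simp only: has_integral_iff)
    qed simp
    moreover have "(\<lambda>x. \<Sum>k<n. c k t * (v k x * v j x)) = (\<lambda>x. (\<Sum>k<n. c k t * v k x) * v j x)"
      by (simp add: sum_distrib_right mult.assoc)
    ultimately have "((\<lambda>x. (\<Sum>k<n. c k t * v k x) * v j x) has_integral
        (\<Sum>k<n. c k t * (if k = j then 1 else 0))) {0..1}" by simp
    then have "I n = (\<Sum>k<n. c k t * (if k = j then 1 else 0))"
      by (rule has_integral_unique[OF I[of n]])
    also have "\<dots> = c j t" using that by (simp add: if_distrib sum.delta cong: if_cong)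
    finally show ?thesis .
  qed
  then have "\<forall>\<^sub>F n in sequentially. I n = c j t"
    by (auto simp: eventually_sequentially intro!: exI[of _ "Suc j"])
  then have "I \<longlonglongrightarrow> c j t" by (rule tendsto_eventually)
  then have "J = c j t" using IJ LIMSEQ_unique by blast
  then show "ip_01 (\<lambda>x. \<Sum>k. c k t * v k x) (v j) = c j t"
    using J ip_01_continuous[OF cont v_continuous] by (simp add: has_integral_iff)
qed

lemma uniform_energy_tails_W12:
  assumes W: "W12 \<beta> \<psi>" and bd: "\<psi> 0 = 0" "\<psi> 1 = 0"
  shows "uniform_energy_tails X (\<lambda>k t. ip_01 \<psi> (v k))"
  unfolding uniform_energy_tails_def
proof (intro allI impI)
  fix \<epsilon> :: real assume e: "0 < \<epsilon>"
  let ?g = "\<lambda>k. lam k * (ip_01 \<psi> (v k))\<^sup>2"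
  have g0: "0 \<le> ?g k" for k using lam_pos[of k] by simp
  have sm: "summable ?g"
    using bessel_energy[OF W bd] by (intro summableI_nonneg_bounded[OF g0]) auto
  then obtain N where N: "\<And>n. norm (sum ?g {N..<n}) < \<epsilon>"
    using e unfolding summable_Cauchy by (metis order_refl)
  show "\<exists>N. \<forall>t\<in>X. \<forall>S. finite S \<longrightarrow> S \<subseteq> {N..} \<longrightarrow> sum ?g S \<le> \<epsilon>"
  proof (intro exI[of _ N] ballI allI impI)
    fix S assume S: "finite S" "S \<subseteq> {N..}"
    then have "S \<subseteq> {N..<Suc (Max S)}" by (auto simp: le_imp_less_Suc)
    then have "sum ?g S \<le> sum ?g {N..<Suc (Max S)}" using g0 by (intro sum_mono2) auto
    also have "\<dots> < \<epsilon>" using N[of "Suc (Max S)"] by simp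
    finally show "sum ?g S \<le> \<epsilon>" by simp
  qed
qed

lemma ip_01_diff:
  assumes "continuous_on {0..1} g" "continuous_on {0..1} h"
  shows "ip_01 (\<lambda>x. g x - h x) (v k) = ip_01 g (v k) - ip_01 h (v k)"
proof -
  have "(\<lambda>x. g x * v k x) integrable_on {0..1}" "(\<lambda>x. h x * v k x) integrable_on {0..1}"
    by (intro integrable_continuous_real continuous_intros assms)+
  then show ?thesis
    using assms by (simp add: ip_01_continuous v_continuous continuous_on_diff left_diff_distrib
        Henstock_Kurzweil_Integration.integral_diff)
qed

lemma C_W12_dotD:
  assumes f: "C_W12_dot \<beta> a T f" and t: "t \<in> {a..T}"
  shows "W12_dot \<beta> (\<lambda>x. f x t)" "W12 \<beta> (\<lambda>x. f x t)" "continuous_on {0..1} (\<lambda>x. f x t)"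
    "f 0 t = 0" "f 1 t = 0"
    and "((\<lambda>s. norm_W12 \<beta> (\<lambda>x. f x s - f x t)) \<longlongrightarrow> 0) (at t within {a..T})"
proof -
  show W: "W12_dot \<beta> (\<lambda>x. f x t)" using f t by (simp add: C_W12_dot_def)
  then show "W12 \<beta> (\<lambda>x. f x t)" by (rule W12_dot_imp_W12)
  then show "continuous_on {0..1} (\<lambda>x. f x t)" by (rule W12_continuous_on)
  show "f 0 t = 0" "f 1 t = 0" using W12_dot_boundary[OF beta W] by auto
qed (use f t in \<open>simp add: C_W12_dot_def\<close>)

text \<open>At a fixed time the tails are small because the energy series converges. By the energy form of
  Bessel's inequality for \<open>f s - f t\<close> the same index serves a whole neighbourhood of the time, and
  finitely many neighbourhoods cover the interval.\<close>

lemma uniform_energy_tails_C_W12_dot: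
  assumes f: "C_W12_dot \<beta> a T f"
  shows "uniform_energy_tails {a..T} (\<lambda>k t. ip_01 (\<lambda>x. f x t) (v k))"
  unfolding uniform_energy_tails_def
proof (intro allI impI)
  fix \<epsilon> :: real assume e: "0 < \<epsilon>"
  define c where "c k t = ip_01 (\<lambda>x. f x t) (v k)" for k t
  define P where "P t \<delta> N \<longleftrightarrow> 0 < \<delta> \<and> (\<forall>s\<in>{a..T} \<inter> ball t \<delta>. \<forall>S. finite S \<longrightarrow> S \<subseteq> {N..} \<longrightarrow>
      (\<Sum>k\<in>S. lam k * (c k s)\<^sup>2) \<le> \<epsilon>)" for t \<delta> N
  have "\<exists>\<delta> N. P t \<delta> N" if t: "t \<in> {a..T}" for t
  proof -
    note ft = C_W12_dotD[OF f t]
    have e4: "0 < \<epsilon> / 4" using e by simp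
    from uniform_energy_tailsD[OF uniform_energy_tails_W12[OF ft(2,4,5), of "{t}"] e4] obtain N where
      "\<forall>s\<in>{t}. \<forall>S. finite S \<longrightarrow> S \<subseteq> {N..} \<longrightarrow> (\<Sum>k\<in>S. lam k * (ip_01 (\<lambda>x. f x t) (v k))\<^sup>2) \<le> \<epsilon> / 4" ..
    then have N: "\<And>S. \<lbrakk>finite S; S \<subseteq> {N..}\<rbrakk> \<Longrightarrow> (\<Sum>k\<in>S. lam k * (c k t)\<^sup>2) \<le> \<epsilon> / 4"
      by (simp add: c_def)
    have lim: "((\<lambda>s. (norm_W12 \<beta> (\<lambda>x. f x s - f x t))\<^sup>2) \<longlongrightarrow> 0\<^sup>2) (at t within {a..T})"
      by (intro tendsto_intros ft(6))
    then have "\<forall>\<^sub>F s in at t within {a..T}. (norm_W12 \<beta> (\<lambda>x. f x s - f x t))\<^sup>2 < \<epsilon> / 4"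
      by (rule order_tendstoD(2)) (use e in simp)
    then obtain \<delta> where \<delta>: "0 < \<delta>" "\<And>s. \<lbrakk>s \<in> {a..T}; s \<noteq> t; dist s t < \<delta>\<rbrakk> \<Longrightarrow>
        (norm_W12 \<beta> (\<lambda>x. f x s - f x t))\<^sup>2 < \<epsilon> / 4"
      unfolding eventually_at by blast
    have "(\<Sum>k\<in>S. lam k * (c k s)\<^sup>2) \<le> \<epsilon>"
      if s: "s \<in> {a..T}" "dist s t < \<delta>" and S: "finite S" "S \<subseteq> {N..}" for s S
    proof (cases "s = t")
      case False
      note fs = C_W12_dotD[OF f s(1)]
      have "(\<Sum>k\<in>S. lam k * (c k s - c k t)\<^sup>2) \<le> (norm_W12 \<beta> (\<lambda>x. f x s - f x t))\<^sup>2"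
        unfolding c_def ip_01_diff[OF fs(3) ft(3), symmetric]
        by (intro bessel_energy W12_diff fs ft S(1)) (simp_all add: fs ft)
      then have d: "(\<Sum>k\<in>S. lam k * (c k s - c k t)\<^sup>2) \<le> \<epsilon> / 4"
        using \<delta>(2)[OF s(1) False s(2)] by simp
      have "(\<Sum>k\<in>S. lam k * (c k s)\<^sup>2) \<le> (\<Sum>k\<in>S. 2 * (lam k * (c k s - c k t)\<^sup>2) + 2 * (lam k * (c k t)\<^sup>2))"
      proof (rule sum_mono)
        fix k show "lam k * (c k s)\<^sup>2 \<le> 2 * (lam k * (c k s - c k t)\<^sup>2) + 2 * (lam k * (c k t)\<^sup>2)"
          using lam_square_add_le[of k "c k s - c k t" "c k t"] by simp
      qed
      also have "\<dots> \<le> \<epsilon>"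
        using d N[OF S] by (simp add: sum.distrib sum_distrib_left[symmetric])
      finally show ?thesis .
    qed (use N[OF S] e in simp)
    then have "P t \<delta> N" using \<delta>(1) by (auto simp: P_def dist_commute)
    then show ?thesis by blast
  qed
  then have "\<forall>t\<in>{a..T}. \<exists>\<delta> N. P t \<delta> N" ..
  from bchoice[OF this] obtain \<delta> where "\<forall>t\<in>{a..T}. \<exists>N. P t (\<delta> t) N" ..
  from bchoice[OF this] obtain N where N: "\<forall>t\<in>{a..T}. P t (\<delta> t) (N t)" ..
  have cover: "{a..T} \<subseteq> (\<Union>t\<in>{a..T}. ball t (\<delta> t))"
    using N by (auto simp: P_def)
  obtain D where D: "D \<subseteq> {a..T}" "finite D" "{a..T} \<subseteq> (\<Union>t\<in>D. ball t (\<delta> t))"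
    by (rule compactE_image[OF compact_Icc _ cover]) auto
  show "\<exists>N. \<forall>t\<in>{a..T}. \<forall>S. finite S \<longrightarrow> S \<subseteq> {N..} \<longrightarrow> (\<Sum>k\<in>S. lam k * (ip_01 (\<lambda>x. f x t) (v k))\<^sup>2) \<le> \<epsilon>"
  proof (intro exI[of _ "Max (insert 0 (N ` D))"] ballI allI impI)
    fix s S assume s: "s \<in> {a..T}" and S: "finite S" "S \<subseteq> {Max (insert 0 (N ` D))..}"
    obtain t where t: "t \<in> D" "s \<in> ball t (\<delta> t)" using D s by auto
    have "N t \<le> Max (insert 0 (N ` D))" using t D by (intro Max_ge) auto
    then have "S \<subseteq> {N t..}" using S(2) by auto
    then show "(\<Sum>k\<in>S. lam k * (ip_01 (\<lambda>x. f x s) (v k))\<^sup>2) \<le> \<epsilon>"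
      using N t s S(1) D(1) by (auto simp: P_def c_def)
  qed
qed

lemma C_W12_dot_continuous:
  assumes f: "C_W12_dot \<beta> a T f"
  shows "continuous_on {a..T} (\<lambda>t. ip_01 (\<lambda>x. f x t) (v k))"
  unfolding continuous_on_def
proof
  fix t assume t: "t \<in> {a..T}"
  define c where "c s = ip_01 (\<lambda>x. f x s) (v k)" for s
  note ft = C_W12_dotD[OF f t]
  have bound: "norm (c s - c t) \<le> \<bar>norm_W12 \<beta> (\<lambda>x. f x s - f x t)\<bar> / sqrt (lam k)" if s: "s \<in> {a..T}" for s
  proof -
    note fs = C_W12_dotD[OF f s]
    have "(\<Sum>k\<in>{k}. lam k * (ip_01 (\<lambda>x. f x s - f x t) (v k))\<^sup>2) \<le> (norm_W12 \<beta> (\<lambda>x. f x s - f x t))\<^sup>2"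
      by (intro bessel_energy W12_diff fs ft) (simp_all add: fs ft)
    then have "lam k * (c s - c t)\<^sup>2 \<le> (norm_W12 \<beta> (\<lambda>x. f x s - f x t))\<^sup>2"
      by (simp add: c_def ip_01_diff[OF fs(3) ft(3)])
    then have "sqrt (lam k * (c s - c t)\<^sup>2) \<le> sqrt ((norm_W12 \<beta> (\<lambda>x. f x s - f x t))\<^sup>2)"
      by (rule real_sqrt_le_mono)
    then have "sqrt (lam k) * \<bar>c s - c t\<bar> \<le> \<bar>norm_W12 \<beta> (\<lambda>x. f x s - f x t)\<bar>"
      by (simp add: real_sqrt_mult)
    then show ?thesis using lam_pos[of k] by (simp add: pos_le_divide_eq mult.commute)
  qed
  have "((\<lambda>s. \<bar>norm_W12 \<beta> (\<lambda>x. f x s - f x t)\<bar> / sqrt (lam k)) \<longlongrightarrow> \<bar>0\<bar> / sqrt (lam k)) (at t within {a..T})"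
    using lam_pos[of k] by (intro tendsto_intros ft(6)) auto
  then have lim: "((\<lambda>s. \<bar>norm_W12 \<beta> (\<lambda>x. f x s - f x t)\<bar> / sqrt (lam k)) \<longlongrightarrow> 0) (at t within {a..T})"
    by simp
  have "((\<lambda>s. c s - c t) \<longlongrightarrow> 0) (at t within {a..T})"
    by (rule Lim_null_comparison[OF _ lim]) (use bound in \<open>auto simp: eventually_at_filter\<close>)
  then show "((\<lambda>t. ip_01 (\<lambda>x. f x t) (v k)) \<longlongrightarrow> ip_01 (\<lambda>x. f x t) (v k)) (at t within {a..T})"
    unfolding c_def by (rule LIM_zero_cancel)
qed

text \<open>The series converges to a continuous function with the coefficients of \<open>\<psi>\<close>, and completeness
  makes continuous functions with equal coefficients equal everywhere.\<close>

lemma expansion: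
  assumes \<psi>: "W12_dot \<beta> \<psi>" and x: "x \<in> {0..1}"
  shows "(\<Sum>k. ip_01 \<psi> (v k) * v k x) = \<psi> x"
proof -
  note W = W12_dot_imp_W12[OF \<psi>] and bd = W12_dot_boundary[OF beta \<psi>]
  note u = uniform_energy_tails_W12[OF W bd, of "UNIV :: unit set"]
  show ?thesis
    by (rule eq_of_coefficients[OF eigen_series_slice(1)[OF u UNIV_I] W12_continuous_on[OF W]
          eigen_series_slice(2)[OF u UNIV_I] x])
qed

text \<open>This replaces differentiating the series twice in \<open>x\<close>: both sides have the coefficients
  \<open>c k t\<close>, and the right-hand side is classically differentiable.\<close>

lemma eigen_series_eq_green:
  assumes c: "uniform_energy_tails X c" and lc: "uniform_energy_tails X (\<lambda>k t. lam k * c k t)" and t: "t \<in> X"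
    and x: "x \<in> {0..1}"
  shows "(\<Sum>k. c k t * v k x) = green \<beta> (\<lambda>x. \<Sum>k. lam k * c k t * v k x) x"
proof (rule eq_of_coefficients[OF _ _ _ x])
  note s = eigen_series_slice[OF c t] and ls = eigen_series_slice[OF lc t]
  show "continuous_on {0..1} (\<lambda>x. \<Sum>k. c k t * v k x)" by (rule s)
  let ?h = "\<lambda>x. \<Sum>k. lam k * c k t * v k x"
  show g: "continuous_on {0..1} (green \<beta> ?h)" by (rule green_continuous_on[OF beta ls(1)])
  fix k
  have "lam k * ip_01 (green \<beta> ?h) (v k) = integral {0..1} (\<lambda>z. green \<beta> ?h z * (lam k * v k z))"
    by (simp add: ip_01_continuous[OF g v_continuous] mult.left_commute[of _ "lam k"])
  also have "\<dots> = integral {0..1} (\<lambda>z. ?h z * green \<beta> (\<lambda>x. lam k * v k x) z)"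
    by (rule green_symmetric[OF beta lam_v_continuous ls(1)])
  also have "\<dots> = integral {0..1} (\<lambda>z. ?h z * v k z)"
    by (intro Henstock_Kurzweil_Integration.integral_cong) (simp add: v_eq_green[symmetric])
  also have "\<dots> = lam k * c k t"
    using ls(2)[of k] by (simp add: ip_01_continuous[OF ls(1) v_continuous])
  finally show "ip_01 (\<lambda>x. \<Sum>k. c k t * v k x) (v k) = ip_01 (green \<beta> ?h) (v k)"
    using lam_pos[of k] s(2)[of k] by simp
qed

end

section \<open>Mittag-Leffler functions on the negative half-line\<close>

text \<open>Slopes of the convex function \<open>ln \<circ> Gamma\<close> increase: the slope on \<open>[x, x + \<alpha>]\<close> is at least
  the slope on \<open>[x - 1, x]\<close>, which is \<open>ln (x - 1)\<close>.\<close>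

lemma Gamma_growth:
  fixes x \<alpha> :: real
  assumes x: "1 < x" and \<alpha>: "0 < \<alpha>"
  shows "Gamma x * (x - 1) powr \<alpha> \<le> Gamma (x + \<alpha>)"
proof -
  let ?L = "\<lambda>x. ln (Gamma x) :: real"
  have G: "0 < Gamma x" "0 < Gamma (x - 1)" "0 < Gamma (x + \<alpha>)"
    using x \<alpha> by (auto intro!: Gamma_real_pos)
  have cvx: "convex_on {0<..} ?L"
    using log_convex_Gamma_real by (simp add: o_def)
  define r where "r = 1 / (1 + \<alpha>)"
  have r: "0 < r" "r < 1" "(1 + \<alpha>) * r = 1" using \<alpha> by (auto simp: r_def)
  then have ra: "r * \<alpha> = 1 - r" by (simp add: algebra_simps)
  have "?L ((1 - r) *\<^sub>R (x - 1) + r *\<^sub>R (x + \<alpha>)) \<le> (1 - r) * ?L (x - 1) + r * ?L (x + \<alpha>)"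
    using x \<alpha> r by (intro convex_onD[OF cvx]) auto
  moreover have "(1 - r) *\<^sub>R (x - 1) + r *\<^sub>R (x + \<alpha>) = x"
    using ra by (simp add: algebra_simps)
  ultimately have "?L x \<le> (1 - r) * ?L (x - 1) + r * ?L (x + \<alpha>)" by simp
  then have "(1 + \<alpha>) * ?L x \<le> (1 + \<alpha>) * ((1 - r) * ?L (x - 1) + r * ?L (x + \<alpha>))"
    using \<alpha> by (intro mult_left_mono) auto
  also have "\<dots> = (1 + \<alpha>) * ?L (x - 1) - ((1 + \<alpha>) * r) * ?L (x - 1) + ((1 + \<alpha>) * r) * ?L (x + \<alpha>)"
    by (simp only: algebra_simps)
  also have "\<dots> = \<alpha> * ?L (x - 1) + ?L (x + \<alpha>)"
    unfolding r(3) by (simp add: algebra_simps)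
  finally have "(1 + \<alpha>) * ?L x \<le> \<alpha> * ?L (x - 1) + ?L (x + \<alpha>)" .
  moreover have "?L x = ln (x - 1) + ?L (x - 1)"
  proof -
    have "x - 1 \<notin> \<int>\<^sub>\<le>\<^sub>0" using x by (auto elim!: nonpos_Ints_cases)
    then have "Gamma x = (x - 1) * Gamma (x - 1)" using Gamma_plus1[of "x - 1"] by simp
    moreover have "x - 1 \<noteq> 0" "Gamma (x - 1) \<noteq> 0"
      using x less_imp_neq[OF G(2), symmetric] by auto
    ultimately show ?thesis by (simp add: ln_mult)
  qed
  ultimately have "?L x + \<alpha> * ln (x - 1) \<le> ?L (x + \<alpha>)"
    by (simp add: algebra_simps)
  then have "ln (Gamma x * (x - 1) powr \<alpha>) \<le> ln (Gamma (x + \<alpha>))"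
    using x G less_imp_neq[OF G(1), symmetric] by (simp add: ln_mult ln_powr)
  then show ?thesis using x G by (subst (asm) ln_le_cancel_iff) auto
qed

lemma mittag_leffler_summable:
  fixes \<alpha> \<gamma> z :: real
  assumes \<alpha>: "0 < \<alpha>" and \<gamma>: "0 < \<gamma>"
  shows "summable (\<lambda>k. z ^ k / Gamma (\<alpha> * real k + \<gamma>))"
proof -
  let ?x = "\<lambda>k. \<alpha> * real k + \<gamma>"
  \<comment> \<open>Beyond \<open>R\<close> the Gamma quotient exceeds \<open>R powr \<alpha> \<ge> 2 * \<bar>z\<bar>\<close>, so the ratio test applies with \<open>1/2\<close>.\<close>
  define R where "R = (2 * \<bar>z\<bar> + 1) powr (1 / \<alpha>)"
  obtain N :: nat where N: "(R + 2) / \<alpha> < real N" using reals_Archimedean2 by blast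
  have "norm (z ^ Suc k / Gamma (?x (Suc k))) \<le> 1 / 2 * norm (z ^ k / Gamma (?x k))" if k: "N \<le> k" for k
  proof -
    have "(R + 2) / \<alpha> < real k" using N k by linarith
    then have "R + 2 < \<alpha> * real k" using \<alpha> by (simp add: field_simps)
    then have x: "R + 2 < ?x k" using \<gamma> by simp
    have R: "0 < R" by (simp add: R_def)
    have G: "0 < Gamma (?x k)" using x R by (intro Gamma_real_pos) auto
    have "2 * \<bar>z\<bar> \<le> 2 * \<bar>z\<bar> + 1" by simp
    also have "\<dots> = R powr \<alpha>" using \<alpha> by (simp add: R_def powr_powr)
    also have "\<dots> \<le> (?x k - 1) powr \<alpha>" using x R \<alpha> by (intro powr_mono2) auto
    finally have "Gamma (?x k) * (2 * \<bar>z\<bar>) \<le> Gamma (?x k) * (?x k - 1) powr \<alpha>"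
      using G by (intro mult_left_mono) auto
    also have "\<dots> \<le> Gamma (?x k + \<alpha>)" using x R \<alpha> by (intro Gamma_growth) auto
    also have "?x k + \<alpha> = ?x (Suc k)" by (simp add: algebra_simps)
    finally have le: "Gamma (?x k) * (2 * \<bar>z\<bar>) \<le> Gamma (?x (Suc k))" .
    have G': "0 < Gamma (?x (Suc k))" using \<alpha> \<gamma> by (intro Gamma_real_pos) (simp add: add_nonneg_pos)
    have "\<bar>z\<bar> / Gamma (?x (Suc k)) \<le> 1 / 2 * (1 / Gamma (?x k))"
      using le G G' by (simp add: field_simps)
    then have "\<bar>z\<bar> ^ k * (\<bar>z\<bar> / Gamma (?x (Suc k))) \<le> \<bar>z\<bar> ^ k * (1 / 2 * (1 / Gamma (?x k)))"
      by (intro mult_left_mono) auto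
    then show ?thesis using G G' by (simp add: abs_mult power_abs mult.commute)
  qed
  then show ?thesis by (intro summable_ratio_test[of "1/2" N]) auto
qed

lemma mittag_leffler_isCont:
  assumes "0 < \<alpha>" "0 < \<gamma>"
  shows "isCont (mittag_leffler \<alpha> \<gamma>) z"
proof -
  have "summable (\<lambda>k. 1 / Gamma (\<alpha> * real k + \<gamma>) * (\<bar>z\<bar> + 1) ^ k)"
    using mittag_leffler_summable[OF assms, of "\<bar>z\<bar> + 1"] by simp
  then have "isCont (\<lambda>z. \<Sum>k. 1 / Gamma (\<alpha> * real k + \<gamma>) * z ^ k) z"
    by (rule isCont_powser) simp
  then show ?thesis by (simp add: mittag_leffler_def[abs_def])
qed

lemma mittag_leffler_continuous_on [continuous_intros]:
  assumes "0 < \<alpha>" "0 < \<gamma>" "continuous_on X g"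
  shows "continuous_on X (\<lambda>x. mittag_leffler \<alpha> \<gamma> (g x))"
proof (rule continuous_on_compose2[OF _ assms(3) subset_UNIV])
  show "continuous_on UNIV (mittag_leffler \<alpha> \<gamma>)"
    by (intro continuous_at_imp_continuous_on ballI mittag_leffler_isCont assms)
qed

lemma mittag_leffler_0: "mittag_leffler \<alpha> \<gamma> 0 = 1 / Gamma \<gamma>"
  using powser_zero[of "\<lambda>k. 1 / Gamma (\<alpha> * real k + \<gamma>)"] by (simp add: mittag_leffler_def)

lemma mittag_leffler_shift:
  assumes "0 < \<alpha>" "0 < \<gamma>"
  shows "mittag_leffler \<alpha> \<gamma> z = 1 / Gamma \<gamma> + z * mittag_leffler \<alpha> (\<gamma> + \<alpha>) z"
proof -
  have "mittag_leffler \<alpha> \<gamma> z = 1 / Gamma \<gamma> + (\<Sum>k. z ^ Suc k / Gamma (\<alpha> * real (Suc k) + \<gamma>))"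
    unfolding mittag_leffler_def using suminf_split_head[OF mittag_leffler_summable[OF assms, of z]] by simp
  also have "(\<Sum>k. z ^ Suc k / Gamma (\<alpha> * real (Suc k) + \<gamma>)) =
      (\<Sum>k. z * (z ^ k / Gamma (\<alpha> * real k + (\<gamma> + \<alpha>))))"
    by (intro suminf_cong) (simp add: algebra_simps)
  also have "\<dots> = z * mittag_leffler \<alpha> (\<gamma> + \<alpha>) z"
    unfolding mittag_leffler_def using assms by (intro suminf_mult mittag_leffler_summable) auto
  finally show ?thesis .
qed

lemma beta_scaled:
  fixes a b t :: real
  assumes "0 < a" "0 < b" "0 < t"
  shows "((\<lambda>s. (t - s) powr (b - 1) * s powr (a - 1)) has_integral t powr (a + b - 1) * Beta a b) {0..t}"
proof -
  have cancel: "t powr (a + b - 2) * ((1 / t * s) powr (a - 1) * (1 - 1 / t * s) powr (b - 1)) =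
      (t - s) powr (b - 1) * s powr (a - 1)" if "s \<in> {0..t}" for s
  proof -
    have "1 - 1 / t * s = (t - s) / t" using assms by (simp add: field_simps)
    then have "(1 / t * s) powr (a - 1) * (1 - 1 / t * s) powr (b - 1) =
        s powr (a - 1) * (t - s) powr (b - 1) / (t powr (a - 1) * t powr (b - 1))"
      using that assms by (simp add: powr_divide)
    also have "t powr (a - 1) * t powr (b - 1) = t powr (a + b - 2)"
      by (simp add: powr_add[symmetric])
    finally show ?thesis using assms by simp
  qed
  have "((\<lambda>s. (1 / t * s) powr (a - 1) * (1 - 1 / t * s) powr (b - 1)) has_integral
      (1 / \<bar>1 / t\<bar>) *\<^sub>R Beta a b) ((\<lambda>x. x / (1 / t)) ` {0..1})"
    using assms by (intro has_integral_stretch_real has_integral_Beta_real) auto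
  moreover have "(\<lambda>x. x / (1 / t)) ` {0..1} = {0..t}"
    using assms by (auto simp: image_iff field_simps intro!: bexI[of _ "x / t" for x])
  ultimately have "((\<lambda>s. (1 / t * s) powr (a - 1) * (1 - 1 / t * s) powr (b - 1)) has_integral
      t * Beta a b) {0..t}" using assms by simp
  then have "((\<lambda>s. t powr (a + b - 2) * ((1 / t * s) powr (a - 1) * (1 - 1 / t * s) powr (b - 1))) has_integral
      t powr (a + b - 2) * (t * Beta a b)) {0..t}" by (rule has_integral_mult_right)
  then have "((\<lambda>s. (t - s) powr (b - 1) * s powr (a - 1)) has_integral t powr (a + b - 2) * (t * Beta a b)) {0..t}"
    by (rule has_integral_eq[rotated]) (rule cancel)
  moreover have "t powr (a + b - 2) * (t * Beta a b) = t powr (a + b - 1) * Beta a b"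
    using assms powr_add[of t "a + b - 2" 1] by simp
  ultimately show ?thesis by simp
qed

lemma absolutely_integrable_imp_lborel:
  fixes f :: "real \<Rightarrow> real"
  assumes "f \<in> borel_measurable borel" "S \<in> sets borel" "f absolutely_integrable_on S"
  shows "set_integrable lborel S f"
proof -
  have "(\<lambda>x. indicator S x *\<^sub>R f x) \<in> borel_measurable lborel"
    using assms(1,2) by simp
  then show ?thesis
    using assms(3) integrable_completion[of "\<lambda>x. indicator S x *\<^sub>R f x" lborel]
    unfolding set_integrable_def by blast
qed

lemma beta_scaled_lborel:
  fixes a b t :: real
  assumes "0 < a" "0 < b" "0 < t"
  shows "set_integrable lborel {0..t} (\<lambda>s. (t - s) powr (b - 1) * s powr (a - 1))"
    and "(LINT s:{0..t}|lborel. (t - s) powr (b - 1) * s powr (a - 1)) = t powr (a + b - 1) * Beta a b"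
proof -
  let ?f = "\<lambda>s. (t - s) powr (b - 1) * s powr (a - 1)"
  show i: "set_integrable lborel {0..t} ?f"
    using beta_scaled[OF assms]
    by (intro absolutely_integrable_imp_lborel nonnegative_absolutely_integrable_1) (auto simp: has_integral_iff)
  show "(LINT s:{0..t}|lborel. ?f s) = t powr (a + b - 1) * Beta a b"
    using set_borel_integral_eq_integral(2)[OF i] beta_scaled[OF assms] by (simp add: has_integral_iff)
qed

text \<open>Up to the factor \<open>Gamma \<delta>\<close> this is the fractional integral of order \<open>\<delta>\<close>. It raises the second
  parameter by \<open>\<delta>\<close>, since termwise it is Euler's Beta integral; the series of the integrals of absolute
  values is again a Mittag-Leffler series, so sum and integral may be exchanged.\<close>

lemma mittag_leffler_convolution:
  fixes \<alpha> \<gamma> \<delta> m t :: real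
  assumes \<alpha>: "0 < \<alpha>" and \<gamma>: "0 < \<gamma>" and \<delta>: "0 < \<delta>" and t: "0 < t"
  defines "f \<equiv> \<lambda>s. (t - s) powr (\<delta> - 1) * (s powr (\<gamma> - 1) * mittag_leffler \<alpha> \<gamma> (m * s powr \<alpha>))"
  shows "set_integrable lborel {0..t} f"
    and "(LINT s:{0..t}|lborel. f s) = Gamma \<delta> * (t powr (\<gamma> + \<delta> - 1) * mittag_leffler \<alpha> (\<gamma> + \<delta>) (m * t powr \<alpha>))"
proof -
  define a where "a k = \<alpha> * real k + \<gamma>" for k
  have a: "0 < a k" for k using \<alpha> \<gamma> by (simp add: a_def add_nonneg_pos)
  define g where "g k s = m ^ k / Gamma (a k) * ((t - s) powr (\<delta> - 1) * s powr (a k - 1))" for k s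
  define F where "F k s = indicat_real {0..t} s * g k s" for k s
  have trm: "g k s = (t - s) powr (\<delta> - 1) * (s powr (\<gamma> - 1) * ((m * s powr \<alpha>) ^ k / Gamma (a k)))"
    if "0 < s" for k s
  proof -
    have "s powr (a k - 1) = s powr (\<gamma> - 1) * s powr (\<alpha> * real k)"
      by (simp add: a_def powr_add[symmetric] algebra_simps)
    also have "s powr (\<alpha> * real k) = (s powr \<alpha>) ^ k"
      using that by (simp add: powr_powr[symmetric] powr_realpow)
    finally show ?thesis by (simp add: g_def power_mult_distrib)
  qed
  have g_int: "set_integrable lborel {0..t} (g k)" for k
    unfolding g_def using beta_scaled_lborel(1)[OF a \<delta> t] by (intro set_integrable_mult_right) auto
  then have F_int: "integrable lborel (F k)" for k
    unfolding F_def set_integrable_def by simp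
  have val: "c / Gamma (a k) * (t powr (a k + \<delta> - 1) * Beta (a k) \<delta>) =
      Gamma \<delta> * t powr (\<gamma> + \<delta> - 1) * (c * (t powr \<alpha>) ^ k / Gamma (\<alpha> * real k + (\<gamma> + \<delta>)))" for k c
  proof -
    have "t powr (a k + \<delta> - 1) = t powr (\<gamma> + \<delta> - 1) * t powr (\<alpha> * real k)"
      by (simp add: a_def powr_add[symmetric] algebra_simps)
    also have "t powr (\<alpha> * real k) = (t powr \<alpha>) ^ k"
      using t by (simp add: powr_powr[symmetric] powr_realpow)
    finally have P: "t powr (a k + \<delta> - 1) = t powr (\<gamma> + \<delta> - 1) * (t powr \<alpha>) ^ k" .
    have B: "Beta (a k) \<delta> = Gamma (a k) * Gamma \<delta> / Gamma (\<alpha> * real k + (\<gamma> + \<delta>))"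
      by (simp add: Beta_def a_def add.assoc)
    show ?thesis
      unfolding P B using Gamma_real_pos[OF a[of k]] by simp
  qed
  have F_val: "(\<integral>s. F k s \<partial>lborel) = Gamma \<delta> * t powr (\<gamma> + \<delta> - 1) * ((m * t powr \<alpha>) ^ k / Gamma (\<alpha> * real k + (\<gamma> + \<delta>)))"
    for k
  proof -
    have "(\<integral>s. F k s \<partial>lborel) = (LINT s:{0..t}|lborel. g k s)"
      by (simp add: F_def set_lebesgue_integral_def)
    also have "\<dots> = m ^ k / Gamma (a k) * (t powr (a k + \<delta> - 1) * Beta (a k) \<delta>)"
      unfolding g_def using beta_scaled_lborel(2)[OF a \<delta> t] by simp
    finally show ?thesis unfolding val by (simp add: power_mult_distrib)
  qed
  have N_val: "(\<integral>s. norm (F k s) \<partial>lborel) = Gamma \<delta> * t powr (\<gamma> + \<delta> - 1) * ((\<bar>m\<bar> * t powr \<alpha>) ^ k / Gamma (\<alpha> * real k + (\<gamma> + \<delta>)))"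
    for k
  proof -
    have "(\<integral>s. norm (F k s) \<partial>lborel) = (LINT s:{0..t}|lborel. \<bar>m\<bar> ^ k / Gamma (a k) * ((t - s) powr (\<delta> - 1) * s powr (a k - 1)))"
      unfolding set_lebesgue_integral_def F_def g_def using Gamma_real_pos[OF a[of k]]
      by (intro Bochner_Integration.integral_cong) (auto simp: abs_mult power_abs)
    also have "\<dots> = \<bar>m\<bar> ^ k / Gamma (a k) * (t powr (a k + \<delta> - 1) * Beta (a k) \<delta>)"
      using beta_scaled_lborel(2)[OF a \<delta> t] by simp
    finally show ?thesis unfolding val by (simp add: power_mult_distrib)
  qed
  have N_sum: "summable (\<lambda>k. \<integral>s. norm (F k s) \<partial>lborel)"
    unfolding N_val using \<alpha> \<gamma> \<delta> by (intro summable_mult mittag_leffler_summable) auto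
  have Gabs: "\<bar>Gamma (a k)\<bar> = Gamma (a k)" for k
    by (rule abs_of_pos[OF Gamma_real_pos[OF a]])
  have pt: "(\<lambda>k. norm (F k s)) = (\<lambda>k. indicat_real {0..t} s * ((t - s) powr (\<delta> - 1) * (s powr (\<gamma> - 1) *
      ((\<bar>m\<bar> * s powr \<alpha>) ^ k / Gamma (a k)))))" if "0 < s" for s
    by (simp add: fun_eq_iff F_def trm[OF that] Gabs abs_mult power_abs power_mult_distrib)
  have "summable (\<lambda>k. norm (F k s))" for s
  proof (cases "0 < s")
    case True
    then show ?thesis
      unfolding pt[OF True] a_def using \<alpha> \<gamma> by (intro summable_mult mittag_leffler_summable)
  next
    case False
    then show ?thesis by (cases "s = 0") (auto simp: F_def g_def)
  qed
  then have S: "AE s in lborel. summable (\<lambda>k. norm (F k s))" by simp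
  have sum_eq: "(\<Sum>k. F k s) = indicator {0..t} s * f s" for s
  proof (cases "0 < s")
    case True
    have "(\<Sum>k. F k s) = (\<Sum>k. (indicator {0..t} s * ((t - s) powr (\<delta> - 1) * s powr (\<gamma> - 1))) *
        ((m * s powr \<alpha>) ^ k / Gamma (\<alpha> * real k + \<gamma>)))"
      by (simp add: F_def trm[OF True] a_def mult.assoc)
    also have "\<dots> = (indicator {0..t} s * ((t - s) powr (\<delta> - 1) * s powr (\<gamma> - 1))) * mittag_leffler \<alpha> \<gamma> (m * s powr \<alpha>)"
      unfolding mittag_leffler_def using \<alpha> \<gamma> by (intro suminf_mult mittag_leffler_summable)
    finally show ?thesis by (simp add: f_def mult.assoc)
  next
    case False
    then show ?thesis by (cases "s = 0") (auto simp: F_def g_def f_def)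
  qed
  show "set_integrable lborel {0..t} f"
    using integrable_suminf[OF F_int S N_sum] unfolding sum_eq set_integrable_def by simp
  have "(LINT s:{0..t}|lborel. f s) = (\<Sum>k. \<integral>s. F k s \<partial>lborel)"
    using integral_suminf[OF F_int S N_sum] unfolding sum_eq set_lebesgue_integral_def by simp
  also have "\<dots> = Gamma \<delta> * t powr (\<gamma> + \<delta> - 1) * mittag_leffler \<alpha> (\<gamma> + \<delta>) (m * t powr \<alpha>)"
    unfolding F_val mittag_leffler_def using \<alpha> \<gamma> \<delta> by (intro suminf_mult mittag_leffler_summable) auto
  finally show "(LINT s:{0..t}|lborel. f s) = Gamma \<delta> * (t powr (\<gamma> + \<delta> - 1) * mittag_leffler \<alpha> (\<gamma> + \<delta>) (m * t powr \<alpha>))"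
    by simp
qed

text \<open>The function \<open>y(t) = t\<^sup>\<gamma>\<^sup>-\<^sup>1 E\<^sub>\<alpha>\<^sub>,\<^sub>\<gamma>(- t\<^sup>\<alpha>)\<close> solves \<open>y = t\<^sup>\<gamma>\<^sup>-\<^sup>1 / \<Gamma>(\<gamma>) - J\<^sup>\<alpha> y\<close>. If \<open>y\<close> is
  positive the equation gives the upper bound, so positivity is the point.

  Let \<open>t0\<close> be the first zero of \<open>y\<close> and \<open>m < t0\<close>. Log-convexity of the kernel \<open>K\<close> yields
  \<open>K(t0 - s) \<le> q K(m - s)\<close> with \<open>q = K(t0) / K(m)\<close>, and \<open>t0\<^sup>\<gamma>\<^sup>-\<^sup>1 \<ge> q m\<^sup>\<gamma>\<^sup>-\<^sup>1\<close> because \<open>\<gamma> \<ge> \<alpha>\<close>.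
  Comparing the equation at \<open>t0\<close> with \<open>q\<close> times the equation at \<open>m\<close> leaves
  \<open>q y(m) \<le> \<integral> K(t0 - s) y(s) ds / \<Gamma>(\<alpha>)\<close> over \<open>[m, t0]\<close>. If \<open>m\<close> maximizes \<open>y\<close> on \<open>[t0 - \<delta>, t0]\<close>,
  the right-hand side is at most \<open>y(m) \<delta>\<^sup>\<alpha> / (\<alpha> \<Gamma>(\<alpha>))\<close>, which is impossible for small \<open>\<delta>\<close>.\<close>

lemma mittag_leffler_bounds:
  fixes \<alpha> \<gamma> x :: real
  assumes \<alpha>: "0 < \<alpha>" "\<alpha> \<le> 1" and \<gamma>: "\<alpha> \<le> \<gamma>" and x: "0 \<le> x"
  shows "0 \<le> mittag_leffler \<alpha> \<gamma> (- x)" "mittag_leffler \<alpha> \<gamma> (- x) \<le> 1 / Gamma \<gamma>"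
proof -
  have \<gamma>0: "0 < \<gamma>" using \<alpha> \<gamma> by simp
  define R where "R t = mittag_leffler \<alpha> \<gamma> (- (t powr \<alpha>))" for t
  define y where "y t = t powr (\<gamma> - 1) * R t" for t
  define K where "K t s = (t - s) powr (\<alpha> - 1)" for t s :: real
  have G\<gamma>: "0 < Gamma \<gamma>" and G\<alpha>: "0 < Gamma \<alpha>" using \<gamma>0 \<alpha> by (auto intro: Gamma_real_pos)
  have Ky: "(\<lambda>s. K t s * y s) integrable_on {0..t}"
    "y t = t powr (\<gamma> - 1) / Gamma \<gamma> - integral {0..t} (\<lambda>s. K t s * y s) / Gamma \<alpha>" if t: "0 < t" for t
  proof -
    have eq: "(\<lambda>s. K t s * y s) = (\<lambda>s. (t - s) powr (\<alpha> - 1) * (s powr (\<gamma> - 1) * mittag_leffler \<alpha> \<gamma> ((-1) * s powr \<alpha>)))"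
      by (simp add: K_def y_def R_def)
    note c = mittag_leffler_convolution[OF \<alpha>(1) \<gamma>0 \<alpha>(1) t, of "-1", folded eq]
    show i: "(\<lambda>s. K t s * y s) integrable_on {0..t}"
      using set_borel_integral_eq_integral(1)[OF c(1)] .
    have "integral {0..t} (\<lambda>s. K t s * y s) = Gamma \<alpha> * (t powr (\<gamma> + \<alpha> - 1) * mittag_leffler \<alpha> (\<gamma> + \<alpha>) (- (t powr \<alpha>)))"
      using c(2) set_borel_integral_eq_integral(2)[OF c(1)] by simp
    then have I: "integral {0..t} (\<lambda>s. K t s * y s) / Gamma \<alpha> = t powr (\<gamma> + \<alpha> - 1) * mittag_leffler \<alpha> (\<gamma> + \<alpha>) (- (t powr \<alpha>))"
      using less_imp_neq[OF G\<alpha>, symmetric] by simp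
    have p: "t powr (\<gamma> + \<alpha> - 1) = t powr (\<gamma> - 1) * t powr \<alpha>"
      by (simp add: powr_add[symmetric] algebra_simps)
    show "y t = t powr (\<gamma> - 1) / Gamma \<gamma> - integral {0..t} (\<lambda>s. K t s * y s) / Gamma \<alpha>"
      unfolding I p unfolding y_def R_def mittag_leffler_shift[OF \<alpha>(1) \<gamma>0, of "- (t powr \<alpha>)"]
      by (simp add: algebra_simps)
  qed
  have "continuous_on {0..} (\<lambda>t::real. t powr \<alpha>)"
    using \<alpha> by (intro continuous_on_powr' continuous_intros) auto
  then have R_cont: "continuous_on {0..} R"
    unfolding R_def by (intro mittag_leffler_continuous_on \<alpha> \<gamma>0 continuous_on_minus)
  have "R 0 = 1 / Gamma \<gamma>" using \<alpha> by (simp add: R_def mittag_leffler_0)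
  then have R0: "0 < R 0" using divide_pos_pos[OF zero_less_one G\<gamma>] by metis
  have pos: "0 < R t" if t: "0 \<le> t" for t
  proof (rule ccontr)
    assume "\<not> 0 < R t"
    define Z where "Z = {s \<in> {0..t}. R s \<le> 0}"
    have R_cont': "continuous_on {0..t} R" using R_cont by (rule continuous_on_subset) auto
    have "closed Z"
    proof -
      have "Z = {0..t} \<inter> R -` {..0}" by (auto simp: Z_def)
      then show ?thesis
        using continuous_closed_preimage[OF R_cont' closed_real_atLeastAtMost, of "{..0}"] by simp
    qed
    moreover have "bounded Z" unfolding Z_def by (rule bounded_subset[of "{0..t}"]) auto
    moreover have "t \<in> Z" using t \<open>\<not> 0 < R t\<close> by (auto simp: Z_def)
    ultimately have "\<exists>t0\<in>Z. \<forall>s\<in>Z. t0 \<le> s"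
      by (intro compact_attains_inf) (auto simp: compact_eq_bounded_closed)
    then obtain t0 where t0: "t0 \<in> Z" "\<And>s. s \<in> Z \<Longrightarrow> t0 \<le> s" by blast
    have t0_pos: "0 < t0" using t0(1) R0 by (auto simp: Z_def less_eq_real_def)
    have before: "0 < R s" if "0 \<le> s" "s < t0" for s
      using t0 that unfolding Z_def by force
    have y_pos: "0 < y s" if "0 < s" "s < t0" for s
      using before[of s] that by (simp add: y_def)
    have y_t0: "y t0 \<le> 0" using t0(1) by (simp add: Z_def y_def mult_nonneg_nonpos)
    \<comment> \<open>A lower bound of \<open>q\<close>, valid because \<open>t0 / m \<le> 2\<close>; \<open>\<delta>\<close> is then chosen to violate the final estimate.\<close>
    define \<rho> where "\<rho> = (2::real) powr (\<alpha> - 1)"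
    have \<rho>: "0 < \<rho>" by (simp add: \<rho>_def)
    define \<delta> where "\<delta> = min (t0 / 2) ((Gamma \<alpha> * \<rho> * \<alpha> / 2) powr (1 / \<alpha>))"
    have c: "0 < Gamma \<alpha> * \<rho> * \<alpha> / 2"
      by (intro divide_pos_pos mult_pos_pos G\<alpha> \<rho> \<alpha>) simp
    have \<delta>: "0 < \<delta>" "\<delta> \<le> t0 / 2"
      using t0_pos less_imp_neq[OF c, symmetric] by (auto simp: \<delta>_def)
    have \<delta>2: "\<delta> powr \<alpha> < Gamma \<alpha> * \<rho> * \<alpha>"
    proof -
      have "\<delta> powr \<alpha> \<le> ((Gamma \<alpha> * \<rho> * \<alpha> / 2) powr (1 / \<alpha>)) powr \<alpha>"
        using \<delta>(1) \<alpha> by (intro powr_mono2) (auto simp: \<delta>_def)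
      also have "\<dots> = Gamma \<alpha> * \<rho> * \<alpha> / 2" using c \<alpha> by (simp add: powr_powr)
      also have "\<dots> < Gamma \<alpha> * \<rho> * \<alpha>" using c by linarith
      finally show ?thesis .
    qed
    have y_cont: "continuous_on {t0 - \<delta>..t0} y"
      unfolding y_def using \<delta> t0_pos by (intro continuous_intros continuous_on_subset[OF R_cont]) auto
    obtain m where m: "m \<in> {t0 - \<delta>..t0}" "\<And>s. s \<in> {t0 - \<delta>..t0} \<Longrightarrow> y s \<le> y m"
      using continuous_attains_sup[OF _ _ y_cont] \<delta> by auto
    have "0 < y (t0 - \<delta>)" using y_pos \<delta> t0_pos by auto
    also have "\<dots> \<le> y m" using m(2)[of "t0 - \<delta>"] \<delta> by auto
    finally have ym: "0 < y m" .
    then have m_less: "m < t0" using m(1) y_t0 by (cases "m = t0") auto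
    have m0: "0 < m" using m(1) \<delta> t0_pos by auto
    define q where "q = t0 powr (\<alpha> - 1) / m powr (\<alpha> - 1)"
    have q: "q = (t0 / m) powr (\<alpha> - 1)" using m0 t0_pos by (simp add: q_def powr_divide)
    have "\<rho> \<le> q"
      unfolding \<rho>_def q using m(1) m0 \<delta> m_less \<alpha> t0_pos by (intro powr_mono2') (auto simp: field_simps)
    have q0: "0 \<le> q" using \<open>\<rho> \<le> q\<close> \<rho> by simp
    have kernel: "K t0 s \<le> q * K m s" if "0 \<le> s" "s < m" for s
    proof -
      have "((t0 - s) / (m - s)) powr (\<alpha> - 1) \<le> (t0 / m) powr (\<alpha> - 1)"
      proof (rule powr_mono2')
        have "s * m \<le> s * t0" using that m_less by (intro mult_left_mono) auto
        then show "t0 / m \<le> (t0 - s) / (m - s)"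
          using that m0 by (simp add: field_simps)
      qed (use m0 t0_pos \<alpha> in auto)
      then show ?thesis unfolding q K_def using that m_less
        by (simp add: powr_divide divide_le_eq)
    qed
    have q_ge: "q * m powr (\<gamma> - 1) \<le> t0 powr (\<gamma> - 1)"
    proof -
      have "q \<le> (t0 / m) powr (\<gamma> - 1)"
        unfolding q using m0 m_less \<gamma> by (intro powr_mono) auto
      then show ?thesis using m0 t0_pos by (simp add: powr_divide le_divide_eq)
    qed
    note It0 = Ky[OF t0_pos] and Im = Ky[OF m0]
    have sub1: "(\<lambda>s. K t0 s * y s) integrable_on {0..m}" "(\<lambda>s. K t0 s * y s) integrable_on {m..t0}"
      using It0(1) m0 m_less by (auto intro: integrable_on_subinterval)
    have split: "integral {0..t0} (\<lambda>s. K t0 s * y s) =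
        integral {0..m} (\<lambda>s. K t0 s * y s) + integral {m..t0} (\<lambda>s. K t0 s * y s)"
      using Henstock_Kurzweil_Integration.integral_combine[OF _ _ It0(1), of m] m0 m_less by simp
    have first: "integral {0..m} (\<lambda>s. K t0 s * y s) \<le> q * integral {0..m} (\<lambda>s. K m s * y s)"
    proof -
      define g where "g s = (if s \<in> {0, m} then 0 else K t0 s * y s)" for s
      have neg: "negligible {0, m}" by simp
      have g: "g integrable_on {0..m}"
        by (rule integrable_spike[OF sub1(1) neg]) (auto simp: g_def)
      have "integral {0..m} (\<lambda>s. K t0 s * y s) = integral {0..m} g"
        by (rule integral_spike[OF neg]) (auto simp: g_def)
      also have "\<dots> \<le> integral {0..m} (\<lambda>s. q * (K m s * y s))"
      proof (rule integral_le[OF g])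
        show "(\<lambda>s. q * (K m s * y s)) integrable_on {0..m}"
          using Im(1) by (rule integrable_on_mult_right)
        fix s assume s: "s \<in> {0..m}"
        show "g s \<le> q * (K m s * y s)"
        proof (cases "s = 0 \<or> s = m")
          case False
          then show ?thesis
            using kernel[of s] y_pos[of s] s m_less by (simp add: g_def mult.assoc[symmetric])
        next
          case True
          have "0 \<le> K m s * y s"
            using True ym by (auto simp: K_def y_def)
          then show ?thesis using True q0 by (auto simp: g_def)
        qed
      qed
      finally show ?thesis by simp
    qed
    have second: "integral {m..t0} (\<lambda>s. K t0 s * y s) \<le> y m * (\<delta> powr \<alpha> / \<alpha>)"
    proof -
      have "((\<lambda>s. (t0 - s) powr (\<alpha> - 1)) has_integral (t0 - m) powr \<alpha> / \<alpha>) {m..t0}"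
      proof -
        have "((\<lambda>s. s powr (\<alpha> - 1)) has_integral (t0 - m) powr \<alpha> / \<alpha>) {0..t0 - m}"
          using has_integral_powr_from_0[of "\<alpha> - 1" "t0 - m"] \<alpha> m_less by simp
        then have "((\<lambda>s. ((-1) * s + t0) powr (\<alpha> - 1)) has_integral (1 / \<bar>-1\<bar>) *\<^sub>R ((t0 - m) powr \<alpha> / \<alpha>))
            ((\<lambda>x. (1 / (-1)) *\<^sub>R x + - ((1 / (-1)) *\<^sub>R t0)) ` {0..t0 - m})"
          using has_integral_affinity[of "\<lambda>s. s powr (\<alpha> - 1)" _ 0 "t0 - m" "-1" t0] by simp
        moreover have "(\<lambda>x. (1 / (-1)) *\<^sub>R x + - ((1 / (-1)) *\<^sub>R t0)) ` {0..t0 - m} = {m..t0}"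
          by (auto simp: image_iff intro!: bexI[of _ "t0 - s" for s])
        ultimately show ?thesis by simp
      qed
      then have h: "((\<lambda>s. y m * K t0 s) has_integral y m * ((t0 - m) powr \<alpha> / \<alpha>)) {m..t0}"
        unfolding K_def by (rule has_integral_mult_right)
      have "integral {m..t0} (\<lambda>s. K t0 s * y s) \<le> integral {m..t0} (\<lambda>s. y m * K t0 s)"
      proof (rule integral_le[OF sub1(2)])
        show "(\<lambda>s. y m * K t0 s) integrable_on {m..t0}" using h by (auto simp: has_integral_iff)
        show "K t0 s * y s \<le> y m * K t0 s" if "s \<in> {m..t0}" for s
          using mult_right_mono[OF m(2)[of s], of "K t0 s"] m(1) that by (simp add: K_def mult.commute)
      qed
      also have "\<dots> = y m * ((t0 - m) powr \<alpha> / \<alpha>)" using h by (simp add: has_integral_iff)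
      also have "\<dots> \<le> y m * (\<delta> powr \<alpha> / \<alpha>)"
        using ym m m_less \<alpha> by (intro mult_left_mono divide_right_mono powr_mono2) auto
      finally show ?thesis .
    qed
    have qy: "q * y m = q * m powr (\<gamma> - 1) / Gamma \<gamma> - q * integral {0..m} (\<lambda>s. K m s * y s) / Gamma \<alpha>"
      unfolding Im(2) by (simp add: right_diff_distrib)
    have "0 \<ge> y t0" by (rule y_t0)
    also have "y t0 = t0 powr (\<gamma> - 1) / Gamma \<gamma> - (integral {0..m} (\<lambda>s. K t0 s * y s) + integral {m..t0} (\<lambda>s. K t0 s * y s)) / Gamma \<alpha>"
      using It0(2) split by simp
    also have "\<dots> \<ge> q * m powr (\<gamma> - 1) / Gamma \<gamma> - (q * integral {0..m} (\<lambda>s. K m s * y s) + y m * (\<delta> powr \<alpha> / \<alpha>)) / Gamma \<alpha>"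
      using G\<gamma> G\<alpha> q_ge first second by (intro diff_mono divide_right_mono add_mono) auto
    also have "q * m powr (\<gamma> - 1) / Gamma \<gamma> - (q * integral {0..m} (\<lambda>s. K m s * y s) + y m * (\<delta> powr \<alpha> / \<alpha>)) / Gamma \<alpha> =
        q * y m - y m * (\<delta> powr \<alpha> / \<alpha>) / Gamma \<alpha>"
      unfolding qy by (simp add: add_divide_distrib)
    finally have "y m * q \<le> y m * (\<delta> powr \<alpha> / \<alpha> / Gamma \<alpha>)" by (simp add: mult.commute)
    then have "q \<le> \<delta> powr \<alpha> / \<alpha> / Gamma \<alpha>" using ym by (rule mult_left_le_imp_le)
    then have "\<rho> \<le> \<delta> powr \<alpha> / \<alpha> / Gamma \<alpha>" using \<open>\<rho> \<le> q\<close> by simp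
    then show False using \<delta>2 G\<alpha> \<alpha> by (simp add: field_simps)
  qed
  define t where "t = x powr (1 / \<alpha>)"
  have xt: "mittag_leffler \<alpha> \<gamma> (- x) = R t"
    using x \<alpha> by (simp add: R_def t_def powr_powr)
  have t0: "0 \<le> t" by (simp add: t_def)
  show "0 \<le> mittag_leffler \<alpha> \<gamma> (- x)" unfolding xt using pos[OF t0] by simp
  show "mittag_leffler \<alpha> \<gamma> (- x) \<le> 1 / Gamma \<gamma>"
  proof (cases "t = 0")
    case True
    then have "R t = 1 / Gamma \<gamma>" using \<alpha> by (simp add: R_def mittag_leffler_0)
    then show ?thesis unfolding xt by simp
  next
    case False
    then have t: "0 < t" using t0 by simp
    have "0 \<le> integral {0..t} (\<lambda>s. K t s * y s)"
      using pos by (intro integral_nonneg Ky(1)[OF t]) (auto simp: K_def y_def less_imp_le)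
    then have "y t \<le> t powr (\<gamma> - 1) / Gamma \<gamma>"
      unfolding Ky(2)[OF t] using G\<alpha> by simp
    then have "t powr (\<gamma> - 1) * R t \<le> t powr (\<gamma> - 1) * (1 / Gamma \<gamma>)" by (simp add: y_def)
    then show ?thesis unfolding xt
      by (rule mult_left_le_imp_le) (use t in simp)
  qed
qed


section \<open>Volterra convolutions\<close>

definition convolution :: "(real \<Rightarrow> real) \<Rightarrow> (real \<Rightarrow> real) \<Rightarrow> real \<Rightarrow> real" where
  "convolution \<kappa> h x = (\<integral>s. \<kappa> (x - s) * h s \<partial>lborel)"

lemma integrable_reflect_shift:
  fixes \<kappa> :: "real \<Rightarrow> real"
  assumes "integrable lborel \<kappa>"
  shows "integrable lborel (\<lambda>s. \<kappa> (x - s))"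
  using lborel_integrable_real_affine[OF assms, of "-1" x] by simp

lemma integral_reflect_shift:
  fixes \<kappa> :: "real \<Rightarrow> real"
  shows "(\<integral>s. \<kappa> (x - s) \<partial>lborel) = (\<integral>s. \<kappa> s \<partial>lborel)"
  using lborel_integral_real_affine[of "-1" \<kappa> x] by simp

lemma integral_shift:
  fixes \<kappa> :: "real \<Rightarrow> real"
  shows "(\<integral>s. \<kappa> (s - x) \<partial>lborel) = (\<integral>s. \<kappa> s \<partial>lborel)"
  using lborel_integral_real_affine[of 1 \<kappa> "-x"] by simp

lemma convolution_integrable:
  fixes \<kappa> h :: "real \<Rightarrow> real"
  assumes \<kappa>: "integrable lborel \<kappa>" and h: "h \<in> borel_measurable borel" and M: "\<And>s. \<bar>h s\<bar> \<le> M"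
  shows "integrable lborel (\<lambda>s. \<kappa> (x - s) * h s)"
proof (rule Bochner_Integration.integrable_bound)
  show "integrable lborel (\<lambda>s. M * \<kappa> (x - s))"
    using integrable_reflect_shift[OF \<kappa>] by simp
  show "(\<lambda>s. \<kappa> (x - s) * h s) \<in> borel_measurable lborel"
    using h borel_measurable_integrable[OF integrable_reflect_shift[OF \<kappa>]] by simp
  have "\<bar>\<kappa> (x - s)\<bar> * \<bar>h s\<bar> \<le> \<bar>\<kappa> (x - s)\<bar> * \<bar>M\<bar>" for s
    using M[of s] by (intro mult_left_mono) auto
  then show "AE s in lborel. norm (\<kappa> (x - s) * h s) \<le> norm (M * \<kappa> (x - s))"
    by (simp add: abs_mult mult.commute)
qed

text \<open>Fubini's theorem. The equation holds at every point because \<open>h\<close> is bounded, so that the double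
  integral converges absolutely for each \<open>x\<close>.\<close>

lemma convolution_assoc:
  fixes \<kappa>1 \<kappa>2 h :: "real \<Rightarrow> real"
  assumes \<kappa>1: "integrable lborel \<kappa>1" and \<kappa>2: "integrable lborel \<kappa>2"
    and h: "h \<in> borel_measurable borel" and M: "\<And>s. \<bar>h s\<bar> \<le> M"
  shows "convolution \<kappa>1 (convolution \<kappa>2 h) x = convolution (convolution \<kappa>1 \<kappa>2) h x"
proof -
  note m1 [measurable] = borel_measurable_integrable[OF \<kappa>1]
  note m2 [measurable] = borel_measurable_integrable[OF \<kappa>2]
  note h [measurable]
  define F where "F s \<sigma> = \<kappa>1 (x - s) * (\<kappa>2 (s - \<sigma>) * h \<sigma>)" for s \<sigma>
  have F_meas: "case_prod F \<in> borel_measurable (lborel \<Otimes>\<^sub>M lborel)"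
    unfolding F_def by measurable
  have inner: "integrable lborel (\<lambda>\<sigma>. F s \<sigma>)" for s
    unfolding F_def using convolution_integrable[OF \<kappa>2 h M] by simp
  have bound: "(\<integral>\<sigma>. norm (F s \<sigma>) \<partial>lborel) \<le> norm (\<bar>\<kappa>1 (x - s)\<bar> * (M * (\<integral>r. \<bar>\<kappa>2 r\<bar> \<partial>lborel)))" for s
  proof -
    have M0: "0 \<le> M" using M[of 0] by simp
    have "(\<integral>\<sigma>. norm (F s \<sigma>) \<partial>lborel) \<le> (\<integral>\<sigma>. \<bar>\<kappa>1 (x - s)\<bar> * (M * \<bar>\<kappa>2 (s - \<sigma>)\<bar>) \<partial>lborel)"
    proof (rule integral_mono)
      show "integrable lborel (\<lambda>\<sigma>. norm (F s \<sigma>))" using inner[of s] by (rule integrable_norm)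
      show "integrable lborel (\<lambda>\<sigma>. \<bar>\<kappa>1 (x - s)\<bar> * (M * \<bar>\<kappa>2 (s - \<sigma>)\<bar>))"
        using integrable_reflect_shift[OF \<kappa>2, of s] by simp
      fix \<sigma>
      have "\<bar>\<kappa>2 (s - \<sigma>)\<bar> * \<bar>h \<sigma>\<bar> \<le> \<bar>\<kappa>2 (s - \<sigma>)\<bar> * M" using M[of \<sigma>] by (intro mult_left_mono) auto
      then show "norm (F s \<sigma>) \<le> \<bar>\<kappa>1 (x - s)\<bar> * (M * \<bar>\<kappa>2 (s - \<sigma>)\<bar>)"
        by (simp add: F_def abs_mult mult.commute[of M] mult_left_mono)
    qed
    also have "\<dots> = \<bar>\<kappa>1 (x - s)\<bar> * (M * (\<integral>r. \<bar>\<kappa>2 r\<bar> \<partial>lborel))"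
      using integral_reflect_shift[of "\<lambda>r. \<bar>\<kappa>2 r\<bar>" s] by simp
    finally show ?thesis by simp
  qed
  have F_int: "integrable (lborel \<Otimes>\<^sub>M lborel) (case_prod F)"
  proof (rule lborel_pair.Fubini_integrable[OF F_meas])
    show "integrable lborel (\<lambda>s. \<integral>\<sigma>. norm (case_prod F (s, \<sigma>)) \<partial>lborel)"
    proof (rule Bochner_Integration.integrable_bound)
      show "integrable lborel (\<lambda>s. \<bar>\<kappa>1 (x - s)\<bar> * (M * (\<integral>r. \<bar>\<kappa>2 r\<bar> \<partial>lborel)))"
        using integrable_reflect_shift[OF \<kappa>1, of x] by simp
      show "(\<lambda>s. \<integral>\<sigma>. norm (case_prod F (s, \<sigma>)) \<partial>lborel) \<in> borel_measurable lborel"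
        using F_meas by measurable
      show "AE s in lborel. norm (\<integral>\<sigma>. norm (case_prod F (s, \<sigma>)) \<partial>lborel) \<le>
          norm (\<bar>\<kappa>1 (x - s)\<bar> * (M * (\<integral>r. \<bar>\<kappa>2 r\<bar> \<partial>lborel)))"
        using bound by simp
    qed
    show "AE s in lborel. integrable lborel (\<lambda>\<sigma>. case_prod F (s, \<sigma>))"
      using inner by simp
  qed
  have "convolution \<kappa>1 (convolution \<kappa>2 h) x = (\<integral>s. \<integral>\<sigma>. F s \<sigma> \<partial>lborel \<partial>lborel)"
    by (simp add: convolution_def F_def)
  also have "\<dots> = (\<integral>\<sigma>. \<integral>s. F s \<sigma> \<partial>lborel \<partial>lborel)"
    by (rule lborel_pair.Fubini_integral[OF F_int, symmetric])
  also have "\<dots> = (\<integral>\<sigma>. convolution \<kappa>1 \<kappa>2 (x - \<sigma>) * h \<sigma> \<partial>lborel)"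
  proof (intro Bochner_Integration.integral_cong refl)
    fix \<sigma>
    have "(\<integral>s. F s \<sigma> \<partial>lborel) = (\<integral>s. \<kappa>1 (x - \<sigma> - (s - \<sigma>)) * \<kappa>2 (s - \<sigma>) * h \<sigma> \<partial>lborel)"
      by (simp add: F_def mult.assoc)
    also have "\<dots> = (\<integral>s. \<kappa>1 (x - \<sigma> - (s - \<sigma>)) * \<kappa>2 (s - \<sigma>) \<partial>lborel) * h \<sigma>"
      by simp
    also have "(\<integral>s. \<kappa>1 (x - \<sigma> - (s - \<sigma>)) * \<kappa>2 (s - \<sigma>) \<partial>lborel) = convolution \<kappa>1 \<kappa>2 (x - \<sigma>)"
      unfolding convolution_def by (rule integral_shift[of "\<lambda>r. \<kappa>1 (x - \<sigma> - r) * \<kappa>2 r"])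
    finally show "(\<integral>s. F s \<sigma> \<partial>lborel) = convolution \<kappa>1 \<kappa>2 (x - \<sigma>) * h \<sigma>" .
  qed
  finally show ?thesis by (simp add: convolution_def)
qed

definition volterra :: "(real \<Rightarrow> real) \<Rightarrow> real \<Rightarrow> (real \<Rightarrow> real) \<Rightarrow> real \<Rightarrow> real" where
  "volterra \<kappa> A h x = (LINT s:{A..x}|lborel. \<kappa> (x - s) * h s)"

text \<open>The kernel of the fractional integral of order \<open>\<delta>\<close>, up to the factor \<open>1 / Gamma \<delta>\<close>.\<close>

abbreviation abel :: "real \<Rightarrow> real \<Rightarrow> real" where
  "abel \<delta> \<equiv> \<lambda>s. s powr (\<delta> - 1)"

definition kernel :: "real \<Rightarrow> (real \<Rightarrow> real) \<Rightarrow> bool" where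
  "kernel L \<kappa> \<longleftrightarrow> set_integrable lborel {0..L} \<kappa>"

text \<open>Truncating the kernel to \<open>[0, B - A]\<close> and the function to \<open>[A, B]\<close> turns a Volterra convolution
  on \<open>[A, B]\<close> into a convolution of integrable functions on the real line.\<close>

definition cut :: "real \<Rightarrow> real \<Rightarrow> (real \<Rightarrow> real) \<Rightarrow> real \<Rightarrow> real" where
  "cut A B h x = indicator {A..B} x * h x"

lemma kernel_cut: "kernel L \<kappa> \<longleftrightarrow> integrable lborel (cut 0 L \<kappa>)"
  by (simp add: kernel_def set_integrable_def cut_def[abs_def])

lemma kernel_diff: "kernel L \<kappa> \<Longrightarrow> kernel L \<kappa>' \<Longrightarrow> kernel L (\<lambda>s. \<kappa> s - \<kappa>' s)"
  unfolding kernel_def by (rule set_integral_diff(1))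

lemma kernel_mult: "kernel L \<kappa> \<Longrightarrow> kernel L (\<lambda>s. c * \<kappa> s)"
  unfolding kernel_def by simp

lemma kernel_mono:
  assumes "kernel L \<kappa>'" "\<kappa> \<in> borel_measurable borel" "\<And>s. s \<in> {0..L} \<Longrightarrow> \<bar>\<kappa> s\<bar> \<le> \<kappa>' s"
  shows "kernel L \<kappa>"
proof -
  have "set_borel_measurable lborel {0..L} \<kappa>"
    using assms(2) unfolding set_borel_measurable_def by simp
  moreover have "AE s in lborel. s \<in> {0..L} \<longrightarrow> norm (\<kappa> s) \<le> norm (\<kappa>' s)"
  proof (intro AE_I2 impI)
    fix s assume "s \<in> {0..L}"
    then show "norm (\<kappa> s) \<le> norm (\<kappa>' s)" using assms(3)[of s] by simp
  qed
  ultimately show ?thesis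
    using set_integrable_bound[of lborel "{0..L}" \<kappa>' \<kappa>] assms(1) unfolding kernel_def by blast
qed

lemma kernel_powr:
  assumes "0 < \<delta>"
  shows "kernel L (abel \<delta>)"
proof (cases "0 \<le> L")
  case True
  have "((abel \<delta>) has_integral L powr (\<delta> - 1 + 1) / (\<delta> - 1 + 1)) {0..L}"
    using has_integral_powr_from_0[of "\<delta> - 1" L] assms True by simp
  then have "(abel \<delta>) absolutely_integrable_on {0..L}"
    by (intro nonnegative_absolutely_integrable_1) (auto simp: has_integral_iff)
  then have "integrable lebesgue (\<lambda>s. indicator {0..L} s *\<^sub>R s powr (\<delta> - 1))"
    by (simp add: set_integrable_def)
  then show ?thesis
    unfolding kernel_def set_integrable_def by (subst (asm) integrable_completion) auto
qed (simp add: kernel_def)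

context
  fixes A B :: real
begin

lemma cut_measurable:
  assumes "continuous_on {A..B} h"
  shows "cut A B h \<in> borel_measurable borel"
proof -
  have "(\<lambda>x. indicator {A..B} x *\<^sub>R h x) \<in> borel_measurable borel"
    by (intro borel_measurable_continuous_on_indicator assms) auto
  then show ?thesis by (simp add: cut_def[abs_def])
qed

lemma cut_bounded:
  assumes "continuous_on {A..B} h"
  obtains M where "\<And>s. \<bar>cut A B h s\<bar> \<le> M" "\<And>s. s \<in> {A..B} \<Longrightarrow> \<bar>h s\<bar> \<le> M" "0 \<le> M"
proof -
  have "bounded (h ` {A..B})"
    using assms by (intro compact_imp_bounded compact_continuous_image) auto
  then obtain M where M: "0 < M" "\<And>s. s \<in> {A..B} \<Longrightarrow> \<bar>h s\<bar> \<le> M"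
    unfolding bounded_pos real_norm_def by (meson imageI)
  have "\<bar>cut A B h s\<bar> \<le> M" for s
    using M by (cases "s \<in> {A..B}") (auto simp: cut_def)
  with M that show ?thesis by (meson less_imp_le)
qed

lemma volterra_integrand_cut:
  assumes "x \<in> {A..B}"
  shows "indicator {A..x} s *\<^sub>R (\<kappa> (x - s) * h s) = cut 0 (B - A) \<kappa> (x - s) * cut A B h s"
  using assms by (auto simp: cut_def indicator_def)

lemma volterra_cut:
  "x \<in> {A..B} \<Longrightarrow> volterra \<kappa> A h x = convolution (cut 0 (B - A) \<kappa>) (cut A B h) x"
  unfolding volterra_def convolution_def set_lebesgue_integral_def
  by (simp only: volterra_integrand_cut)

lemma volterra_integrable:
  assumes \<kappa>: "kernel (B - A) \<kappa>" and h: "continuous_on {A..B} h" and x: "x \<in> {A..B}"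
  shows "set_integrable lborel {A..x} (\<lambda>s. \<kappa> (x - s) * h s)"
proof -
  obtain M where "\<And>s. \<bar>cut A B h s\<bar> \<le> M" using cut_bounded[OF h] by metis
  then show ?thesis
    unfolding set_integrable_def volterra_integrand_cut[OF x]
    using \<kappa> by (intro convolution_integrable[where M = M] cut_measurable h) (simp_all add: kernel_cut)
qed

lemma volterra_abs_le:
  assumes \<kappa>: "kernel (B - A) \<kappa>" and h: "continuous_on {A..B} h" and x: "x \<in> {A..B}"
    and M: "\<And>s. s \<in> {A..B} \<Longrightarrow> \<bar>h s\<bar> \<le> M"
  shows "\<bar>volterra \<kappa> A h x\<bar> \<le> M * (LINT s:{0..B - A}|lborel. \<bar>\<kappa> s\<bar>)"
proof -
  have M0: "0 \<le> M" using M[OF x] by simp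
  let ?k = "cut 0 (B - A) \<kappa>" and ?h = "cut A B h"
  have k: "integrable lborel ?k" using \<kappa> by (simp add: kernel_cut)
  have M': "\<bar>?h s\<bar> \<le> M" for s
    using M M0 by (cases "s \<in> {A..B}") (auto simp: cut_def)
  have "\<bar>convolution ?k ?h x\<bar> \<le> (\<integral>s. \<bar>?k (x - s) * ?h s\<bar> \<partial>lborel)"
    unfolding convolution_def by (rule integral_abs_bound)
  also have "\<dots> \<le> (\<integral>s. M * \<bar>?k (x - s)\<bar> \<partial>lborel)"
  proof (rule integral_mono)
    show "integrable lborel (\<lambda>s. \<bar>?k (x - s) * ?h s\<bar>)"
      by (intro integrable_abs convolution_integrable[OF k cut_measurable[OF h] M'])
    show "integrable lborel (\<lambda>s. M * \<bar>?k (x - s)\<bar>)"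
      using integrable_reflect_shift[OF k, of x] by simp
    show "\<bar>?k (x - s) * ?h s\<bar> \<le> M * \<bar>?k (x - s)\<bar>" for s
      using M'[of s] by (simp add: abs_mult mult.commute[of M] mult_left_mono)
  qed
  also have "\<dots> = M * (\<integral>s. \<bar>?k s\<bar> \<partial>lborel)"
    using integral_reflect_shift[of "\<lambda>r. \<bar>?k r\<bar>" x] by simp
  also have "(\<integral>s. \<bar>?k s\<bar> \<partial>lborel) = (LINT s:{0..B - A}|lborel. \<bar>\<kappa> s\<bar>)"
    by (simp add: set_lebesgue_integral_def cut_def abs_mult)
  finally show ?thesis using volterra_cut[OF x] by simp
qed

text \<open>Written as an integral of \<open>\<kappa>(r) h(x - r)\<close>, the integrand depends continuously on \<open>x\<close> for every
  \<open>r\<close> other than \<open>x - A\<close>, where the truncated function may jump; dominated convergence applies.\<close>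

lemma volterra_continuous_on:
  assumes \<kappa>: "kernel (B - A) \<kappa>" and h: "continuous_on {A..B} h"
  shows "continuous_on {A..B} (volterra \<kappa> A h)"
  unfolding continuous_on_sequentially
proof (intro allI ballI impI, elim conjE)
  fix X x assume x: "x \<in> {A..B}" and X: "\<forall>n. X n \<in> {A..B}" and lim: "X \<longlonglongrightarrow> x"
  let ?k = "cut 0 (B - A) \<kappa>" and ?h = "cut A B h"
  have k: "integrable lborel ?k" using \<kappa> by (simp add: kernel_cut)
  obtain M where M: "\<And>s. \<bar>?h s\<bar> \<le> M" using cut_bounded[OF h] by metis
  have swap: "convolution ?k ?h y = (\<integral>r. ?k r * ?h (y - r) \<partial>lborel)" for y
    unfolding convolution_def using integral_reflect_shift[of "\<lambda>r. ?k r * ?h (y - r)" y] by simp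
  have "(\<lambda>n. \<integral>r. ?k r * ?h (X n - r) \<partial>lborel) \<longlonglongrightarrow> (\<integral>r. ?k r * ?h (x - r) \<partial>lborel)"
  proof (rule integral_dominated_convergence[where w = "\<lambda>r. M * \<bar>?k r\<bar>"])
    note [measurable] = borel_measurable_integrable[OF k] cut_measurable[OF h]
    show "(\<lambda>r. ?k r * ?h (x - r)) \<in> borel_measurable lborel" by measurable
    show "(\<lambda>r. ?k r * ?h (X n - r)) \<in> borel_measurable lborel" for n by measurable
    show "integrable lborel (\<lambda>r. M * \<bar>?k r\<bar>)" using k by simp
    show "AE r in lborel. norm (?k r * ?h (X n - r)) \<le> M * \<bar>?k r\<bar>" for n
      using M by (simp add: abs_mult mult.commute[of M] mult_left_mono)
    have "(\<lambda>n. ?k r * ?h (X n - r)) \<longlonglongrightarrow> ?k r * ?h (x - r)" if r: "r \<noteq> x - A" for r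
    proof (cases "r \<in> {0..B - A}")
      case True
      show ?thesis
      proof (cases "r < x - A")
        case True
        have "\<forall>\<^sub>F n in sequentially. A + r < X n"
          using order_tendstoD(1)[OF lim, of "A + r"] True by simp
        then have ev: "\<forall>\<^sub>F n in sequentially. ?h (X n - r) = h (X n - r)"
          by eventually_elim (use X \<open>r \<in> {0..B - A}\<close> in \<open>auto simp: cut_def indicator_def; smt (verit) atLeastAtMost_iff\<close>)
        have "x - r \<in> {A..B}" using True x \<open>r \<in> {0..B - A}\<close> by auto
        moreover have "\<forall>\<^sub>F n in sequentially. X n - r \<in> {A..B}"
          using \<open>\<forall>\<^sub>F n in sequentially. A + r < X n\<close>
        proof eventually_elim
          case (elim n)
          have "X n \<le> B" using X by simp
          then show ?case using elim \<open>r \<in> {0..B - A}\<close> by auto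
        qed
        ultimately have "(\<lambda>n. h (X n - r)) \<longlonglongrightarrow> h (x - r)"
          by (intro continuous_on_tendsto_compose[OF h] tendsto_intros lim)
        then have "(\<lambda>n. ?h (X n - r)) \<longlonglongrightarrow> h (x - r)"
          using ev by (simp add: tendsto_cong)
        then show ?thesis
          using \<open>x - r \<in> {A..B}\<close> by (intro tendsto_mult_left) (simp add: cut_def)
      next
        case False
        then have "\<forall>\<^sub>F n in sequentially. X n < A + r"
          using order_tendstoD(2)[OF lim, of "A + r"] r by simp
        then have ev: "\<forall>\<^sub>F n in sequentially. ?k r * ?h (X n - r) = 0"
          by eventually_elim (auto simp: cut_def)
        moreover have "?h (x - r) = 0" using False r by (auto simp: cut_def)
        ultimately show ?thesis by (simp add: tendsto_eventually)
      qed
    qed (simp add: cut_def)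
    moreover have "AE r in lborel. r \<noteq> x - A" by (rule AE_lborel_singleton)
    ultimately show "AE r in lborel. (\<lambda>n. ?k r * ?h (X n - r)) \<longlonglongrightarrow> ?k r * ?h (x - r)"
      by (auto elim: eventually_mono)
  qed
  then show "(volterra \<kappa> A h \<circ> X) \<longlonglongrightarrow> volterra \<kappa> A h x"
    using X x by (simp add: o_def volterra_cut swap)
qed

end

text \<open>The composite kernel \<open>\<kappa>3\<close> is prescribed on \<open>(0, B - A]\<close> only: its value at \<open>0\<close> concerns a single
  point of the domain of integration.\<close>

lemma volterra_assoc:
  assumes \<kappa>1: "kernel (B - A) \<kappa>1" and \<kappa>2: "kernel (B - A) \<kappa>2" and h: "continuous_on {A..B} h"
    and "kernel (B - A) \<kappa>3" and \<kappa>3: "\<And>s. \<lbrakk>0 < s; s \<le> B - A\<rbrakk> \<Longrightarrow> volterra \<kappa>1 0 \<kappa>2 s = \<kappa>3 s" and x: "x \<in> {A..B}"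
  shows "volterra \<kappa>1 A (volterra \<kappa>2 A h) x = volterra \<kappa>3 A h x"
proof -
  let ?k1 = "cut 0 (B - A) \<kappa>1" and ?k2 = "cut 0 (B - A) \<kappa>2" and ?h = "cut A B h"
  have k1: "integrable lborel ?k1" and k2: "integrable lborel ?k2"
    and k3: "integrable lborel (cut 0 (B - A) \<kappa>3)"
    using \<kappa>1 \<kappa>2 \<open>kernel (B - A) \<kappa>3\<close> by (simp_all add: kernel_cut)
  obtain M where M: "\<And>s. \<bar>?h s\<bar> \<le> M" using cut_bounded[OF h] by metis
  have "volterra \<kappa>1 A (volterra \<kappa>2 A h) x = convolution ?k1 (cut A B (volterra \<kappa>2 A h)) x"
    by (rule volterra_cut[OF x])
  also have "\<dots> = convolution ?k1 (convolution ?k2 ?h) x"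
    unfolding convolution_def[of ?k1]
  proof (intro Bochner_Integration.integral_cong refl)
    fix s
    show "?k1 (x - s) * cut A B (volterra \<kappa>2 A h) s = ?k1 (x - s) * convolution ?k2 ?h s"
    proof (cases "s \<in> {A..B}")
      case True
      then show ?thesis by (simp add: cut_def[of A B] volterra_cut)
    next
      case False
      show ?thesis
      proof (cases "s < A")
        case True
        then have "(\<lambda>\<sigma>. ?k2 (s - \<sigma>) * ?h \<sigma>) = (\<lambda>\<sigma>. 0)"
          by (auto simp: cut_def indicator_def fun_eq_iff)
        then have "convolution ?k2 ?h s = 0" by (simp add: convolution_def)
        then show ?thesis using False by (simp add: cut_def)
      next
        case 2: False
        then have "?k1 (x - s) = 0" using False x by (auto simp: cut_def)
        then show ?thesis by simp
      qed
    qed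
  qed
  also have "\<dots> = convolution (convolution ?k1 ?k2) ?h x"
    by (rule convolution_assoc[OF k1 k2 cut_measurable[OF h] M])
  also have "\<dots> = convolution (cut 0 (B - A) \<kappa>3) ?h x"
    unfolding convolution_def[of _ ?h]
  proof (rule integral_cong_AE)
    note [measurable] = borel_measurable_integrable[OF k1] borel_measurable_integrable[OF k2]
      borel_measurable_integrable[OF k3] cut_measurable[OF h]
    show "(\<lambda>\<sigma>. convolution ?k1 ?k2 (x - \<sigma>) * ?h \<sigma>) \<in> borel_measurable lborel"
      unfolding convolution_def by measurable
    show "(\<lambda>\<sigma>. cut 0 (B - A) \<kappa>3 (x - \<sigma>) * ?h \<sigma>) \<in> borel_measurable lborel"
      by measurable
    have "convolution ?k1 ?k2 (x - \<sigma>) * ?h \<sigma> = cut 0 (B - A) \<kappa>3 (x - \<sigma>) * ?h \<sigma>" if "\<sigma> \<noteq> x" for \<sigma>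
    proof (cases "\<sigma> \<in> {A..B}")
      case \<sigma>: True
      show ?thesis
      proof (cases "\<sigma> < x")
        case True
        then have y: "0 < x - \<sigma>" "x - \<sigma> \<le> B - A" using \<sigma> x by auto
        have "convolution ?k1 ?k2 (x - \<sigma>) = volterra \<kappa>1 0 \<kappa>2 (x - \<sigma>)"
          using volterra_cut[of "x - \<sigma>" 0 "B - A" \<kappa>1 \<kappa>2] y by simp
        then show ?thesis using \<kappa>3[OF y] y by (simp add: cut_def)
      next
        case False
        then have "(\<lambda>s. ?k1 (x - \<sigma> - s) * ?k2 s) = (\<lambda>s. 0)"
          using that by (auto simp: cut_def indicator_def fun_eq_iff)
        then have "convolution ?k1 ?k2 (x - \<sigma>) = 0" by (simp add: convolution_def)
        then show ?thesis using False that by (simp add: cut_def)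
      qed
    qed (simp add: cut_def)
    moreover have "AE \<sigma> in lborel. \<sigma> \<noteq> x" by (rule AE_lborel_singleton)
    ultimately show "AE \<sigma> in lborel. convolution ?k1 ?k2 (x - \<sigma>) * ?h \<sigma> = cut 0 (B - A) \<kappa>3 (x - \<sigma>) * ?h \<sigma>"
      by (auto elim: eventually_mono)
  qed
  also have "\<dots> = volterra \<kappa>3 A h x"
    by (rule volterra_cut[OF x, symmetric])
  finally show ?thesis .
qed

lemma volterra_diff:
  assumes \<kappa>: "kernel (B - A) \<kappa>" and g: "continuous_on {A..B} g" and h: "continuous_on {A..B} h"
    and x: "x \<in> {A..B}"
  shows "volterra \<kappa> A (\<lambda>s. g s - h s) x = volterra \<kappa> A g x - volterra \<kappa> A h x"
  unfolding volterra_def right_diff_distrib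
  by (intro set_integral_diff(2) volterra_integrable[OF \<kappa> _ x] g h)

lemma volterra_add:
  assumes \<kappa>: "kernel (B - A) \<kappa>" and g: "continuous_on {A..B} g" and h: "continuous_on {A..B} h"
    and x: "x \<in> {A..B}"
  shows "volterra \<kappa> A (\<lambda>s. g s + h s) x = volterra \<kappa> A g x + volterra \<kappa> A h x"
  unfolding volterra_def distrib_left
  by (intro set_integral_add(2) volterra_integrable[OF \<kappa> _ x] g h)

lemma volterra_mult: "volterra \<kappa> A (\<lambda>s. c * h s) x = c * volterra \<kappa> A h x"
  unfolding volterra_def by (simp add: mult.left_commute[of _ c])

lemma volterra_cmult: "volterra (\<lambda>s. c * \<kappa> s) A h x = c * volterra \<kappa> A h x"
  unfolding volterra_def by (simp add: mult.assoc)

lemma volterra_kernel_add: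
  assumes \<kappa>: "kernel (B - A) \<kappa>" and \<kappa>': "kernel (B - A) \<kappa>'" and h: "continuous_on {A..B} h"
    and x: "x \<in> {A..B}"
  shows "volterra (\<lambda>s. \<kappa> s + \<kappa>' s) A h x = volterra \<kappa> A h x + volterra \<kappa>' A h x"
  unfolding volterra_def distrib_right
  by (intro set_integral_add(2) volterra_integrable[OF _ h x] \<kappa> \<kappa>')

lemma volterra_sum:
  assumes \<kappa>: "kernel (B - A) \<kappa>" and g: "\<And>i. i \<in> I \<Longrightarrow> continuous_on {A..B} (g i)" and x: "x \<in> {A..B}"
  shows "volterra \<kappa> A (\<lambda>s. \<Sum>i\<in>I. g i s) x = (\<Sum>i\<in>I. volterra \<kappa> A (g i) x)"
  using volterra_integrable[OF \<kappa> g x]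
  unfolding volterra_def set_lebesgue_integral_def set_integrable_def
  by (subst Bochner_Integration.integral_sum[symmetric]) (auto simp: sum_distrib_left)

lemma volterra_mono:
  assumes \<kappa>: "kernel (B - A) \<kappa>" "\<And>s. 0 \<le> \<kappa> s" and g: "continuous_on {A..B} g" and h: "continuous_on {A..B} h"
    and x: "x \<in> {A..B}" and le: "\<And>s. s \<in> {A..B} \<Longrightarrow> g s \<le> h s"
  shows "volterra \<kappa> A g x \<le> volterra \<kappa> A h x"
  unfolding volterra_def using x
  by (intro set_integral_mono volterra_integrable[OF \<kappa>(1) _ x] g h mult_left_mono le \<kappa>(2)) auto

lemma volterra_uniform_limit:
  assumes \<kappa>: "kernel (B - A) \<kappa>" and s: "\<And>n. continuous_on {A..B} (s n)"
    and lim: "uniform_limit {A..B} s g sequentially" and x: "x \<in> {A..B}"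
  shows "(\<lambda>n. volterra \<kappa> A (s n) x) \<longlonglongrightarrow> volterra \<kappa> A g x"
proof (rule LIMSEQ_I)
  let ?K = "LINT s:{0..B - A}|lborel. \<bar>\<kappa> s\<bar>"
  fix e :: real assume e: "0 < e"
  have K: "0 \<le> ?K" unfolding set_lebesgue_integral_def by (intro integral_nonneg_AE) auto
  have g: "continuous_on {A..B} g"
    by (rule uniform_limit_theorem[OF _ lim]) (auto intro!: always_eventually s)
  have "0 < e / (?K + 1)" using e K by simp
  then have "\<forall>\<^sub>F n in sequentially. \<forall>y\<in>{A..B}. dist (s n y) (g y) < e / (?K + 1)"
    using lim unfolding uniform_limit_iff by blast
  then obtain N where N: "\<And>n y. \<lbrakk>N \<le> n; y \<in> {A..B}\<rbrakk> \<Longrightarrow> dist (s n y) (g y) < e / (?K + 1)"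
    unfolding eventually_sequentially by blast
  have "norm (volterra \<kappa> A (s n) x - volterra \<kappa> A g x) < e" if n: "N \<le> n" for n
  proof -
    have "volterra \<kappa> A (s n) x - volterra \<kappa> A g x = volterra \<kappa> A (\<lambda>y. s n y - g y) x"
      by (rule volterra_diff[OF \<kappa> s g x, symmetric])
    also have "\<bar>\<dots>\<bar> \<le> e / (?K + 1) * ?K"
    proof (rule volterra_abs_le[OF \<kappa> _ x])
      show "continuous_on {A..B} (\<lambda>y. s n y - g y)" by (intro continuous_intros s g)
      show "\<bar>s n y - g y\<bar> \<le> e / (?K + 1)" if "y \<in> {A..B}" for y
        using N[OF n that] by (simp add: dist_real_def)
    qed
    also have "\<dots> < e" using e K by (simp add: field_simps)
    finally show ?thesis by simp
  qed
  then show "\<exists>N. \<forall>n\<ge>N. norm (volterra \<kappa> A (s n) x - volterra \<kappa> A g x) < e" by blast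
qed

text \<open>Cauchy-Schwarz for the weight \<open>k\<close>, obtained from the nonnegative integral of \<open>k (\<bar>h\<bar> - d)\<^sup>2\<close>
  with \<open>d\<close> the weighted integral of \<open>\<bar>h\<bar>\<close> divided by \<open>K\<close>. A positive upper bound \<open>K\<close> takes the place of
  the mass of the weight, which vanishes at \<open>x = A\<close>.\<close>

lemma volterra_square_le:
  assumes \<kappa>: "kernel (B - A) \<kappa>" and k: "kernel (B - A) k" and k0: "\<And>s. 0 \<le> k s"
    and dom: "\<And>s. 0 \<le> s \<Longrightarrow> \<bar>\<kappa> s\<bar> \<le> k s"
    and h: "continuous_on {A..B} h" and x: "x \<in> {A..B}"
    and K: "0 < K" "volterra k A (\<lambda>_. 1) x \<le> K"
  shows "(volterra \<kappa> A h x)\<^sup>2 \<le> K * volterra k A (\<lambda>s. (h s)\<^sup>2) x"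
proof -
  let ?I = "volterra k A (\<lambda>s. \<bar>h s\<bar>) x"
  note c = continuous_on_const[of "{A..B}" "1 :: real"]
  have h1: "continuous_on {A..B} (\<lambda>s. \<bar>h s\<bar>)" and h2: "continuous_on {A..B} (\<lambda>s. (h s)\<^sup>2)"
    by (intro continuous_intros h)+
  have le: "\<bar>volterra \<kappa> A h x\<bar> \<le> ?I"
  proof -
    have "\<bar>volterra \<kappa> A h x\<bar> \<le> (LINT s:{A..x}|lborel. \<bar>\<kappa> (x - s) * h s\<bar>)"
      using set_integral_norm_bound[OF volterra_integrable[OF \<kappa> h x]] by (simp add: volterra_def)
    also have "\<dots> \<le> ?I"
      unfolding volterra_def
      using set_integrable_abs[OF volterra_integrable[OF \<kappa> h x]]
      by (intro set_integral_mono volterra_integrable[OF k h1 x])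
        (auto simp: abs_mult intro!: mult_right_mono dom)
    finally show ?thesis .
  qed
  define d where "d = ?I / K"
  have "0 \<le> volterra k A (\<lambda>s. (\<bar>h s\<bar> - d)\<^sup>2) x"
    unfolding volterra_def set_lebesgue_integral_def by (intro integral_nonneg_AE) (auto simp: k0)
  also have "(\<lambda>s. (\<bar>h s\<bar> - d)\<^sup>2) = (\<lambda>s. ((h s)\<^sup>2 - (2 * d) * \<bar>h s\<bar>) + d\<^sup>2 * 1)"
    by (auto simp: power2_eq_square algebra_simps abs_mult_self_eq)
  also have "volterra k A \<dots> x = volterra k A (\<lambda>s. (h s)\<^sup>2) x - 2 * d * ?I + d\<^sup>2 * volterra k A (\<lambda>_. 1) x"
    by (subst volterra_add[OF k _ _ x] volterra_diff[OF k h2 _ x],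
        (intro continuous_intros h)+)+ (simp only: volterra_mult)
  also have "\<dots> \<le> volterra k A (\<lambda>s. (h s)\<^sup>2) x - 2 * d * ?I + d\<^sup>2 * K"
    using K by (intro add_left_mono mult_left_mono) auto
  also have "\<dots> = volterra k A (\<lambda>s. (h s)\<^sup>2) x - ?I\<^sup>2 / K"
    using K(1) by (simp add: d_def power2_eq_square field_simps)
  finally have "?I\<^sup>2 \<le> K * volterra k A (\<lambda>s. (h s)\<^sup>2) x"
    using K(1) by (simp add: field_simps)
  moreover have "(volterra \<kappa> A h x)\<^sup>2 \<le> ?I\<^sup>2"
    using le by (metis abs_ge_zero power2_abs power_mono)
  ultimately show ?thesis by simp
qed

text \<open>The substitution \<open>s = \<tau>\<^sup>p\<close> is carried out on the open interval, where \<open>\<tau>\<^sup>p\<close> is differentiable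
  also when \<open>a = 0\<close> and \<open>p < 1\<close>.\<close>

lemma volterra_change_of_variables:
  fixes \<Phi> h :: "real \<Rightarrow> real"
  assumes p: "0 < p" and a: "0 \<le> a" and t: "t \<in> {a..T}"
    and \<Phi>: "kernel (T powr p - a powr p) \<Phi>"
    and h: "continuous_on {a powr p..T powr p} (\<lambda>s. h (s powr (1 / p)))"
  shows "(LINT \<tau>:{a..t}|lebesgue. \<Phi> (t powr p - \<tau> powr p) * h \<tau> * (p * \<tau> powr (p - 1))) =
    volterra \<Phi> (a powr p) (\<lambda>s. h (s powr (1 / p))) (t powr p)"
proof -
  define P where "P = t powr p"
  define f where "f s = \<Phi> (P - s) * h (s powr (1 / p))" for s
  define F where "F \<tau> = \<Phi> (t powr p - \<tau> powr p) * h \<tau> * (p * \<tau> powr (p - 1))" for \<tau>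
  have P: "P \<in> {a powr p..T powr p}"
    unfolding P_def using t a p by (auto intro!: powr_mono2)
  have vi: "set_integrable lborel {a powr p..P} f"
    unfolding f_def by (rule volterra_integrable[OF \<Phi> h P])
  have f_abs: "f absolutely_integrable_on {a powr p..P}"
    using vi unfolding set_integrable_def
    by (subst integrable_completion) (auto dest: borel_measurable_integrable)
  have val: "volterra \<Phi> (a powr p) (\<lambda>s. h (s powr (1 / p))) P = integral {a powr p..P} f"
    using set_borel_integral_eq_integral(2)[OF vi] by (simp add: volterra_def f_def)
  let ?S = "{a<..<t}"
  have img: "(\<lambda>\<tau>. \<tau> powr p) ` ?S = {a powr p<..<P}"
  proof (intro equalityI subsetI)
    fix s assume "s \<in> {a powr p<..<P}"
    then have s: "a powr p < s" "s < t powr p" by (auto simp: P_def)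
    then have s0: "0 < s" using powr_ge_zero[of a p] by linarith
    have "a < s powr (1 / p)"
      using powr_less_mono2[of "1 / p" "a powr p" s] s p a by (simp add: powr_powr)
    moreover have "s powr (1 / p) < t"
      using powr_less_mono2[of "1 / p" s "t powr p"] s s0 p a t by (simp add: powr_powr)
    ultimately show "s \<in> (\<lambda>\<tau>. \<tau> powr p) ` ?S"
      using s0 p by (intro image_eqI[of _ _ "s powr (1 / p)"]) (auto simp: powr_powr)
  qed (use a p in \<open>auto simp: P_def intro!: powr_less_mono2\<close>)
  have inj: "inj_on (\<lambda>\<tau>. \<tau> powr p) ?S"
  proof (rule inj_onI)
    fix y z assume yz: "y \<in> ?S" "z \<in> ?S" "y powr p = z powr p"
    have "y = (y powr p) powr (1 / p)" using yz(1) a p by (simp add: powr_powr)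
    also have "\<dots> = (z powr p) powr (1 / p)" by (simp only: yz(3))
    also have "\<dots> = z" using yz(2) a p by (simp add: powr_powr)
    finally show "y = z" .
  qed
  have der: "((\<lambda>\<tau>. \<tau> powr p) has_field_derivative p * \<tau> powr (p - 1)) (at \<tau> within ?S)"
    if "\<tau> \<in> ?S" for \<tau>
    using that a by (intro has_real_derivative_powr[THEN has_field_derivative_at_within]) auto
  have f_abs': "f absolutely_integrable_on ((\<lambda>\<tau>. \<tau> powr p) ` ?S)"
    unfolding img using f_abs by (rule set_integrable_subset) auto
  have cov: "(\<lambda>\<tau>. \<bar>p * \<tau> powr (p - 1)\<bar> * f (\<tau> powr p)) absolutely_integrable_on ?S \<and>
      integral ?S (\<lambda>\<tau>. \<bar>p * \<tau> powr (p - 1)\<bar> * f (\<tau> powr p)) = integral ((\<lambda>\<tau>. \<tau> powr p) ` ?S) f"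
    using has_absolute_integral_change_of_variables_1'[of ?S "\<lambda>\<tau>. \<tau> powr p" "\<lambda>\<tau>. p * \<tau> powr (p - 1)" f
        "integral ((\<lambda>\<tau>. \<tau> powr p) ` ?S) f"] der inj f_abs' by auto
  have eq: "\<bar>p * \<tau> powr (p - 1)\<bar> * f (\<tau> powr p) = F \<tau>" if "\<tau> \<in> ?S" for \<tau>
    using that a p by (simp add: F_def f_def P_def powr_powr abs_mult)
  have F_S: "F absolutely_integrable_on ?S" "integral ?S F = integral {a powr p<..<P} f"
    using cov eq img set_integrable_cong[of lebesgue lebesgue ?S ?S "\<lambda>\<tau>. \<bar>p * \<tau> powr (p - 1)\<bar> * f (\<tau> powr p)" F]
      Henstock_Kurzweil_Integration.integral_cong[of ?S "\<lambda>\<tau>. \<bar>p * \<tau> powr (p - 1)\<bar> * f (\<tau> powr p)" F]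
    by auto
  have F_abs: "F absolutely_integrable_on {a..t}"
  proof -
    have neg: "negligible ({a..t} - ?S)"
      by (rule negligible_subset[of "{a, t}"]) auto
    have n1: "negligible {\<tau> \<in> {a..t} - ?S. F \<tau> \<noteq> 0}" by (rule negligible_subset[OF neg]) auto
    have n2: "negligible {\<tau> \<in> ?S - {a..t}. F \<tau> \<noteq> 0}" by (rule negligible_subset[OF negligible_empty]) auto
    show ?thesis using absolutely_integrable_spike_set_eq[OF n1 n2] F_S(1) by blast
  qed
  have "(LINT \<tau>:{a..t}|lebesgue. F \<tau>) = integral {a..t} F"
    by (rule set_lebesgue_integral_eq_integral(2)[OF F_abs])
  also have "\<dots> = integral ?S F" by (rule integral_open_interval_real)
  also have "\<dots> = integral {a powr p<..<P} f" by (rule F_S(2))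
  also have "\<dots> = integral {a powr p..P} f" by (rule integral_open_interval_real[symmetric])
  finally show "(LINT \<tau>:{a..t}|lebesgue. \<Phi> (t powr p - \<tau> powr p) * h \<tau> * (p * \<tau> powr (p - 1))) =
    volterra \<Phi> (a powr p) (\<lambda>s. h (s powr (1 / p))) (t powr p)"
    using val by (simp add: F_def P_def)
qed

section \<open>The resolvent of the Abel kernel\<close>

lemma volterra_cong:
  assumes "\<And>s. s \<in> {A..x} \<Longrightarrow> h s = g s"
  shows "volterra \<kappa> A h x = volterra \<kappa> A g x"
  unfolding volterra_def set_lebesgue_integral_def
  by (intro Bochner_Integration.integral_cong) (auto simp: indicator_def assms)

lemma volterra_const:
  assumes "x \<in> {A..B}"
  shows "volterra \<kappa> A (\<lambda>_. 1) x = (LINT r:{0..x - A}|lborel. \<kappa> r)"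
proof -
  have "volterra \<kappa> A (\<lambda>_. 1) x = (\<integral>s. indicator {0..x - A} (x - s) * \<kappa> (x - s) \<partial>lborel)"
    unfolding volterra_def set_lebesgue_integral_def
    by (intro Bochner_Integration.integral_cong) (auto simp: indicator_def)
  also have "\<dots> = (LINT r:{0..x - A}|lborel. \<kappa> r)"
    unfolding set_lebesgue_integral_def
    using integral_reflect_shift[of "\<lambda>r. indicator {0..x - A} r * \<kappa> r" x] by simp
  finally show ?thesis .
qed

lemma volterra_initial: "volterra \<kappa> A h A = 0"
  unfolding volterra_def set_lebesgue_integral_def
proof (rule integral_eq_zero_AE)
  show "AE s in lborel. indicat_real {A..A} s *\<^sub>R (\<kappa> (A - s) * h s) = 0"
    using AE_lborel_singleton[of A] by eventually_elim (auto simp: indicator_def)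
qed

lemma kernel_const: "kernel L (\<lambda>_. c)"
  unfolding kernel_def by (intro borel_integrable_atLeastAtMost') auto

text \<open>The kernel of the second integral in a time factor. It is the convolution of \<open>abel \<alpha>\<close> with the
  resolvent kernel, up to the factor \<open>Gamma \<alpha>\<close>.\<close>

abbreviation double_kernel :: "real \<Rightarrow> real \<Rightarrow> real \<Rightarrow> real" where
  "double_kernel \<alpha> \<mu> \<equiv> \<lambda>s. s powr (2 * \<alpha> - 1) * mittag_leffler \<alpha> (2 * \<alpha>) (- (\<mu> * s powr \<alpha>))"

text \<open>The resolvent of the Abel kernel: convolution with it is \<open>J (1 + \<mu> J)\<^sup>-\<^sup>1\<close> for the fractional
  integral \<open>J\<close> of order \<open>\<alpha>\<close>.\<close>

definition resolvent_kernel :: "real \<Rightarrow> real \<Rightarrow> real \<Rightarrow> real" where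
  "resolvent_kernel \<alpha> \<mu> s = s powr (\<alpha> - 1) * mittag_leffler \<alpha> \<alpha> (- (\<mu> * s powr \<alpha>))"

context
  fixes p a T :: real
  assumes p: "0 < p" and a: "0 \<le> a" "a < T"
begin

lemma powr_mem: "t \<in> {a..T} \<Longrightarrow> t powr p \<in> {a powr p..T powr p}"
  using p a by (auto intro!: powr_mono2)

lemma root_mem:
  assumes "s \<in> {a powr p..T powr p}"
  shows "s powr (1 / p) \<in> {a..T}"
proof -
  have "a powr p \<le> s" using assms by simp
  then have "0 \<le> s" by (rule order_trans[OF powr_ge_zero])
  then have "(a powr p) powr (1 / p) \<le> s powr (1 / p)" "s powr (1 / p) \<le> (T powr p) powr (1 / p)"
    using assms p by (auto intro!: powr_mono2)
  then show ?thesis using p a by (simp add: powr_powr)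
qed

lemma pull_continuous_on:
  assumes "continuous_on {a..T} h"
  shows "continuous_on {a powr p..T powr p} (\<lambda>s. h (s powr (1 / p)))"
proof (rule continuous_on_compose2[OF assms])
  show "continuous_on {a powr p..T powr p} (\<lambda>s. s powr (1 / p))"
  proof (intro continuous_on_powr' continuous_intros ballI)
    fix s assume "s \<in> {a powr p..T powr p}"
    then have "a powr p \<le> s" by simp
    then have "0 \<le> s" by (rule order_trans[OF powr_ge_zero])
    then show "0 \<le> s \<and> (s = 0 \<longrightarrow> 0 < 1 / p)" using p by simp
  qed
  show "(\<lambda>s. s powr (1 / p)) ` {a powr p..T powr p} \<subseteq> {a..T}"
    using root_mem by blast
qed

lemma root_powr: "t \<in> {a..T} \<Longrightarrow> (t powr p) powr (1 / p) = t"
  using p a by (simp add: powr_powr)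

end

context
  fixes \<alpha> :: real
  assumes \<alpha>: "0 < \<alpha>" "\<alpha> < 1"
begin

lemma Gamma_alpha_pos: "0 < Gamma \<alpha>"
  using \<alpha> by (intro Gamma_real_pos)

lemma resolvent_kernel_bound:
  assumes "0 \<le> \<mu>"
  shows "\<bar>resolvent_kernel \<alpha> \<mu> s\<bar> \<le> 1 / Gamma \<alpha> * s powr (\<alpha> - 1)"
proof -
  have "0 \<le> mittag_leffler \<alpha> \<alpha> (- (\<mu> * s powr \<alpha>))" "mittag_leffler \<alpha> \<alpha> (- (\<mu> * s powr \<alpha>)) \<le> 1 / Gamma \<alpha>"
    using mittag_leffler_bounds[of \<alpha> \<alpha> "\<mu> * s powr \<alpha>"] \<alpha> assms by auto
  then have "s powr (\<alpha> - 1) * \<bar>mittag_leffler \<alpha> \<alpha> (- (\<mu> * s powr \<alpha>))\<bar> \<le> s powr (\<alpha> - 1) * (1 / Gamma \<alpha>)"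
    by (intro mult_left_mono) auto
  then show ?thesis by (simp add: resolvent_kernel_def abs_mult)
qed

lemma kernel_resolvent:
  assumes "0 \<le> \<mu>"
  shows "kernel L (resolvent_kernel \<alpha> \<mu>)"
proof (rule kernel_mono[where \<kappa>' = "\<lambda>s. 1 / Gamma \<alpha> * s powr (\<alpha> - 1)"])
  show "kernel L (\<lambda>s. 1 / Gamma \<alpha> * s powr (\<alpha> - 1))"
    using \<alpha> by (intro kernel_mult kernel_powr)
  have [measurable]: "mittag_leffler \<alpha> \<alpha> \<in> borel_measurable borel"
    using \<alpha> mittag_leffler_isCont
    by (intro borel_measurable_continuous_onI continuous_at_imp_continuous_on) auto
  show "resolvent_kernel \<alpha> \<mu> \<in> borel_measurable borel"
    unfolding resolvent_kernel_def[abs_def] by measurable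
qed (rule resolvent_kernel_bound[OF assms])

lemma resolvent_kernel_split:
  "resolvent_kernel \<alpha> \<mu> s = 1 / Gamma \<alpha> * s powr (\<alpha> - 1) +
    (- \<mu>) * (s powr (2 * \<alpha> - 1) * mittag_leffler \<alpha> (2 * \<alpha>) (- (\<mu> * s powr \<alpha>)))"
proof -
  have "s powr (2 * \<alpha> - 1) = s powr (\<alpha> - 1) * s powr \<alpha>"
    by (simp add: powr_add[symmetric] algebra_simps)
  then show ?thesis
    unfolding resolvent_kernel_def mittag_leffler_shift[OF \<alpha>(1) \<alpha>(1), of "- (\<mu> * s powr \<alpha>)"]
    by (simp add: algebra_simps)
qed

lemma kernel_double:
  assumes "0 < \<mu>"
  shows "kernel L (double_kernel \<alpha> \<mu>)"
proof -
  have "kernel L (\<lambda>s. (1 / \<mu>) * (1 / Gamma \<alpha> * s powr (\<alpha> - 1) - resolvent_kernel \<alpha> \<mu> s))"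
    using \<alpha> assms by (intro kernel_mult kernel_diff kernel_powr kernel_resolvent) auto
  moreover have "(1 / \<mu>) * (1 / Gamma \<alpha> * s powr (\<alpha> - 1) - resolvent_kernel \<alpha> \<mu> s) =
      s powr (2 * \<alpha> - 1) * mittag_leffler \<alpha> (2 * \<alpha>) (- (\<mu> * s powr \<alpha>))" for s
    unfolding resolvent_kernel_split using assms by simp
  ultimately show ?thesis by simp
qed

lemma volterra_resolvent_split:
  assumes \<mu>: "0 < \<mu>" and h: "continuous_on {A..B} h" and x: "x \<in> {A..B}"
  shows "volterra (resolvent_kernel \<alpha> \<mu>) A h x = 1 / Gamma \<alpha> * volterra (abel \<alpha>) A h x -
    \<mu> * volterra (double_kernel \<alpha> \<mu>) A h x"
proof -
  have "volterra (resolvent_kernel \<alpha> \<mu>) A h x = volterra (\<lambda>s. 1 / Gamma \<alpha> * s powr (\<alpha> - 1) +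
    (- \<mu>) * (s powr (2 * \<alpha> - 1) * mittag_leffler \<alpha> (2 * \<alpha>) (- (\<mu> * s powr \<alpha>)))) A h x"
    by (simp only: resolvent_kernel_split[symmetric])
  also have "\<dots> = volterra (\<lambda>s. 1 / Gamma \<alpha> * s powr (\<alpha> - 1)) A h x +
     volterra (\<lambda>s. (- \<mu>) * (s powr (2 * \<alpha> - 1) * mittag_leffler \<alpha> (2 * \<alpha>) (- (\<mu> * s powr \<alpha>)))) A h x"
    using \<alpha> by (intro volterra_kernel_add[OF _ _ h x] kernel_mult kernel_powr kernel_double \<mu>)
  finally show ?thesis unfolding volterra_cmult by simp
qed

lemma volterra_powr_resolvent:
  assumes \<mu>: "0 < \<mu>" and h: "continuous_on {A..B} h" and x: "x \<in> {A..B}"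
  shows "volterra (abel \<alpha>) A (volterra (resolvent_kernel \<alpha> \<mu>) A h) x =
    Gamma \<alpha> * volterra (double_kernel \<alpha> \<mu>) A h x"
proof -
  let ?k = "double_kernel \<alpha> \<mu>"
  have "volterra (abel \<alpha>) A (volterra (resolvent_kernel \<alpha> \<mu>) A h) x =
      volterra (\<lambda>s. Gamma \<alpha> * ?k s) A h x"
  proof (rule volterra_assoc[OF _ _ h _ _ x])
    fix s :: real assume "0 < s"
    then show "volterra (abel \<alpha>) 0 (resolvent_kernel \<alpha> \<mu>) s = Gamma \<alpha> * ?k s"
      using mittag_leffler_convolution(2)[OF \<alpha>(1) \<alpha>(1) \<alpha>(1), of s "- \<mu>"]
      by (simp add: volterra_def resolvent_kernel_def[abs_def] mult_2[symmetric])
  qed (use \<alpha> \<mu> in \<open>auto intro!: kernel_powr kernel_resolvent kernel_mult kernel_double\<close>)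
  then show ?thesis by (simp add: volterra_cmult)
qed

text \<open>With \<open>J\<close> the fractional integral of order \<open>\<alpha>\<close> and \<open>R\<close> the convolution with the resolvent
  kernel, this reads \<open>R = J - \<mu> J R\<close>, that is, \<open>R = J (1 + \<mu> J)\<^sup>-\<^sup>1\<close>.\<close>

lemma resolvent_equation:
  assumes "0 < \<mu>" "continuous_on {A..B} h" "x \<in> {A..B}"
  shows "volterra (resolvent_kernel \<alpha> \<mu>) A h x = 1 / Gamma \<alpha> * volterra (abel \<alpha>) A h x -
    \<mu> * (1 / Gamma \<alpha> * volterra (abel \<alpha>) A (volterra (resolvent_kernel \<alpha> \<mu>) A h) x)"
  unfolding volterra_powr_resolvent[OF assms] volterra_resolvent_split[OF assms]
  using less_imp_neq[OF Gamma_alpha_pos, symmetric] by simp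

text \<open>The homogeneous time factor \<open>E\<^sub>\<alpha>\<^sub>,\<^sub>1\<close> is \<open>1 - \<mu> R 1\<close>. In this form the initial value enters the
  equation of the time factor in the same way as the source.\<close>

lemma mittag_leffler_eq_volterra:
  assumes \<mu>: "0 < \<mu>" and x: "x \<in> {A..B}"
  shows "mittag_leffler \<alpha> 1 (- (\<mu> * (x - A) powr \<alpha>)) = 1 - \<mu> * volterra (resolvent_kernel \<alpha> \<mu>) A (\<lambda>_. 1) x"
proof (cases "x = A")
  case True
  then show ?thesis using \<alpha> by (simp add: mittag_leffler_0 volterra_initial)
next
  case False
  define t where "t = x - A"
  have t: "0 < t" using False x by (simp add: t_def)
  let ?f = "\<lambda>s. (t - s) powr (1 - 1) * (s powr (\<alpha> - 1) * mittag_leffler \<alpha> \<alpha> ((- \<mu>) * s powr \<alpha>))"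
  note c = mittag_leffler_convolution[OF \<alpha>(1) \<alpha>(1) zero_less_one t, of "- \<mu>"]
  have "(LINT r:{0..t}|lborel. resolvent_kernel \<alpha> \<mu> r) = (LINT r:{0..t}|lborel. ?f r)"
    unfolding set_lebesgue_integral_def
  proof (rule integral_cong_AE)
    show "(\<lambda>r. indicat_real {0..t} r *\<^sub>R ?f r) \<in> borel_measurable lborel"
      using c(1) unfolding set_integrable_def by (rule borel_measurable_integrable)
    show "(\<lambda>r. indicat_real {0..t} r *\<^sub>R resolvent_kernel \<alpha> \<mu> r) \<in> borel_measurable lborel"
      using kernel_resolvent[of \<mu> t] \<mu> unfolding kernel_def set_integrable_def
      by (intro borel_measurable_integrable) auto
    show "AE r in lborel. indicat_real {0..t} r *\<^sub>R resolvent_kernel \<alpha> \<mu> r = indicat_real {0..t} r *\<^sub>R ?f r"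
      using AE_lborel_singleton[of t] by eventually_elim (auto simp: resolvent_kernel_def)
  qed
  then have "volterra (resolvent_kernel \<alpha> \<mu>) A (\<lambda>_. 1) x = t powr \<alpha> * mittag_leffler \<alpha> (\<alpha> + 1) ((- \<mu>) * t powr \<alpha>)"
    using c(2) volterra_const[OF x] by (simp add: t_def)
  then show ?thesis
    using mittag_leffler_shift[OF \<alpha>(1) zero_less_one, of "- (\<mu> * t powr \<alpha>)"]
    by (simp add: t_def add.commute)
qed

text \<open>Fractional integration of order \<open>1 - \<alpha>\<close> after order \<open>\<alpha>\<close> is ordinary integration, because the
  Beta integral of \<open>\<alpha>\<close> and \<open>1 - \<alpha>\<close> does not depend on its upper limit.\<close>

lemma volterra_powr_powr:
  assumes g: "continuous_on {A..B} g" and x: "x \<in> {A..B}"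
  shows "volterra (\<lambda>s. s powr (- \<alpha>)) A (volterra (abel \<alpha>) A g) x =
    Gamma (1 - \<alpha>) * Gamma \<alpha> * integral {A..x} g"
proof -
  have "volterra (\<lambda>s. s powr (- \<alpha>)) A (volterra (abel \<alpha>) A g) x =
      volterra (\<lambda>s. Gamma (1 - \<alpha>) * Gamma \<alpha>) A g x"
  proof (rule volterra_assoc[OF _ _ g _ _ x])
    show "kernel (B - A) (\<lambda>s. s powr (- \<alpha>))"
      using kernel_powr[of "1 - \<alpha>" "B - A"] \<alpha> by simp
    show "kernel (B - A) (abel \<alpha>)" using \<alpha> by (intro kernel_powr)
    fix s :: real assume "0 < s"
    then show "volterra (\<lambda>s. s powr (- \<alpha>)) 0 (abel \<alpha>) s = Gamma (1 - \<alpha>) * Gamma \<alpha>"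
      using beta_scaled_lborel(2)[of \<alpha> "1 - \<alpha>" s] \<alpha> by (simp add: volterra_def Beta_def)
  qed (rule kernel_const)
  also have "\<dots> = Gamma (1 - \<alpha>) * Gamma \<alpha> * (LINT s:{A..x}|lborel. g s)"
    by (simp add: volterra_def)
  also have "(LINT s:{A..x}|lborel. g s) = integral {A..x} g"
    using x by (intro set_borel_integral_eq_integral(2) borel_integrable_atLeastAtMost'
        continuous_on_subset[OF g]) auto
  finally show ?thesis .
qed

lemma volterra_powr_const:
  assumes x: "x \<in> {A..B}"
  shows "volterra (\<lambda>s. s powr (- \<alpha>)) A (\<lambda>_. 1) x = (x - A) powr (1 - \<alpha>) / (1 - \<alpha>)"
proof -
  have "((\<lambda>s. s powr (- \<alpha>)) has_integral (x - A) powr (1 - \<alpha>) / (1 - \<alpha>)) {0..x - A}"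
    using has_integral_powr_from_0[of "- \<alpha>" "x - A"] \<alpha> x by (simp add: add.commute)
  moreover have "set_integrable lborel {0..x - A} (\<lambda>s. s powr (- \<alpha>))"
    using kernel_powr[of "1 - \<alpha>" "x - A"] \<alpha> by (simp add: kernel_def)
  ultimately show ?thesis
    unfolding volterra_const[OF x] by (simp add: set_borel_integral_eq_integral(2) has_integral_iff)
qed

context
  fixes p a T :: real
  assumes p: "0 < p" and a: "0 \<le> a" "a < T"
begin

text \<open>By the splitting of the resolvent kernel the two integrals of a time factor are one convolution,
  and the cancellation between them is taken into account once and for all.\<close>

lemma time_factor_eq_volterra:
  assumes l: "0 < l" and h: "continuous_on {a..T} h" and t: "t \<in> {a..T}"
  defines "\<mu> \<equiv> l / p powr \<alpha>"
  shows "time_factor \<alpha> p a l c h t =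
    c * mittag_leffler \<alpha> 1 (- (\<mu> * (t powr p - a powr p) powr \<alpha>)) +
    1 / p powr \<alpha> * volterra (resolvent_kernel \<alpha> \<mu>) (a powr p) (\<lambda>s. h (s powr (1 / p))) (t powr p)"
proof -
  have \<mu>: "0 < \<mu>" using l p by (simp add: \<mu>_def)
  note h' = pull_continuous_on[OF p a h]
  have ls: "- l / p powr \<alpha> = - \<mu>" by (simp add: \<mu>_def)
  let ?V = "\<lambda>\<kappa>. volterra \<kappa> (a powr p) (\<lambda>s. h (s powr (1 / p))) (t powr p)"
  let ?k = "double_kernel \<alpha> \<mu>"
  have 1: "(LINT \<tau>:{a..t}|lebesgue. (t powr p - \<tau> powr p) powr (\<alpha> - 1) * h \<tau> * (p * \<tau> powr (p - 1))) =
      ?V (abel \<alpha>)"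
    using \<alpha> by (intro volterra_change_of_variables[OF p a(1) t _ h'] kernel_powr)
  have 2: "(LINT \<tau>:{a..t}|lebesgue. (t powr p - \<tau> powr p) powr (2 * \<alpha> - 1) *
      mittag_leffler \<alpha> (2 * \<alpha>) (- \<mu> * (t powr p - \<tau> powr p) powr \<alpha>) * h \<tau> * (p * \<tau> powr (p - 1))) = ?V ?k"
    using volterra_change_of_variables[OF p a(1) t kernel_double[OF \<mu>] h'] by simp
  have "time_factor \<alpha> p a l c h t = c * mittag_leffler \<alpha> 1 (- (\<mu> * (t powr p - a powr p) powr \<alpha>)) +
      1 / (p powr \<alpha> * Gamma \<alpha>) * ?V (abel \<alpha>) + - \<mu> / p powr \<alpha> * ?V ?k"
    unfolding time_factor_def Let_def ls 1 2 by simp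
  also have "\<dots> = c * mittag_leffler \<alpha> 1 (- (\<mu> * (t powr p - a powr p) powr \<alpha>)) +
      1 / p powr \<alpha> * (1 / Gamma \<alpha> * ?V (abel \<alpha>) - \<mu> * ?V ?k)"
    by (simp add: algebra_simps)
  finally show ?thesis
    unfolding volterra_resolvent_split[OF \<mu> h' powr_mem[OF p a t]] .
qed

lemma time_factor_continuous_on:
  assumes l: "0 < l" and h: "continuous_on {a..T} h"
  shows "continuous_on {a..T} (time_factor \<alpha> p a l c h)"
proof (rule continuous_on_eq[OF _ time_factor_eq_volterra[OF l h, symmetric]])
  have \<mu>: "0 \<le> l / p powr \<alpha>" using l p by simp
  have P: "continuous_on {a..T} (\<lambda>t. t powr p)"
    using p a by (intro continuous_on_powr' continuous_intros) auto
  have "continuous_on {a powr p..T powr p} (volterra (resolvent_kernel \<alpha> (l / p powr \<alpha>)) (a powr p) (\<lambda>s. h (s powr (1 / p))))"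
    by (intro volterra_continuous_on kernel_resolvent \<mu> pull_continuous_on p a h)
  then have V: "continuous_on {a..T} (\<lambda>t. volterra (resolvent_kernel \<alpha> (l / p powr \<alpha>)) (a powr p) (\<lambda>s. h (s powr (1 / p))) (t powr p))"
    by (rule continuous_on_compose2[OF _ P]) (use powr_mem[OF p a] in blast)
  have "continuous_on {a..T} (\<lambda>t. (t powr p - a powr p) powr \<alpha>)"
    using \<alpha> powr_mem[OF p a] by (intro continuous_on_powr' continuous_intros P) auto
  then show "continuous_on {a..T} (\<lambda>t. c * mittag_leffler \<alpha> 1 (- (l / p powr \<alpha> * (t powr p - a powr p) powr \<alpha>)) +
      1 / p powr \<alpha> * volterra (resolvent_kernel \<alpha> (l / p powr \<alpha>)) (a powr p) (\<lambda>s. h (s powr (1 / p))) (t powr p))"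
    by (intro continuous_on_add continuous_on_mult continuous_on_const mittag_leffler_continuous_on
        continuous_on_minus V \<alpha>) auto
qed

text \<open>In operator notation \<open>U = c - \<mu> c R 1 + p\<^sup>-\<^sup>\<alpha> R H\<close>. Substituting \<open>R = J - \<mu> J R\<close> in both terms and
  collecting gives \<open>U = c + p\<^sup>-\<^sup>\<alpha> J H - \<mu> J U\<close>, and \<open>\<mu> = l p\<^sup>-\<^sup>\<alpha>\<close>.\<close>

lemma time_factor_equation:
  assumes l: "0 < l" and h: "continuous_on {a..T} h" and t: "t \<in> {a..T}"
  shows "time_factor \<alpha> p a l c h t = c + 1 / p powr \<alpha> * (1 / Gamma \<alpha> *
    volterra (abel \<alpha>) (a powr p)
      (\<lambda>s. h (s powr (1 / p)) - l * time_factor \<alpha> p a l c h (s powr (1 / p))) (t powr p))"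
proof -
  define A where "A = a powr p"
  define B where "B = T powr p"
  define \<mu> where "\<mu> = l / p powr \<alpha>"
  have \<mu>: "0 < \<mu>" using l p by (simp add: \<mu>_def)
  define H where "H s = h (s powr (1 / p))" for s
  define U where "U s = time_factor \<alpha> p a l c h (s powr (1 / p))" for s
  define J where "J g x = 1 / Gamma \<alpha> * volterra (abel \<alpha>) A g x" for g x
  define R where "R g x = volterra (resolvent_kernel \<alpha> \<mu>) A g x" for g x
  have H: "continuous_on {A..B} H"
    unfolding H_def A_def B_def by (rule pull_continuous_on[OF p a h])
  have R_cont: "continuous_on {A..B} (R g)" if "continuous_on {A..B} g" for g
    unfolding R_def using that \<mu> by (intro volterra_continuous_on kernel_resolvent) auto
  have one: "continuous_on {A..B} (\<lambda>_. 1 :: real)" by (rule continuous_on_const)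
  have k: "kernel (B - A) (abel \<alpha>)" using \<alpha> by (intro kernel_powr)
  have J_add: "J (\<lambda>s. g s + g' s) x = J g x + J g' x" if "continuous_on {A..B} g" "continuous_on {A..B} g'" "x \<in> {A..B}" for g g' x
    unfolding J_def using volterra_add[OF k that] by (simp add: distrib_left)
  have J_mult: "J (\<lambda>s. d * g s) x = d * J g x" for d g x
    unfolding J_def volterra_mult by simp
  have res: "R g x = J g x - \<mu> * J (R g) x" if "continuous_on {A..B} g" "x \<in> {A..B}" for g x
    using resolvent_equation[OF \<mu> that] by (simp add: R_def[abs_def] J_def)
  have U_eq: "U s = c + (- (\<mu> * c)) * R (\<lambda>_. 1) s + 1 / p powr \<alpha> * R H s" if s: "s \<in> {A..B}" for s
  proof -
    have s': "s powr (1 / p) \<in> {a..T}" "(s powr (1 / p)) powr p = s"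
      using root_mem[OF p a] s p order_trans[OF powr_ge_zero, of a p s] by (auto simp: A_def B_def powr_powr)
    have E: "mittag_leffler \<alpha> 1 (- (l / p powr \<alpha> * (s - a powr p) powr \<alpha>)) = 1 - \<mu> * R (\<lambda>_. 1) s"
      using mittag_leffler_eq_volterra[OF \<mu> s] by (simp add: R_def A_def \<mu>_def)
    show ?thesis
      unfolding U_def time_factor_eq_volterra[OF l h s'(1)] s'(2) E
      by (simp add: R_def H_def[abs_def] A_def \<mu>_def algebra_simps)
  qed
  define x where "x = t powr p"
  have x: "x \<in> {A..B}" unfolding x_def A_def B_def by (rule powr_mem[OF p a t])
  have U_cont: "continuous_on {A..B} U"
    by (rule continuous_on_eq[OF _ U_eq[symmetric]]) (intro continuous_intros R_cont H one)
  have "J U x = J (\<lambda>s. c * 1 + ((- (\<mu> * c)) * R (\<lambda>_. 1) s + 1 / p powr \<alpha> * R H s)) x"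
    unfolding J_def using U_eq x by (intro arg_cong[where f = "\<lambda>z. _ * z"] volterra_cong) auto
  also have "\<dots> = J (\<lambda>s. c * 1) x + (J (\<lambda>s. (- (\<mu> * c)) * R (\<lambda>_. 1) s) x + J (\<lambda>s. 1 / p powr \<alpha> * R H s) x)"
    by (subst J_add[OF _ _ x], (intro continuous_intros R_cont H one)+)+ (rule refl)
  finally have JU: "J U x = c * J (\<lambda>_. 1) x - \<mu> * c * J (R (\<lambda>_. 1)) x + 1 / p powr \<alpha> * J (R H) x"
    unfolding J_mult by simp
  have "J (\<lambda>s. H s + (- l) * U s) x = J H x + J (\<lambda>s. (- l) * U s) x"
    by (rule J_add[OF _ _ x]) (intro continuous_intros H U_cont)+
  then have JHU: "J (\<lambda>s. H s - l * U s) x = J H x - l * J U x"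
    unfolding J_mult by simp
  have "U x = c - \<mu> * c * (J (\<lambda>_. 1) x - \<mu> * J (R (\<lambda>_. 1)) x) + 1 / p powr \<alpha> * (J H x - \<mu> * J (R H) x)"
    using U_eq[OF x] res[OF one x] res[OF H x] by simp
  also have "\<dots> = c + 1 / p powr \<alpha> * J (\<lambda>s. H s - l * U s) x"
    unfolding JHU JU by (simp add: \<mu>_def algebra_simps)
  finally show ?thesis
    by (simp add: U_def[abs_def] H_def[abs_def] J_def x_def A_def root_powr[OF p a t])
qed

text \<open>The constant does not depend on the eigenvalue \<open>l\<close>, since the resolvent kernel is dominated by
  the Abel kernel. One constant serves both as a factor and as a bound for the mass of the Abel kernel.\<close>

lemma time_factor_square_le:
  obtains K where "0 < K" "\<And>l c h t. \<lbrakk>0 < l; continuous_on {a..T} h; t \<in> {a..T}\<rbrakk> \<Longrightarrow>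
    (time_factor \<alpha> p a l c h t)\<^sup>2 \<le> 2 * c\<^sup>2 +
      K * volterra (\<lambda>s. 1 / Gamma \<alpha> * s powr (\<alpha> - 1)) (a powr p) (\<lambda>s. (h (s powr (1 / p)))\<^sup>2) (t powr p)"
    "\<And>t. t \<in> {a..T} \<Longrightarrow> volterra (\<lambda>s. 1 / Gamma \<alpha> * s powr (\<alpha> - 1)) (a powr p) (\<lambda>_. 1) (t powr p) \<le> K"
proof -
  define k where "k s = 1 / Gamma \<alpha> * s powr (\<alpha> - 1)" for s
  let ?A = "a powr p" and ?B = "T powr p"
  have k: "kernel (?B - ?A) k" unfolding k_def using \<alpha> by (intro kernel_mult kernel_powr)
  have k0: "0 \<le> k s" for s using Gamma_alpha_pos by (simp add: k_def)
  \<comment> \<open>The summand \<open>1\<close> makes the bound positive.\<close>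
  define K0 where "K0 = (LINT s:{0..?B - ?A}|lborel. \<bar>k s\<bar>) + 1"
  have K0: "1 \<le> K0" unfolding K0_def set_lebesgue_integral_def by (simp add: integral_nonneg_AE)
  have kK: "volterra k ?A (\<lambda>_. 1) (t powr p) \<le> K0" if "t \<in> {a..T}" for t
    using volterra_abs_le[OF k continuous_on_const powr_mem[OF p a that], of 1 1] by (simp add: K0_def)
  define q where "q = 1 / p powr \<alpha>"
  define K where "K = 2 * q\<^sup>2 * K0 + K0"
  have "(time_factor \<alpha> p a l c h t)\<^sup>2 \<le> 2 * c\<^sup>2 + K * volterra k ?A (\<lambda>s. (h (s powr (1 / p)))\<^sup>2) (t powr p)"
    if l: "0 < l" and h: "continuous_on {a..T} h" and t: "t \<in> {a..T}" for l c h t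
  proof -
    define \<mu> where "\<mu> = l / p powr \<alpha>"
    have \<mu>: "0 \<le> \<mu>" using l p by (simp add: \<mu>_def)
    define e where "e = mittag_leffler \<alpha> 1 (- (\<mu> * (t powr p - ?A) powr \<alpha>))"
    have e: "0 \<le> e" "e \<le> 1"
      using mittag_leffler_bounds[of \<alpha> 1 "\<mu> * (t powr p - ?A) powr \<alpha>"] \<alpha> \<mu> by (auto simp: e_def)
    define V where "V = volterra (resolvent_kernel \<alpha> \<mu>) ?A (\<lambda>s. h (s powr (1 / p))) (t powr p)"
    define Q where "Q = volterra k ?A (\<lambda>s. (h (s powr (1 / p)))\<^sup>2) (t powr p)"
    have Q0: "0 \<le> Q"
      unfolding Q_def volterra_def set_lebesgue_integral_def by (intro integral_nonneg_AE) (auto simp: k0)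
    have V: "V\<^sup>2 \<le> K0 * Q"
      unfolding V_def Q_def using resolvent_kernel_bound[OF \<mu>] K0
      by (intro volterra_square_le[OF kernel_resolvent[OF \<mu>] k k0 _ pull_continuous_on[OF p a h] powr_mem[OF p a t] _ kK[OF t]])
        (auto simp: k_def)
    have "time_factor \<alpha> p a l c h t = c * e + q * V"
      unfolding time_factor_eq_volterra[OF l h t] by (simp add: e_def V_def q_def \<mu>_def)
    then have "(time_factor \<alpha> p a l c h t)\<^sup>2 \<le> 2 * (c * e)\<^sup>2 + 2 * (q * V)\<^sup>2"
      using zero_le_power2[of "c * e - q * V"] by (simp add: power2_eq_square algebra_simps)
    also have "(c * e)\<^sup>2 \<le> c\<^sup>2"
    proof -
      have "e\<^sup>2 \<le> 1" using e by (simp add: power_le_one)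
      then have "c\<^sup>2 * e\<^sup>2 \<le> c\<^sup>2 * 1" by (intro mult_left_mono) auto
      then show ?thesis by (simp add: power_mult_distrib)
    qed
    also have "(q * V)\<^sup>2 \<le> q\<^sup>2 * (K0 * Q)"
      unfolding power_mult_distrib using V by (intro mult_left_mono) auto
    finally have "(time_factor \<alpha> p a l c h t)\<^sup>2 \<le> 2 * c\<^sup>2 + 2 * (q\<^sup>2 * (K0 * Q))" by simp
    also have "\<dots> \<le> 2 * c\<^sup>2 + K * Q"
      using K0 Q0 by (simp add: K_def algebra_simps)
    finally show ?thesis by (simp add: Q_def)
  qed
  moreover have "0 < K" using K0 by (simp add: K_def add_nonneg_pos)
  moreover have "K0 \<le> K" using K0 by (simp add: K_def)
  ultimately show ?thesis using that[of K] kK unfolding k_def by (meson order_trans)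
qed

end

end

lemma time_factor_scale:
  "d * time_factor \<alpha> p a l c h t = time_factor \<alpha> p a l (d * c) (\<lambda>\<tau>. d * h \<tau>) t"
proof -
  have 1: "(\<lambda>\<tau>. w \<tau> * (d * h \<tau>) * z \<tau>) = (\<lambda>\<tau>. d * (w \<tau> * h \<tau> * z \<tau>))" for w z :: "real \<Rightarrow> real"
    by (simp add: fun_eq_iff)
  show ?thesis
    unfolding time_factor_def Let_def 1 set_integral_mult_right by (simp add: algebra_simps)
qed

lemma time_factor_cong:
  assumes "\<And>\<tau>. \<tau> \<in> {a..t} \<Longrightarrow> h \<tau> = g \<tau>"
  shows "time_factor \<alpha> p a l c h t = time_factor \<alpha> p a l c g t"
proof -
  have "(LINT \<tau>:{a..t}|lebesgue. w \<tau> * h \<tau> * z \<tau>) = (LINT \<tau>:{a..t}|lebesgue. w \<tau> * g \<tau> * z \<tau>)" for w z :: "real \<Rightarrow> real"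
    by (intro set_lebesgue_integral_cong) (auto simp: assms)
  then show ?thesis unfolding time_factor_def Let_def by simp
qed

section \<open>The hyper-Bessel derivative of a fractional integral\<close>

context
  fixes \<alpha> p a T :: real
  assumes \<alpha>: "0 < \<alpha>" "\<alpha> < 1" and p: "0 < p" and a: "0 \<le> a" "a < T"
begin

lemma EK_integral_eq_volterra:
  assumes u: "continuous_on {a..T} u" and t: "t \<in> {a..T}"
  shows "EK_integral 0 (1 - \<alpha>) p a u t = t powr (- p * (1 - \<alpha>)) / Gamma (1 - \<alpha>) *
    volterra (\<lambda>s. s powr (- \<alpha>)) (a powr p) (\<lambda>s. u (s powr (1 / p))) (t powr p)"
proof -
  have k: "kernel L (\<lambda>s. s powr (- \<alpha>))" for L
    using kernel_powr[of "1 - \<alpha>" L] \<alpha> by simp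
  have "(LINT \<tau>:{a..t}|lebesgue. (t powr p - \<tau> powr p) powr ((1 - \<alpha>) - 1) * \<tau> powr (p * 0) * u \<tau> * (p * \<tau> powr (p - 1))) =
      (LINT \<tau>:{a..t}|lebesgue. (t powr p - \<tau> powr p) powr (- \<alpha>) * u \<tau> * (p * \<tau> powr (p - 1)))"
    by (intro set_lebesgue_integral_cong) auto
  also have "\<dots> = volterra (\<lambda>s. s powr (- \<alpha>)) (a powr p) (\<lambda>s. u (s powr (1 / p))) (t powr p)"
    by (rule volterra_change_of_variables[OF p a(1) t k pull_continuous_on[OF p a u]])
  finally show ?thesis by (simp add: EK_integral_def)
qed

text \<open>Applied to \<open>u = c + p\<^sup>-\<^sup>\<alpha> J\<^sup>\<alpha> F\<close>, the integral of order \<open>1 - \<alpha>\<close> is \<open>t\<^sup>-\<^sup>p\<^sup>(\<^sup>1\<^sup>-\<^sup>\<alpha>\<^sup>) Q(t\<^sup>p)\<close>, where \<open>Q\<close> is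
  the sum of a power and of the primitive of \<open>F\<close> in the variable \<open>t\<^sup>p\<close>. In the operator
  \<open>(1 - \<alpha>) + (t / p) d/dt\<close> the derivative of the outer power cancels the first summand. What remains
  of \<open>c\<close> is exactly the term which the Caputo-like regularization subtracts.\<close>

lemma
  assumes F: "continuous_on {a..T} F" and u_cont: "continuous_on {a..T} u"
    and u: "\<And>t. t \<in> {a..T} \<Longrightarrow> u t = c + 1 / p powr \<alpha> * (1 / Gamma \<alpha> *
      volterra (abel \<alpha>) (a powr p) (\<lambda>s. F (s powr (1 / p))) (t powr p))"
    and t: "a < t" "t \<le> T"
  shows volterra_imp_EK_differentiable: "EK_differentiable \<alpha> p a T u t"
    and caputo_hyper_Bessel_volterra: "caputo_hyper_Bessel \<alpha> p a T u t = F t"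
proof -
  define A B where "A = a powr p" and "B = T powr p"
  define G where "G s = F (s powr (1 / p))" for s
  define q where "q = 1 / p powr \<alpha>"
  define Q where "Q P = c * ((P - A) powr (1 - \<alpha>) / (1 - \<alpha>)) / Gamma (1 - \<alpha>) + q * integral {A..P} G" for P
  have G\<alpha>: "Gamma \<alpha> \<noteq> 0" "Gamma (1 - \<alpha>) \<noteq> 0"
    using Gamma_real_pos[of \<alpha>] Gamma_real_pos[of "1 - \<alpha>"] \<alpha> by (metis less_irrefl diff_gt_0_iff_gt)+
  have G: "continuous_on {A..B} G"
    unfolding G_def A_def B_def by (rule pull_continuous_on[OF p a F])
  have k: "kernel (B - A) (abel \<alpha>)" "kernel (B - A) (\<lambda>s. s powr (- \<alpha>))"
    using kernel_powr[of "1 - \<alpha>" "B - A"] kernel_powr[of \<alpha> "B - A"] \<alpha> by simp_all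
  have EK: "EK_integral 0 (1 - \<alpha>) p a u s = s powr (- p * (1 - \<alpha>)) * Q (s powr p)" if s: "s \<in> {a..T}" for s
  proof -
    have P: "s powr p \<in> {A..B}" unfolding A_def B_def by (rule powr_mem[OF p a s])
    let ?J = "volterra (abel \<alpha>) A G"
    have "u (y powr (1 / p)) = c * 1 + q * (1 / Gamma \<alpha>) * ?J y" if y: "y \<in> {A..s powr p}" for y
    proof -
      have y': "y \<in> {A..B}" using y P by auto
      then have r: "y powr (1 / p) \<in> {a..T}" unfolding A_def B_def by (rule root_mem[OF p a])
      have "A \<le> y" using y by simp
      then have "0 \<le> y" unfolding A_def by (rule order_trans[OF powr_ge_zero])
      then have "(y powr (1 / p)) powr p = y" using p by (simp add: powr_powr)
      then show ?thesis using u[OF r] by (simp add: q_def A_def G_def[abs_def])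
    qed
    then have "volterra (\<lambda>s. s powr (- \<alpha>)) A (\<lambda>y. u (y powr (1 / p))) (s powr p) =
        volterra (\<lambda>s. s powr (- \<alpha>)) A (\<lambda>y. c * 1 + q * (1 / Gamma \<alpha>) * ?J y) (s powr p)"
      by (rule volterra_cong)
    also have "\<dots> = volterra (\<lambda>s. s powr (- \<alpha>)) A (\<lambda>y. c * 1) (s powr p) +
        volterra (\<lambda>s. s powr (- \<alpha>)) A (\<lambda>y. q * (1 / Gamma \<alpha>) * ?J y) (s powr p)"
      by (rule volterra_add[OF k(2) _ _ P]) (intro continuous_intros volterra_continuous_on k G)+
    also have "\<dots> = c * ((s powr p - A) powr (1 - \<alpha>) / (1 - \<alpha>)) +
        q * (1 / Gamma \<alpha>) * (Gamma (1 - \<alpha>) * Gamma \<alpha> * integral {A..s powr p} G)"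
      unfolding volterra_mult volterra_powr_const[OF \<alpha> P] volterra_powr_powr[OF \<alpha> G P] ..
    also have "\<dots> = Gamma (1 - \<alpha>) * Q (s powr p)"
      using G\<alpha> by (simp add: Q_def distrib_left)
    finally show ?thesis
      unfolding EK_integral_eq_volterra[OF u_cont s] using G\<alpha> by (simp add: A_def)
  qed
  have t': "t \<in> {a..T}" and t0: "0 < t" using t a by auto
  define P where "P = t powr p"
  have P: "A < P" "P \<le> B"
    unfolding A_def B_def P_def using t a p by (auto intro!: powr_less_mono2 powr_mono2)
  define D where "D = c * (P - A) powr (- \<alpha>) / Gamma (1 - \<alpha>) + q * F t"
  have GP: "G P = F t" using root_powr[OF p a t'] by (simp add: G_def P_def)
  have dQ: "(Q has_field_derivative D) (at P within {A..B})"
  proof -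
    have "((\<lambda>P. integral {A..P} G) has_real_derivative F t) (at P within {A..B})"
      using integral_has_real_derivative[OF G, of P] P by (simp add: GP)
    moreover have "((\<lambda>P. (P - A) powr (1 - \<alpha>)) has_real_derivative (1 - \<alpha>) * (P - A) powr (1 - \<alpha> - 1)) (at P within {A..B})"
      using P by (auto intro!: derivative_eq_intros)
    ultimately have "(Q has_field_derivative (c * ((1 - \<alpha>) * (P - A) powr (1 - \<alpha> - 1) / (1 - \<alpha>)) / Gamma (1 - \<alpha>) + q * F t)) (at P within {A..B})"
      unfolding Q_def by (intro DERIV_add DERIV_cmult DERIV_cdivide)
    then show ?thesis using \<alpha> by (simp add: D_def)
  qed
  have dP: "((\<lambda>t. t powr p) has_real_derivative p * t powr (p - 1)) (at t within {a..T})"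
    using t0 by (intro has_real_derivative_powr[THEN has_field_derivative_at_within])
  have dQP: "((\<lambda>t. Q (t powr p)) has_real_derivative D * (p * t powr (p - 1))) (at t within {a..T})"
  proof -
    have "(\<lambda>t. t powr p) ` {a..T} \<subseteq> {A..B}"
      using powr_mem[OF p a] unfolding A_def B_def by blast
    then have "(Q has_field_derivative D) (at (t powr p) within (\<lambda>t. t powr p) ` {a..T})"
      using has_field_derivative_subset[OF dQ] by (simp add: P_def)
    from DERIV_image_chain[OF this dP] show ?thesis by (simp add: o_def)
  qed
  let ?E = "t powr (- p * (1 - \<alpha>))"
  define D' where "D' = (- p * (1 - \<alpha>)) * t powr (- p * (1 - \<alpha>) - 1) * Q P + D * (p * t powr (p - 1)) * ?E"
  have "((\<lambda>t. t powr (- p * (1 - \<alpha>)) * Q (t powr p)) has_real_derivative D') (at t within {a..T})"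
    unfolding D'_def P_def using t0
    by (intro DERIV_mult dQP has_real_derivative_powr[THEN has_field_derivative_at_within])
  then have der: "(EK_integral 0 (1 - \<alpha>) p a u has_real_derivative D') (at t within {a..T})"
    by (rule has_field_derivative_transform_within[OF _ zero_less_one t']) (simp add: EK)
  then show "EK_differentiable \<alpha> p a T u t"
    unfolding EK_differentiable_def by (auto simp: real_differentiable_def)
  have vd: "vector_derivative (EK_integral 0 (1 - \<alpha>) p a u) (at t within {a..T}) = D'"
    using der by (intro vector_derivative_within_closed_interval[OF a(2) t'])
      (simp add: has_real_derivative_iff_has_vector_derivative)
  have 1: "t * t powr (- p * (1 - \<alpha>) - 1) = ?E"
    using t0 powr_add[of t 1 "- p * (1 - \<alpha>) - 1"] by simp
  have 2: "t * t powr (p - 1) = t powr p"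
    using t0 powr_add[of t 1 "p - 1"] by simp
  have 3: "t powr (- p * \<alpha>) * (t powr p * ?E) = 1"
  proof -
    have "t powr (- p * \<alpha>) * (t powr p * ?E) = t powr (- p * \<alpha> + (p + - p * (1 - \<alpha>)))"
      by (simp only: powr_add)
    also have "- p * \<alpha> + (p + - p * (1 - \<alpha>)) = 0" by (simp add: algebra_simps)
    finally show ?thesis using t0 by simp
  qed
  have "t / p * D' = - (1 - \<alpha>) * (t * t powr (- p * (1 - \<alpha>) - 1)) * Q P + D * (t * t powr (p - 1)) * ?E"
    using p unfolding D'_def by (simp add: field_simps)
  then have "EK_derivative \<alpha> p a T u t = D * (t powr p * ?E)"
    unfolding EK_derivative_def vd EK[OF t'] 1 2 by (simp add: P_def algebra_simps)
  then have "hyper_Bessel_derivative \<alpha> p a T u t = p powr \<alpha> * D * (t powr (- p * \<alpha>) * (t powr p * ?E))"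
    unfolding hyper_Bessel_derivative_def by simp
  then have H: "hyper_Bessel_derivative \<alpha> p a T u t = p powr \<alpha> * D"
    unfolding 3 by simp
  have "u a = c" using u[of a] a by (simp add: volterra_initial)
  then show "caputo_hyper_Bessel \<alpha> p a T u t = F t"
    unfolding caputo_hyper_Bessel_def H D_def q_def using p
    by (simp add: P_def A_def algebra_simps)
qed

end

section \<open>The classical solution\<close>

lemma A_expr_cong:
  assumes eq: "\<And>y. y \<in> {0<..<1} \<Longrightarrow> g y = h y" and x: "x \<in> {0<..<1}"
  shows "A_expr \<beta> g x = A_expr \<beta> h x" "A_differentiable \<beta> g x \<longleftrightarrow> A_differentiable \<beta> h x"
proof -
  have ev: "\<forall>\<^sub>F z in nhds y. k z = l z" if "y \<in> {0<..<1}" "\<And>z. z \<in> {0<..<1} \<Longrightarrow> k z = l z"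
    for y :: real and k l :: "real \<Rightarrow> real"
    using eventually_nhds_in_open[OF open_greaterThanLessThan that(1)] by eventually_elim (rule that(2))
  have dv: "deriv k y = deriv l y" "k differentiable (at y) \<longleftrightarrow> l differentiable (at y)"
    if "y \<in> {0<..<1}" "\<And>z. z \<in> {0<..<1} \<Longrightarrow> k z = l z" for y and k l :: "real \<Rightarrow> real"
    using ev[OF that] DERIV_cong_ev[OF refl ev[OF that] refl]
    by (auto intro!: deriv_cong_ev simp: real_differentiable_def)
  have fl: "flux \<beta> g y = flux \<beta> h y" if "y \<in> {0<..<1}" for y
    unfolding flux_def using dv(1)[OF that eq] by simp
  show "A_expr \<beta> g x = A_expr \<beta> h x"
    unfolding A_expr_def using dv(1)[OF x fl] by simp
  show "A_differentiable \<beta> g x \<longleftrightarrow> A_differentiable \<beta> h x"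
    unfolding A_differentiable_def using dv(2)[OF x eq] dv(2)[OF x fl] by simp
qed

context degenerate_eigensystem
begin

lemma uniform_energy_tails_cong:
  assumes "uniform_energy_tails X c" "\<And>k t. t \<in> X \<Longrightarrow> c k t = d k t"
  shows "uniform_energy_tails X d"
  using assms unfolding uniform_energy_tails_def by simp

text \<open>The square of each time factor is bounded by its initial coefficient and a convolution of its
  squared source coefficient with one common nonnegative kernel; summation over \<open>k\<close> commutes with this
  convolution. The source tails thus enter with the factor \<open>K\<close> from the estimate and the factor \<open>K\<close>
  from the mass of the kernel, whence the choice of \<open>\<eta>\<close>.\<close>

lemma uniform_energy_tails_time_factor:
  assumes \<alpha>: "0 < \<alpha>" "\<alpha> < 1" and p: "0 < p" and a: "0 \<le> a" "a < T"
    and c: "uniform_energy_tails {a..T} (\<lambda>k t. c k)" and h: "uniform_energy_tails {a..T} h"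
    and hc: "\<And>k. continuous_on {a..T} (h k)"
  shows "uniform_energy_tails {a..T} (\<lambda>k. time_factor \<alpha> p a (lam k) (c k) (h k))"
  unfolding uniform_energy_tails_def
proof (intro allI impI)
  fix \<epsilon> :: real assume \<epsilon>: "0 < \<epsilon>"
  define \<kappa> where "\<kappa> s = 1 / Gamma \<alpha> * s powr (\<alpha> - 1)" for s
  let ?A = "a powr p" and ?B = "T powr p"
  define V where "V g t = volterra \<kappa> ?A (\<lambda>s. g (s powr (1 / p))) (t powr p)" for g and t :: real
  obtain K where K: "0 < K" and sq: "\<And>l c h t. \<lbrakk>0 < l; continuous_on {a..T} h; t \<in> {a..T}\<rbrakk> \<Longrightarrow>
      (time_factor \<alpha> p a l c h t)\<^sup>2 \<le> 2 * c\<^sup>2 + K * V (\<lambda>s. (h s)\<^sup>2) t"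
    and one: "\<And>t. t \<in> {a..T} \<Longrightarrow> V (\<lambda>_. 1) t \<le> K"
    using time_factor_square_le[OF \<alpha> p a] unfolding V_def \<kappa>_def by metis
  have \<kappa>: "kernel (?B - ?A) \<kappa>" unfolding \<kappa>_def using \<alpha> by (intro kernel_mult kernel_powr)
  have \<kappa>0: "0 \<le> \<kappa> s" for s using Gamma_real_pos[of \<alpha>] \<alpha> by (simp add: \<kappa>_def)
  define \<eta> where "\<eta> = \<epsilon> / (2 + K * K)"
  have \<eta>: "0 < \<eta>" using \<epsilon> K by (simp add: \<eta>_def add_pos_pos)
  from uniform_energy_tailsD[OF c \<eta>] obtain M where
    M: "\<forall>t\<in>{a..T}. \<forall>S. finite S \<longrightarrow> S \<subseteq> {M..} \<longrightarrow> (\<Sum>k\<in>S. lam k * (c k)\<^sup>2) \<le> \<eta>" ..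
  from uniform_energy_tailsD[OF h \<eta>] obtain N where
    N: "\<forall>t\<in>{a..T}. \<forall>S. finite S \<longrightarrow> S \<subseteq> {N..} \<longrightarrow> (\<Sum>k\<in>S. lam k * (h k t)\<^sup>2) \<le> \<eta>" ..
  show "\<exists>N. \<forall>t\<in>{a..T}. \<forall>S. finite S \<longrightarrow> S \<subseteq> {N..} \<longrightarrow>
      (\<Sum>k\<in>S. lam k * (time_factor \<alpha> p a (lam k) (c k) (h k) t)\<^sup>2) \<le> \<epsilon>"
  proof (intro exI[of _ "max M N"] ballI allI impI)
    fix t and S :: "nat set" assume t: "t \<in> {a..T}" and S: "finite S" "S \<subseteq> {max M N..}"
    have S': "S \<subseteq> {M..}" "S \<subseteq> {N..}" using S(2) by auto
    note P = powr_mem[OF p a t]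
    have hk: "continuous_on {?A..?B} (\<lambda>s. lam k * (h k (s powr (1 / p)))\<^sup>2)" for k
      by (intro continuous_intros pull_continuous_on[OF p a hc])
    have "(\<Sum>k\<in>S. lam k * (time_factor \<alpha> p a (lam k) (c k) (h k) t)\<^sup>2) \<le>
        (\<Sum>k\<in>S. 2 * (lam k * (c k)\<^sup>2) + K * V (\<lambda>s. lam k * (h k s)\<^sup>2) t)"
    proof (rule sum_mono)
      fix k
      have "lam k * (time_factor \<alpha> p a (lam k) (c k) (h k) t)\<^sup>2 \<le> lam k * (2 * (c k)\<^sup>2 + K * V (\<lambda>s. (h k s)\<^sup>2) t)"
        using lam_pos[of k] by (intro mult_left_mono sq hc t) auto
      then show "lam k * (time_factor \<alpha> p a (lam k) (c k) (h k) t)\<^sup>2 \<le>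
          2 * (lam k * (c k)\<^sup>2) + K * V (\<lambda>s. lam k * (h k s)\<^sup>2) t"
        unfolding V_def volterra_mult by (simp add: algebra_simps)
    qed
    also have "\<dots> = 2 * (\<Sum>k\<in>S. lam k * (c k)\<^sup>2) + K * V (\<lambda>s. \<Sum>k\<in>S. lam k * (h k s)\<^sup>2) t"
      unfolding V_def volterra_sum[OF \<kappa> hk P] by (simp add: sum.distrib sum_distrib_left)
    also have "\<dots> \<le> 2 * \<eta> + K * (\<eta> * K)"
    proof (intro add_mono mult_left_mono)
      show "(\<Sum>k\<in>S. lam k * (c k)\<^sup>2) \<le> \<eta>" using M t S S' by blast
      have "V (\<lambda>s. \<Sum>k\<in>S. lam k * (h k s)\<^sup>2) t \<le> V (\<lambda>s. \<eta> * 1) t"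
        unfolding V_def
      proof (rule volterra_mono[OF \<kappa> \<kappa>0 _ _ P])
        show "continuous_on {?A..?B} (\<lambda>s. \<Sum>k\<in>S. lam k * (h k (s powr (1 / p)))\<^sup>2)"
          by (intro continuous_on_sum hk)
        show "(\<Sum>k\<in>S. lam k * (h k (s powr (1 / p)))\<^sup>2) \<le> \<eta> * 1" if "s \<in> {?A..?B}" for s
          using N root_mem[OF p a that] S S' by simp
      qed (rule continuous_on_const)
      also have "\<dots> = \<eta> * V (\<lambda>_. 1) t" unfolding V_def volterra_mult ..
      also have "\<dots> \<le> \<eta> * K" using one[OF t] \<eta> by (intro mult_left_mono) auto
      finally show "V (\<lambda>s. \<Sum>k\<in>S. lam k * (h k s)\<^sup>2) t \<le> \<eta> * K" .
    qed (use K in auto)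
    also have "\<dots> = \<epsilon>"
    proof -
      have "2 + K * K > 0" using K by (simp add: add_pos_pos)
      then have "(2 + K * K) * \<eta> = \<epsilon>" by (simp add: \<eta>_def)
      then show ?thesis by (simp add: algebra_simps)
    qed
    finally show "(\<Sum>k\<in>S. lam k * (time_factor \<alpha> p a (lam k) (c k) (h k) t)\<^sup>2) \<le> \<epsilon>" .
  qed
qed

end

text \<open>\<open>\<psi>\<close> and \<open>g\<close> are representatives of \<open>A \<phi>\<close> and \<open>A f\<close>.\<close>

locale diffusion_problem = degenerate_eigensystem +
  fixes \<alpha> p a T :: real and \<phi> \<psi> :: "real \<Rightarrow> real" and f g :: "real \<Rightarrow> real \<Rightarrow> real"
  assumes \<alpha>: "0 < \<alpha>" "\<alpha> < 1" and p: "0 < p" and a: "0 \<le> a" "a < T"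
    and \<phi>: "W12_dot \<beta> \<phi>" "friedrichs_A \<beta> \<phi> \<psi>" and \<psi>: "W12_dot \<beta> \<psi>"
    and f: "C_W12_dot \<beta> a T f" and fg: "\<And>t. t \<in> {a..T} \<Longrightarrow> friedrichs_A \<beta> (\<lambda>x. f x t) (\<lambda>x. g x t)"
    and g: "C_W12_dot \<beta> a T g"
begin

definition source_coeff :: "nat \<Rightarrow> real \<Rightarrow> real" where
  "source_coeff k t = ip_01 (\<lambda>x. f x t) (v k)"

definition time_coeff :: "nat \<Rightarrow> real \<Rightarrow> real" where
  "time_coeff k = time_factor \<alpha> p a (lam k) (ip_01 \<phi> (v k)) (source_coeff k)"

definition u :: "real \<Rightarrow> real \<Rightarrow> real" where
  "u x t = (\<Sum>k. time_coeff k t * v k x)"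

definition Au :: "real \<Rightarrow> real \<Rightarrow> real" where
  "Au x t = (\<Sum>k. lam k * time_coeff k t * v k x)"

text \<open>The sum of the time derivatives of the terms of \<open>u\<close>, by the integral equation for the time
  factors.\<close>

definition Dt_u :: "real \<Rightarrow> real \<Rightarrow> real" where
  "Dt_u x t = (\<Sum>k. (source_coeff k t - lam k * time_coeff k t) * v k x)"

lemma source_coeff_continuous: "continuous_on {a..T} (source_coeff k)"
  unfolding source_coeff_def by (rule C_W12_dot_continuous[OF f])

lemma source_coeff_uniform_energy_tails: "uniform_energy_tails {a..T} source_coeff"
  using uniform_energy_tails_C_W12_dot[OF f] by (simp add: source_coeff_def[abs_def])

lemma time_coeff_continuous: "continuous_on {a..T} (time_coeff k)"
  unfolding time_coeff_def by (rule time_factor_continuous_on[OF \<alpha> p a lam_pos source_coeff_continuous])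

lemma W12_dot_uniform_energy_tails: "W12_dot \<beta> \<omega> \<Longrightarrow> uniform_energy_tails X (\<lambda>k t. ip_01 \<omega> (v k))"
  using W12_dot_boundary[OF beta, of \<omega>] by (intro uniform_energy_tails_W12 W12_dot_imp_W12) auto

lemma time_coeff_uniform_energy_tails: "uniform_energy_tails {a..T} time_coeff"
  using uniform_energy_tails_time_factor[OF \<alpha> p a W12_dot_uniform_energy_tails[OF \<phi>(1)] source_coeff_uniform_energy_tails source_coeff_continuous]
  by (simp add: time_coeff_def[abs_def])

text \<open>Multiplication by \<open>lam k\<close> replaces the data \<open>\<phi>\<close>, \<open>f\<close> by \<open>A \<phi>\<close>, \<open>A f\<close>. This is what makes the
  series of \<open>A u\<close> converge by the same argument as the series of \<open>u\<close>.\<close>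

lemma lam_time_coeff:
  assumes t: "t \<in> {a..T}"
  shows "lam k * time_coeff k t = time_factor \<alpha> p a (lam k) (ip_01 \<psi> (v k)) (\<lambda>\<tau>. ip_01 (\<lambda>x. g x \<tau>) (v k)) t"
proof -
  have "lam k * ip_01 \<phi> (v k) = ip_01 \<psi> (v k)"
    by (intro friedrichs_coefficient \<phi> W12_continuous_on[of \<beta>] W12_dot_imp_W12 \<psi>)
  moreover have "lam k * source_coeff k \<tau> = ip_01 (\<lambda>x. g x \<tau>) (v k)" if "\<tau> \<in> {a..T}" for \<tau>
    unfolding source_coeff_def using that by (intro friedrichs_coefficient fg C_W12_dotD(3)[OF g])
  ultimately show ?thesis
    unfolding time_coeff_def time_factor_scale using t by (auto intro!: time_factor_cong)
qed

lemma lam_time_coeff_uniform_energy_tails: "uniform_energy_tails {a..T} (\<lambda>k t. lam k * time_coeff k t)"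
  by (rule uniform_energy_tails_cong[OF uniform_energy_tails_time_factor[OF \<alpha> p a W12_dot_uniform_energy_tails[OF \<psi>]
        uniform_energy_tails_C_W12_dot[OF g] C_W12_dot_continuous[OF g]]])
    (simp add: lam_time_coeff)

lemma Dt_u_uniform_energy_tails: "uniform_energy_tails {a..T} (\<lambda>k t. source_coeff k t - lam k * time_coeff k t)"
  by (rule uniform_energy_tails_diff[OF source_coeff_uniform_energy_tails lam_time_coeff_uniform_energy_tails])

lemma u_summable: "x \<in> {0..1} \<Longrightarrow> t \<in> {a..T} \<Longrightarrow> summable (\<lambda>k. time_coeff k t * v k x)"
  by (rule eigen_series_uniform(2)[OF time_coeff_uniform_energy_tails])

lemma u_continuous: "continuous_on ({0..1} \<times> {a..T}) (\<lambda>(x, t). u x t)"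
  unfolding u_def by (rule eigen_series_continuous_on[OF time_coeff_uniform_energy_tails time_coeff_continuous])

lemma Au_continuous: "continuous_on ({0..1} \<times> {a..T}) (\<lambda>(x, t). Au x t)"
  unfolding Au_def
  by (rule eigen_series_continuous_on[OF lam_time_coeff_uniform_energy_tails]) (intro continuous_intros time_coeff_continuous)

lemma Dt_u_continuous: "continuous_on ({0..1} \<times> {a..T}) (\<lambda>(x, t). Dt_u x t)"
  unfolding Dt_u_def
  by (rule eigen_series_continuous_on[OF Dt_u_uniform_energy_tails]) (intro continuous_intros time_coeff_continuous source_coeff_continuous)

lemma slice_continuous:
  assumes "continuous_on ({0..1} \<times> {a..T}) (\<lambda>(x, t). h x t)" "x \<in> {0..1}"
  shows "continuous_on {a..T} (h x)"
proof -
  have "continuous_on {a..T} (\<lambda>t. (\<lambda>(x, t). h x t) (x, t))"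
    by (rule continuous_on_compose2[OF assms(1)]) (use assms(2) in \<open>auto intro!: continuous_intros\<close>)
  then show ?thesis by simp
qed

lemma Dt_u_eq:
  assumes x: "x \<in> {0..1}" and t: "t \<in> {a..T}"
  shows "Dt_u x t = f x t - Au x t"
proof -
  have "Dt_u x t = (\<Sum>k. source_coeff k t * v k x - lam k * time_coeff k t * v k x)"
    by (simp add: Dt_u_def left_diff_distrib)
  also have "\<dots> = (\<Sum>k. source_coeff k t * v k x) - Au x t"
    unfolding Au_def
    by (intro suminf_diff[symmetric] eigen_series_uniform(2)[OF source_coeff_uniform_energy_tails x t]
        eigen_series_uniform(2)[OF lam_time_coeff_uniform_energy_tails x t])
  also have "(\<Sum>k. source_coeff k t * v k x) = f x t"
    unfolding source_coeff_def by (rule expansion[OF C_W12_dotD(1)[OF f t] x])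
  finally show ?thesis .
qed

text \<open>The integral equations of the time factors are summed. The series of \<open>Dt_u\<close> converges uniformly
  in time, so it may be exchanged with the fractional integral.\<close>

lemma u_volterra:
  assumes x: "x \<in> {0..1}" and t: "t \<in> {a..T}"
  shows "u x t = \<phi> x + 1 / p powr \<alpha> * (1 / Gamma \<alpha> *
    volterra (abel \<alpha>) (a powr p) (\<lambda>s. Dt_u x (s powr (1 / p))) (t powr p))"
proof -
  let ?A = "a powr p" and ?B = "T powr p"
  let ?J = "volterra (abel \<alpha>) ?A"
  note P = powr_mem[OF p a t]
  define d where "d k s = source_coeff k (s powr (1 / p)) - lam k * time_coeff k (s powr (1 / p))" for k s
  have d: "continuous_on {?A..?B} (d k)" for k
    unfolding d_def by (intro continuous_intros pull_continuous_on[OF p a source_coeff_continuous] pull_continuous_on[OF p a time_coeff_continuous])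
  have k: "kernel (?B - ?A) (abel \<alpha>)" using \<alpha> by (intro kernel_powr)
  have lim: "uniform_limit {?A..?B} (\<lambda>n s. \<Sum>k<n. d k s * v k x) (\<lambda>s. Dt_u x (s powr (1 / p))) sequentially"
    using uniform_limit_compose'[OF eigen_series_uniform(1)[OF Dt_u_uniform_energy_tails], of "\<lambda>s. (x, s powr (1 / p))" "{?A..?B}"]
      x root_mem[OF p a] by (auto simp: d_def Dt_u_def)
  have dv: "continuous_on {?A..?B} (\<lambda>s. d k s * v k x)" for k by (intro continuous_intros d)
  have "(\<lambda>n. ?J (\<lambda>s. \<Sum>k<n. d k s * v k x) (t powr p)) \<longlonglongrightarrow> ?J (\<lambda>s. Dt_u x (s powr (1 / p))) (t powr p)"
    by (rule volterra_uniform_limit[OF k _ lim P]) (intro continuous_on_sum dv)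
  moreover have "(\<lambda>n. \<Sum>k<n. ip_01 \<phi> (v k) * v k x) \<longlonglongrightarrow> \<phi> x"
    using summable_LIMSEQ[OF eigen_series_uniform(2)[OF W12_dot_uniform_energy_tails[OF \<phi>(1), of "UNIV :: unit set"] x UNIV_I]]
    by (simp add: expansion[OF \<phi>(1) x])
  ultimately have "(\<lambda>n. (\<Sum>k<n. ip_01 \<phi> (v k) * v k x) + 1 / p powr \<alpha> * (1 / Gamma \<alpha> *
      ?J (\<lambda>s. \<Sum>k<n. d k s * v k x) (t powr p))) \<longlonglongrightarrow>
      \<phi> x + 1 / p powr \<alpha> * (1 / Gamma \<alpha> * ?J (\<lambda>s. Dt_u x (s powr (1 / p))) (t powr p))"
    by (intro tendsto_intros)
  moreover have "(\<Sum>k<n. time_coeff k t * v k x) = (\<Sum>k<n. ip_01 \<phi> (v k) * v k x) + 1 / p powr \<alpha> * (1 / Gamma \<alpha> *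
      ?J (\<lambda>s. \<Sum>k<n. d k s * v k x) (t powr p))" for n
  proof -
    have "time_coeff k t * v k x = ip_01 \<phi> (v k) * v k x + 1 / p powr \<alpha> * (1 / Gamma \<alpha> * ?J (\<lambda>s. d k s * v k x) (t powr p))" for k
    proof -
      have "time_coeff k t = ip_01 \<phi> (v k) + 1 / p powr \<alpha> * (1 / Gamma \<alpha> * ?J (d k) (t powr p))"
        using time_factor_equation[OF \<alpha> p a lam_pos source_coeff_continuous t] by (simp add: time_coeff_def d_def[abs_def])
      moreover have "?J (\<lambda>s. d k s * v k x) (t powr p) = v k x * ?J (d k) (t powr p)"
        using volterra_mult[of _ _ "v k x" "d k"] by (simp add: mult.commute)
      ultimately show ?thesis by (simp add: algebra_simps)
    qed
    then show ?thesis
      by (simp add: volterra_sum[OF k dv P] sum.distrib sum_distrib_left)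
  qed
  ultimately have "(\<lambda>n. \<Sum>k<n. time_coeff k t * v k x) \<longlonglongrightarrow>
      \<phi> x + 1 / p powr \<alpha> * (1 / Gamma \<alpha> * ?J (\<lambda>s. Dt_u x (s powr (1 / p))) (t powr p))"
    by simp
  then show ?thesis
    unfolding u_def using summable_LIMSEQ[OF u_summable[OF x t]] LIMSEQ_unique by blast
qed

lemma u_initial:
  assumes x: "x \<in> {0..1}"
  shows "u x a = \<phi> x"
  using u_volterra[OF x, of a] a by (simp add: volterra_initial)

lemma u_time_derivative:
  assumes x: "x \<in> {0..1}" and t: "a < t" "t \<le> T"
  shows "EK_differentiable \<alpha> p a T (u x) t" "caputo_hyper_Bessel \<alpha> p a T (u x) t = Dt_u x t"
proof -
  note cont = slice_continuous[OF Dt_u_continuous x] slice_continuous[OF u_continuous x]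
  show "EK_differentiable \<alpha> p a T (u x) t"
    by (rule volterra_imp_EK_differentiable[OF \<alpha> p a cont u_volterra[OF x] t])
  show "caputo_hyper_Bessel \<alpha> p a T (u x) t = Dt_u x t"
    by (rule caputo_hyper_Bessel_volterra[OF \<alpha> p a cont u_volterra[OF x] t])
qed

lemma u_space_derivative:
  assumes x: "x \<in> {0<..<1}" and t: "t \<in> {a..T}"
  shows "A_differentiable \<beta> (\<lambda>y. u y t) x" "A_expr \<beta> (\<lambda>y. u y t) x = Au x t"
proof -
  have w: "continuous_on {0..1} (\<lambda>y. Au y t)"
    unfolding Au_def by (rule eigen_series_slice(1)[OF lam_time_coeff_uniform_energy_tails t])
  have eq: "u y t = green \<beta> (\<lambda>y. Au y t) y" if "y \<in> {0<..<1}" for y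
    unfolding u_def Au_def
    using eigen_series_eq_green[OF time_coeff_uniform_energy_tails lam_time_coeff_uniform_energy_tails t, of y] that by simp
  note cong = A_expr_cong[of "\<lambda>y. u y t" "green \<beta> (\<lambda>y. Au y t)", OF eq x, of \<beta>]
  show "A_differentiable \<beta> (\<lambda>y. u y t) x" "A_expr \<beta> (\<lambda>y. u y t) x = Au x t"
    using cong A_expr_green[OF beta w x] by auto
qed

lemma u_classical_solution: "classical_solution \<alpha> \<beta> p a T f \<phi> u"
proof -
  have sub: "Omega a T \<subseteq> {0..1} \<times> {a..T}" by (auto simp: Omega_def)
  have closed: "closure (Omega a T) \<subseteq> {0..1} \<times> {a..T}"
    by (intro closure_minimal sub closed_Times closed_atLeastAtMost)
  have Om: "x \<in> {0..1}" "x \<in> {0<..<1}" "t \<in> {a..T}" "a < t" "t \<le> T" if "(x, t) \<in> Omega a T" for x t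
    using that by (auto simp: Omega_def)
  show ?thesis
    unfolding classical_solution_def
  proof (intro conjI ballI)
    show "continuous_on (closure (Omega a T)) (\<lambda>(x, t). u x t)"
      by (rule continuous_on_subset[OF u_continuous closed])
    show "continuous_on (Omega a T) (\<lambda>(x, t). caputo_hyper_Bessel \<alpha> p a T (u x) t)"
      by (rule continuous_on_eq[OF continuous_on_subset[OF Dt_u_continuous sub]])
        (auto simp: u_time_derivative(2)[OF Om(1,4,5)])
    show "continuous_on (Omega a T) (\<lambda>(x, t). A_expr \<beta> (\<lambda>y. u y t) x)"
      by (rule continuous_on_eq[OF continuous_on_subset[OF Au_continuous sub]])
        (auto simp: u_space_derivative(2)[OF Om(2,3)])
    show "case z of (x, t) \<Rightarrow> EK_differentiable \<alpha> p a T (u x) t" if "z \<in> Omega a T" for z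
      using that by (cases z) (simp add: u_time_derivative(1)[OF Om(1,4,5)])
    show "case z of (x, t) \<Rightarrow> A_differentiable \<beta> (\<lambda>y. u y t) x" if "z \<in> Omega a T" for z
      using that by (cases z) (simp add: u_space_derivative(1)[OF Om(2,3)])
    show "case z of (x, t) \<Rightarrow> caputo_hyper_Bessel \<alpha> p a T (u x) t + A_expr \<beta> (\<lambda>y. u y t) x = f x t"
      if "z \<in> Omega a T" for z
      using that by (cases z)
        (simp add: u_time_derivative(2)[OF Om(1,4,5)] u_space_derivative(2)[OF Om(2,3)] Dt_u_eq[OF Om(1,3)])
    show "(u x \<longlongrightarrow> \<phi> x) (at_right a)" if x: "x \<in> {0..1}" for x
    proof -
      have "(u x \<longlongrightarrow> u x a) (at a within {a..T})"
        using slice_continuous[OF u_continuous x] a by (auto simp: continuous_on_def)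
      then have "(u x \<longlongrightarrow> \<phi> x) (at a within {a..T})" by (simp add: u_initial[OF x])
      then show ?thesis
        using at_within_Icc_at_right[OF a(2)] by simp
    qed
    show "u 0 t = 0" "u 1 t = 0" if "t \<in> {a..T}" for t
      by (simp_all add: u_def v_boundary)
  qed
qed

end

theorem theorem7p2:
  fixes \<alpha> \<beta> \<theta> p a T :: real
    and \<phi> :: "real \<Rightarrow> real" and f :: "real \<Rightarrow> real \<Rightarrow> real"
    and v :: "nat \<Rightarrow> real \<Rightarrow> real" and lam :: "nat \<Rightarrow> real"
    and uk :: "nat \<Rightarrow> real \<Rightarrow> real"
  assumes "0 < \<alpha>" "\<alpha> < 1" "\<theta> < 1" "p = 1 - \<theta>" "0 \<le> a" "a < T"
    and "0 < \<beta>" "\<beta> < 1"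
    and "W12_dot \<beta> \<phi>"
    and "\<exists>\<psi>. friedrichs_A \<beta> \<phi> \<psi> \<and> W12_dot \<beta> \<psi>"
    and "C_W12_dot \<beta> a T f"
    and "\<exists>g. (\<forall>t\<in>{a..T}. friedrichs_A \<beta> (\<lambda>x. f x t) (\<lambda>x. g x t)) \<and> C_W12_dot \<beta> a T g"
    and "eigensystem \<beta> v lam"
    and "\<And>k t. uk k t =
           time_factor \<alpha> p a (lam k) (ip_01 \<phi> (v k)) (\<lambda>\<tau>. ip_01 (\<lambda>x. f x \<tau>) (v k)) t"
  shows "(\<forall>x\<in>{0..1}. \<forall>t\<in>{a..T}. summable (\<lambda>k. uk k t * v k x)) \<and>
         classical_solution \<alpha> \<beta> p a T f \<phi> (\<lambda>x t. \<Sum>k. uk k t * v k x)"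
proof -
  obtain \<psi> where \<psi>: "friedrichs_A \<beta> \<phi> \<psi>" "W12_dot \<beta> \<psi>" using assms(10) by blast
  obtain g where g: "\<And>t. t \<in> {a..T} \<Longrightarrow> friedrichs_A \<beta> (\<lambda>x. f x t) (\<lambda>x. g x t)" "C_W12_dot \<beta> a T g"
    using assms(12) by blast
  have "0 < p" using assms(3,4) by simp
  interpret diffusion_problem \<beta> v lam \<alpha> p a T \<phi> \<psi> f g
    by unfold_locales (fact assms \<psi> g \<open>0 < p\<close>)+
  have uk: "uk k t = time_coeff k t" for k t
    by (simp add: assms(14) time_coeff_def source_coeff_def[abs_def])
  show ?thesis
    using u_summable u_classical_solution by (simp add: uk u_def[abs_def])
qed

end
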